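(* There is a constant $C>0$ independent of the mesh size $h$ such that $$\|\mathcal G_h\|^2_{H^{-1}(\Omega)}\le C\,(\eta_1^2+\eta_2^2),$$ where $\mathcal G_h$ is the functional on $H^1_0(\Omega)$ given by $\mathcal G_h(v)=a_h(u-u_h,v)+(\lambda(u)-\lambda_h(u_h),v)_{-1,1}$ and $$\eta_1^2=\sum_{T\in\mathcal T_h}h_T^2\|f+\nabla\cdot(\nabla_wu_h)-\lambda_h(u_h)\|^2_{L^2(T)},\qquad \eta_2^2=\sum_{e\in\mathcal E_h^i}h_e\|[\![\nabla_wu_h]\!]\|^2_{L^2(e)}.$$
   Context: Continuous problem. $\Omega\subset\mathbb R^2$ is a bounded polygonal domain, assumed convex, with boundary $\Gamma$; $f\in L^2(\Omega)$; $\psi\in H^2(\Omega)$ with $\psi\le 0$ on $\Gamma$; $V=H^1_0(\Omega)$; $\mathcal K=\{v\in V: v\ge\psi \text{ a.e. in }\Omega\}$; $a(w,v)=\int_\Omega\nabla w\cdot\nabla v\,dx$, $L(v)=\int_\Omega fv\,dx$. $u\in\mathcal K$ is the unique solution of $a(u,v-u)\ge L(v-u)$ for all $v\in\mathcal K$. The continuous Lagrange multiplier $\lambda(u)\in H^{-1}(\Omega)$ is $(\lambda(u),v)_{-1,1}=L(v)-a(u,v)$ for $v\in V$, where $(\cdot,\cdot)_{-1,1}$ is the duality pairing of $H^{-1}(\Omega)$ and $H^1_0(\Omega)$. Mesh. $\mathcal T_h$ is a (conforming) triangulation of $\Omega$ from a shape-regular family, $h_T$ the diameter of $T$, $h=\max_T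 h_T$, $\mathcal E_h$ the set of all edges, $\mathcal E_h^i$ the interior edges, $\mathcal E_h^b$ the boundary edges, $h_e$ the length of $e$. On an interior edge $e$ shared by $T_1,T_2$ with outward unit normals $\boldsymbol n_1=-\boldsymbol n_2$, $\{\!\{w\}\!\}=\frac12(w|_{T_1}+w|_{T_2})$, $[\![w]\!]=w|_{T_1}\boldsymbol n_1+w|_{T_2}\boldsymbol n_2$ for scalar $w$, and $[\![\boldsymbol v]\!]=\boldsymbol v|_{T_1}\cdot\boldsymbol n_1+\boldsymbol v|_{T_2}\cdot\boldsymbol n_2$ for vector-valued $\boldsymbol v$; on a boundary edge $\{\!\{w\}\!\}=w$, $[\![w]\!]=w\boldsymbol n_e$ with $\boldsymbol n_e$ the outward unit normal. Discrete problem. $V_h^{0w}$ is the set of pairs $v_h=(v_h^0,v_h^b)$ with $v_h^0|_T\in\mathbb P_1(T)$ for all $T\in\mathcal T_h$ (no continuity imposed), $v_h^b|_e=\{\!\{v_h^0\}\!\}$ on interior edges, and $v_h^b=0$ on boundary edges. The discrete weak gradient $\nabla_w v_h|_T\in[\mathbb P_0(T)]^2$ is defined by $\int_T\nabla_w v_h\cdot\boldsymbol q\,dx=\int_{\partial T}\{\!\{v_h^0\}\!\}\boldsymbol q\cdot\boldsymbol n\,ds$ for all $\boldsymbol q\in[\mathbb P_0(T)]^2$. For $v\in H^1_0(\Omega)$ the convention $\nabla_w v=\nabla v$ is used, and all jumps of $v$ vanish; this extends $a_h$ below to $H^1_0(\Omega)+V_h^{0w}$. Set $a_h(w,v)=\sum_T\int_T\nabla_w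 w\cdot\nabla_w v\,dx+\sum_{e\in\mathcal E_h}\frac1{h_e}\int_e[\![w^0]\!]\cdot[\![v^0]\!]\,ds$, $L(v_h)=\sum_T\int_T f v_h^0\,dx$, and $\mathcal K_h=\{v_h\in V_h^{0w}:\int_T v_h^0\,dx\ge\int_T\psi\,dx\ \forall T\in\mathcal T_h\}$. $u_h\in\mathcal K_h$ is the unique solution of $a_h(u_h,v_h-u_h)\ge L(v_h-u_h)$ for all $v_h\in\mathcal K_h$. Discrete multiplier. $W_h$ is the space of functions that are constant on each $T$; $\pi_h^0v_h|_T=\frac1{|T|}\int_Tv_h^0\,dx$; the right inverse $\pi_h^{-1}:W_h\to V_h^{0w}$ sends $w_h$ to $(w_h,q_h^b)$ with $q_h^b=\{\!\{w_h\}\!\}$ on interior edges and $0$ on boundary edges. $\lambda_h(u_h)\in W_h$ is defined by $(\lambda_h(u_h),w_h)_{L^2(\Omega)}=L(\pi_h^{-1}w_h)-a_h(u_h,\pi_h^{-1}w_h)$ for all $w_h\in W_h$; it acts on $v\in V$ by $(\lambda_h(u_h),v)_{-1,1}=\int_\Omega\lambda_h(u_h)v\,dx$. Thus $\mathcal G_h(v)=\sum_T\int_T(\nabla u-\nabla_wu_h)\cdot\nabla v\,dx+(\lambda(u)-\lambda_h(u_h),v)_{-1,1}$ for $v\in H^1_0(\Omega)$, and $\|\mathcal G_h\|_{H^{-1}(\Omega)}=\sup_{0\ne v\in H^1_0(\Omega)}\mathcal G_h(v)/\|v\|_{H^1(\Omega)}$. *)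

theory Defs
  imports "HOL-Analysis.Analysis"
begin

section \<open>Sobolev spaces\<close>

text \<open>
  Elements of Lebesgue and Sobolev spaces are represented by functions on the whole plane, of
  which only the values almost everywhere in \<open>\<Omega>\<close> matter.
\<close>

type_synonym plane = "real^2"

definition partial_deriv :: "2 \<Rightarrow> (plane \<Rightarrow> real) \<Rightarrow> plane \<Rightarrow> real" where
  "partial_deriv i \<phi> x = frechet_derivative \<phi> (at x) (axis i 1)"

primrec C_k :: "nat \<Rightarrow> (plane \<Rightarrow> real) \<Rightarrow> bool" where
  "C_k 0 \<phi> \<longleftrightarrow> continuous_on UNIV \<phi>"
| "C_k (Suc k) \<phi> \<longleftrightarrow> (\<forall>x. \<phi> differentiable at x) \<and> (\<forall>i. C_k k (partial_deriv i \<phi>))"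

definition test_functions :: "plane set \<Rightarrow> (plane \<Rightarrow> real) set" where
  "test_functions \<Omega> =
     {\<phi>. (\<forall>k. C_k k \<phi>) \<and> (\<exists>K. compact K \<and> K \<subseteq> \<Omega> \<and> (\<forall>x. x \<notin> K \<longrightarrow> \<phi> x = 0))}"

definition L2 :: "plane set \<Rightarrow> (plane \<Rightarrow> real) set" where
  "L2 \<Omega> = {v. v \<in> borel_measurable (lebesgue_on \<Omega>) \<and> integrable (lebesgue_on \<Omega>) (\<lambda>x. (v x)\<^sup>2)}"

definition L2_norm :: "plane set \<Rightarrow> (plane \<Rightarrow> real) \<Rightarrow> real" where
  "L2_norm \<Omega> v = sqrt (LINT x|lebesgue_on \<Omega>. (v x)\<^sup>2)"

definition has_weak_grad :: "plane set \<Rightarrow> (plane \<Rightarrow> real) \<Rightarrow> (plane \<Rightarrow> plane) \<Rightarrow> bool" where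
  "has_weak_grad \<Omega> v g \<longleftrightarrow>
     v \<in> L2 \<Omega> \<and> (\<forall>i. (\<lambda>x. g x $ i) \<in> L2 \<Omega>) \<and>
     (\<forall>\<phi>\<in>test_functions \<Omega>. \<forall>i.
        (LINT x|lebesgue_on \<Omega>. v x * partial_deriv i \<phi> x) = - (LINT x|lebesgue_on \<Omega>. g x $ i * \<phi> x))"

text \<open>The weak gradient is unique up to null sets; a representative is chosen.\<close>

definition grad :: "plane set \<Rightarrow> (plane \<Rightarrow> real) \<Rightarrow> plane \<Rightarrow> plane" where
  "grad \<Omega> v = (SOME g. has_weak_grad \<Omega> v g)"

definition H1 :: "plane set \<Rightarrow> (plane \<Rightarrow> real) set" where
  "H1 \<Omega> = {v. \<exists>g. has_weak_grad \<Omega> v g}"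

definition H1_norm :: "plane set \<Rightarrow> (plane \<Rightarrow> real) \<Rightarrow> real" where
  "H1_norm \<Omega> v =
     sqrt ((LINT x|lebesgue_on \<Omega>. (v x)\<^sup>2) + (LINT x|lebesgue_on \<Omega>. grad \<Omega> v x \<bullet> grad \<Omega> v x))"

definition H10 :: "plane set \<Rightarrow> (plane \<Rightarrow> real) set" where
  "H10 \<Omega> = {v \<in> H1 \<Omega>. \<forall>\<epsilon>>0. \<exists>\<phi>\<in>test_functions \<Omega>. H1_norm \<Omega> (v - \<phi>) < \<epsilon>}"

definition H2 :: "plane set \<Rightarrow> (plane \<Rightarrow> real) set" where
  "H2 \<Omega> = {v. \<exists>g. has_weak_grad \<Omega> v g \<and> (\<forall>i. (\<lambda>x. g x $ i) \<in> H1 \<Omega>)}"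

text \<open>
  Functions in \<open>H2 \<Omega>\<close> (\<open>\<Omega>\<close> a Lipschitz domain in the plane) have a unique representative that is
  continuous up to the boundary; boundary values are those of this representative.
\<close>

definition nonpos_on_boundary :: "plane set \<Rightarrow> (plane \<Rightarrow> real) \<Rightarrow> bool" where
  "nonpos_on_boundary \<Omega> \<psi> \<longleftrightarrow>
     (\<exists>\<psi>'. continuous_on (closure \<Omega>) \<psi>' \<and> (AE x in lebesgue_on \<Omega>. \<psi>' x = \<psi> x) \<and>
           (\<forall>x\<in>frontier \<Omega>. \<psi>' x \<le> 0))"

text \<open>
  The norm of a functional on \<open>H10 \<Omega>\<close>, taken in the extended reals so that an unbounded
  functional has norm \<open>\<infinity>\<close>. The condition excludes the zero element of \<open>H10 \<Omega>\<close>.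
\<close>

definition Hm1_norm :: "plane set \<Rightarrow> ((plane \<Rightarrow> real) \<Rightarrow> real) \<Rightarrow> ereal" where
  "Hm1_norm \<Omega> G =
     (SUP v \<in> {v \<in> H10 \<Omega>. \<not> (AE x in lebesgue_on \<Omega>. v x = 0)}. ereal (G v / H1_norm \<Omega> v))"


section \<open>The obstacle problem\<close>

definition convex_polygonal_domain :: "plane set \<Rightarrow> bool" where
  "convex_polygonal_domain \<Omega> \<longleftrightarrow> open \<Omega> \<and> \<Omega> \<noteq> {} \<and> bounded \<Omega> \<and> convex \<Omega> \<and> polytope (closure \<Omega>)"

definition a_form :: "plane set \<Rightarrow> (plane \<Rightarrow> real) \<Rightarrow> (plane \<Rightarrow> real) \<Rightarrow> real" where
  "a_form \<Omega> w v = (LINT x|lebesgue_on \<Omega>. grad \<Omega> w x \<bullet> grad \<Omega> v x)"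

definition L_form :: "plane set \<Rightarrow> (plane \<Rightarrow> real) \<Rightarrow> (plane \<Rightarrow> real) \<Rightarrow> real" where
  "L_form \<Omega> f v = (LINT x|lebesgue_on \<Omega>. f x * v x)"

definition K_set :: "plane set \<Rightarrow> (plane \<Rightarrow> real) \<Rightarrow> (plane \<Rightarrow> real) set" where
  "K_set \<Omega> \<psi> = {v \<in> H10 \<Omega>. AE x in lebesgue_on \<Omega>. \<psi> x \<le> v x}"

definition obstacle_solution ::
    "plane set \<Rightarrow> (plane \<Rightarrow> real) \<Rightarrow> (plane \<Rightarrow> real) \<Rightarrow> (plane \<Rightarrow> real) \<Rightarrow> bool" where
  "obstacle_solution \<Omega> f \<psi> u \<longleftrightarrow>
     u \<in> K_set \<Omega> \<psi> \<and> (\<forall>v\<in>K_set \<Omega> \<psi>. a_form \<Omega> u (v - u) \<ge> L_form \<Omega> f (v - u))"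

definition multiplier ::
    "plane set \<Rightarrow> (plane \<Rightarrow> real) \<Rightarrow> (plane \<Rightarrow> real) \<Rightarrow> (plane \<Rightarrow> real) \<Rightarrow> real" where
  "multiplier \<Omega> f u v = L_form \<Omega> f v - a_form \<Omega> u v"


section \<open>Meshes\<close>

type_synonym mesh = "plane set set"

text \<open>Triangles are closed; \<^const>\<open>triangulation\<close> contains the conformity condition.\<close>

definition mesh_of :: "plane set \<Rightarrow> mesh \<Rightarrow> bool" where
  "mesh_of \<Omega> M \<longleftrightarrow> triangulation M \<and> (\<forall>T\<in>M. 2 simplex T) \<and> \<Union>M = closure \<Omega>"

definition shape_regular :: "mesh set \<Rightarrow> bool" where
  "shape_regular F \<longleftrightarrow> (\<exists>\<kappa>>0. \<forall>M\<in>F. \<forall>T\<in>M. \<exists>x. ball x (\<kappa> * diameter T) \<subseteq> T)"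

definition edges :: "mesh \<Rightarrow> plane set set" where
  "edges M = {e. \<exists>T\<in>M. e edge_of T}"

definition adjacent :: "mesh \<Rightarrow> plane set \<Rightarrow> plane set set" where
  "adjacent M e = {T \<in> M. e edge_of T}"

text \<open>
  In a conforming triangulation of \<open>\<Omega>\<close> each edge belongs to one triangle (when it lies on the
  boundary of \<open>\<Omega>\<close>) or to two.
\<close>

definition interior_edges :: "mesh \<Rightarrow> plane set set" where
  "interior_edges M = {e \<in> edges M. card (adjacent M e) = 2}"

definition boundary_edges :: "mesh \<Rightarrow> plane set set" where
  "boundary_edges M = {e \<in> edges M. card (adjacent M e) = 1}"

text \<open>
  The inequality forces the normal to be orthogonal to \<open>e\<close> (exchange two points of \<open>e\<close>) and to
  point out of \<open>T\<close>.
\<close>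

definition outward_normal :: "plane set \<Rightarrow> plane set \<Rightarrow> plane" where
  "outward_normal T e = (THE n. norm n = 1 \<and> (\<forall>x\<in>e. \<forall>y\<in>T. n \<bullet> (y - x) \<le> 0))"

text \<open>Arc length integral; it does not depend on the order of the endpoints.\<close>

definition edge_integral :: "plane set \<Rightarrow> (plane \<Rightarrow> real) \<Rightarrow> real" where
  "edge_integral e g =
     (let (a, b) = (SOME (a, b). e = closed_segment a b)
      in dist a b * (LINT t|lebesgue_on {0..1}. g ((1 - t) *\<^sub>R a + t *\<^sub>R b)))"


section \<open>Weak Galerkin discretization\<close>

text \<open>
  A piecewise function \<open>v\<close> assigns to each triangle \<open>T\<close> a function \<open>v T\<close>, the restriction of \<open>v\<close>
  to \<open>T\<close>, so that one-sided traces on edges are available. A function on the skeleton assigns a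
  function to each edge.
\<close>

type_synonym piecewise = "plane set \<Rightarrow> plane \<Rightarrow> real"
type_synonym weak_fun = "piecewise \<times> (plane set \<Rightarrow> plane \<Rightarrow> real)"

text \<open>
  With one adjacent triangle (boundary edge) the average is the one-sided trace and the jump is
  the trace times the outward normal; with two, these are the usual average and jump.
\<close>

definition avg :: "mesh \<Rightarrow> piecewise \<Rightarrow> plane set \<Rightarrow> plane \<Rightarrow> real" where
  "avg M w e x = (\<Sum>T\<in>adjacent M e. w T x) / real (card (adjacent M e))"

definition jump :: "mesh \<Rightarrow> piecewise \<Rightarrow> plane set \<Rightarrow> plane \<Rightarrow> plane" where
  "jump M w e x = (\<Sum>T\<in>adjacent M e. w T x *\<^sub>R outward_normal T e)"

definition vjump :: "mesh \<Rightarrow> (plane set \<Rightarrow> plane \<Rightarrow> plane) \<Rightarrow> plane set \<Rightarrow> plane \<Rightarrow> real" where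
  "vjump M q e x = (\<Sum>T\<in>adjacent M e. q T x \<bullet> outward_normal T e)"

definition V_h :: "mesh \<Rightarrow> weak_fun set" where
  "V_h M = {(v0, vb).
     (\<forall>T\<in>M. \<exists>c p. \<forall>x. v0 T x = c + p \<bullet> x) \<and>
     (\<forall>e\<in>interior_edges M. \<forall>x\<in>e. vb e x = avg M v0 e x) \<and>
     (\<forall>e\<in>boundary_edges M. \<forall>x\<in>e. vb e x = 0)}"

definition W_h :: "mesh \<Rightarrow> piecewise set" where
  "W_h M = {w. \<forall>T\<in>M. \<exists>c. \<forall>x. w T x = c}"

text \<open>
  The boundary integrals involve the averages of \<open>v\<^sup>0\<close>, hence on boundary edges the trace of \<open>v\<^sup>0\<close>
  and not the vanishing component \<open>v\<^sup>b\<close>.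
\<close>

definition weak_grad :: "mesh \<Rightarrow> weak_fun \<Rightarrow> plane set \<Rightarrow> plane" where
  "weak_grad M v T =
     (THE g. \<forall>q. (LINT x|lebesgue_on T. g \<bullet> q) =
        (\<Sum>e\<in>{e. e edge_of T}. edge_integral e (\<lambda>x. avg M (fst v) e x * (q \<bullet> outward_normal T e))))"

definition a_h :: "mesh \<Rightarrow> weak_fun \<Rightarrow> weak_fun \<Rightarrow> real" where
  "a_h M w v =
     (\<Sum>T\<in>M. LINT x|lebesgue_on T. weak_grad M w T \<bullet> weak_grad M v T) +
     (\<Sum>e\<in>edges M. 1 / diameter e * edge_integral e (\<lambda>x. jump M (fst w) e x \<bullet> jump M (fst v) e x))"

text \<open>
  The extension of \<^const>\<open>a_h\<close> to sums of an element of \<open>H10 \<Omega>\<close> and an element of \<open>V_h M\<close>, given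
  as pairs of the two summands: the weak gradient of the first summand is its gradient, and the
  jumps of the first summand vanish.
\<close>

definition a_h_sum ::
    "plane set \<Rightarrow> mesh \<Rightarrow> (plane \<Rightarrow> real) \<times> weak_fun \<Rightarrow> (plane \<Rightarrow> real) \<times> weak_fun \<Rightarrow> real" where
  "a_h_sum \<Omega> M = (\<lambda>(w, w\<^sub>h) (v, v\<^sub>h).
     (\<Sum>T\<in>M. LINT x|lebesgue_on T.
        (grad \<Omega> w x + weak_grad M w\<^sub>h T) \<bullet> (grad \<Omega> v x + weak_grad M v\<^sub>h T)) +
     (\<Sum>e\<in>edges M. 1 / diameter e *
        edge_integral e (\<lambda>x. jump M (fst w\<^sub>h) e x \<bullet> jump M (fst v\<^sub>h) e x)))"

definition L_h :: "mesh \<Rightarrow> (plane \<Rightarrow> real) \<Rightarrow> weak_fun \<Rightarrow> real" where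
  "L_h M f v = (\<Sum>T\<in>M. LINT x|lebesgue_on T. f x * fst v T x)"

definition K_h :: "mesh \<Rightarrow> (plane \<Rightarrow> real) \<Rightarrow> weak_fun set" where
  "K_h M \<psi> =
     {v \<in> V_h M. \<forall>T\<in>M. (LINT x|lebesgue_on T. fst v T x) \<ge> (LINT x|lebesgue_on T. \<psi> x)}"

definition discrete_solution ::
    "mesh \<Rightarrow> (plane \<Rightarrow> real) \<Rightarrow> (plane \<Rightarrow> real) \<Rightarrow> weak_fun \<Rightarrow> bool" where
  "discrete_solution M f \<psi> u\<^sub>h \<longleftrightarrow>
     u\<^sub>h \<in> K_h M \<psi> \<and> (\<forall>v\<^sub>h\<in>K_h M \<psi>. a_h M u\<^sub>h (v\<^sub>h - u\<^sub>h) \<ge> L_h M f (v\<^sub>h - u\<^sub>h))"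

definition pi_inv :: "mesh \<Rightarrow> piecewise \<Rightarrow> weak_fun" where
  "pi_inv M w = (w, \<lambda>e x. if e \<in> interior_edges M then avg M w e x else 0)"

definition discrete_multiplier ::
    "mesh \<Rightarrow> (plane \<Rightarrow> real) \<Rightarrow> weak_fun \<Rightarrow> piecewise \<Rightarrow> bool" where
  "discrete_multiplier M f u\<^sub>h lam\<^sub>h \<longleftrightarrow>
     lam\<^sub>h \<in> W_h M \<and>
     (\<forall>w\<in>W_h M. (\<Sum>T\<in>M. LINT x|lebesgue_on T. lam\<^sub>h T x * w T x) =
        L_h M f (pi_inv M w) - a_h M u\<^sub>h (pi_inv M w))"


section \<open>Residual functional and error estimators\<close>

definition G_h ::
    "plane set \<Rightarrow> mesh \<Rightarrow> (plane \<Rightarrow> real) \<Rightarrow> (plane \<Rightarrow> real) \<Rightarrow> weak_fun \<Rightarrow> piecewise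
      \<Rightarrow> (plane \<Rightarrow> real) \<Rightarrow> real" where
  "G_h \<Omega> M f u u\<^sub>h lam\<^sub>h v =
     a_h_sum \<Omega> M (u, - u\<^sub>h) (v, (\<lambda>T x. 0, \<lambda>e x. 0)) +
     (multiplier \<Omega> f u v - (\<Sum>T\<in>M. LINT x|lebesgue_on T. lam\<^sub>h T x * v x))"

definition divergence :: "(plane \<Rightarrow> plane) \<Rightarrow> plane \<Rightarrow> real" where
  "divergence q x = (\<Sum>i\<in>UNIV. partial_deriv i (\<lambda>y. q y $ i) x)"

definition eta1 :: "mesh \<Rightarrow> (plane \<Rightarrow> real) \<Rightarrow> weak_fun \<Rightarrow> piecewise \<Rightarrow> real" where
  "eta1 M f u\<^sub>h lam\<^sub>h =
     sqrt (\<Sum>T\<in>M. (diameter T)\<^sup>2 *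
       (L2_norm T (\<lambda>x. f x + divergence (\<lambda>y. weak_grad M u\<^sub>h T) x - lam\<^sub>h T x))\<^sup>2)"

definition eta2 :: "mesh \<Rightarrow> weak_fun \<Rightarrow> real" where
  "eta2 M u\<^sub>h =
     sqrt (\<Sum>e\<in>interior_edges M. diameter e *
       edge_integral e (\<lambda>x. (vjump M (\<lambda>T y. weak_grad M u\<^sub>h T) e x)\<^sup>2))"

end

theory Submission
  imports Defs
begin

text \<open>
  The gradient of \<open>u\<close> cancels in \<open>G_h\<close>: the multiplier of \<open>u\<close> contains \<open>- a(u, v)\<close>, so that
  \<open>G_h v\<close> is the residual \<open>\<Sum>T. (\<integral>T (f - lam\<^sub>h) v - g\<^sub>T \<bullet> \<integral>T \<nabla>v)\<close>, where the vector \<open>g\<^sub>T\<close> is the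
  discrete weak gradient of \<open>u\<^sub>h\<close> on \<open>T\<close> (\<open>G_h_eq_residual\<close>). What is left is the residual-based
  a posteriori argument: subtract a discrete function, integrate by parts on each triangle, and
  estimate the interpolation error.

  The residual satisfies a Galerkin orthogonality (\<open>discrete_orthogonality\<close>). The discrete
  obstacle condition sees only the means over triangles, so a piecewise affine function with
  vanishing means may be added to \<open>u\<^sub>h\<close> and subtracted from it (\<open>mean_zero_variation\<close>), and on
  such functions the variational inequality is an equality; on piecewise constants the equality
  is the definition of the discrete multiplier. For a continuous piecewise affine \<open>w\<close> that
  vanishes on the boundary the jump terms of \<open>a_h\<close> vanish as well, so \<open>v\<close> may be replaced by
  \<open>v - w\<close>. Because \<open>g\<^sub>T\<close> is constant, the divergence theorem on \<open>T\<close> leaves only boundary terms,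
  and these combine to the normal jumps of \<open>g\<close> over interior edges times the integrals of
  \<open>v - w\<close> over these edges (\<open>residual_representation\<close>).

  By the Cauchy--Schwarz inequality it remains to find \<open>w\<close> such that the squares of
  \<open>\<parallel>v - w\<parallel>\<^sub>T / h\<^sub>T\<close>, summed over triangles, and the squares of the means of \<open>v - w\<close> over edges,
  summed over edges, are bounded by a multiple of \<open>\<parallel>\<nabla>v\<parallel>\<^sup>2\<close>. A quasi-interpolant of Scott--Zhang
  type does this: its value at an interior vertex is the mean of \<open>v\<close> over one edge there, and at
  a boundary vertex it is zero. The means over two edges of one triangle differ by at most a
  multiple of \<open>\<parallel>\<nabla>v\<parallel>\<^sub>T\<close>, independently of the size of the triangle (\<open>edge_mean_oscillation\<close>), so
  going around a vertex from edge to edge costs no more than the gradient on the surrounding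
  triangles (\<open>nodal_oscillation\<close>). That the triangles at a vertex can be reached from one
  another through common edges, or else a boundary edge is met, on which \<open>v\<close> vanishes, is a
  topological fact (\<open>star_covers_ball\<close>); that their number is bounded is a comparison of areas
  (\<open>card_star_le\<close>). A Poincare inequality with an edge mean in place of the mean over the
  triangle (\<open>triangle_Poincare\<close>) turns closeness of means into closeness in the \<open>L2\<close> norm.

  All of this is done for test functions \<open>v\<close>, where classical calculus applies, and carried over
  to \<open>H10 \<Omega>\<close> by density (\<open>H10_bound_from_test_functions\<close>). Since gradients are arbitrary
  representatives, this uses that the mean of a weak gradient over a triangle is determined by
  the function (\<open>weak_grad_integral_unique\<close>), shown with explicit bump functions. Bump functions
  are also needed at the end: the norm of a functional is a supremum in the extended reals, and
  over an empty set of functions it would be \<open>-\<infinity>\<close>, with square \<open>\<infinity>\<close>.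
\<close>

section \<open>Smooth bump functions\<close>

lemma partial_deriv_eq:
  assumes "(f has_derivative D) (at x)"
  shows "partial_deriv i f x = D (axis i 1)"
  using frechet_derivative_at[OF assms] by (simp add: partial_deriv_def)

lemma C_k_Suc_imp_C_k: "C_k (Suc k) f \<Longrightarrow> C_k k f"
proof (induction k arbitrary: f)
  case 0
  then show ?case
    by (auto intro!: continuous_at_imp_continuous_on differentiable_imp_continuous_within)
qed auto

lemma C_k_const: "C_k k (\<lambda>x. c)"
proof (induction k arbitrary: c)
  case (Suc k)
  have "partial_deriv i (\<lambda>x. c) = (\<lambda>x. 0)" for i
    by (rule ext) (use partial_deriv_eq[OF has_derivative_const] in simp)
  then show ?case using Suc by simp
qed simp

lemma C_k_add: "C_k k f \<Longrightarrow> C_k k g \<Longrightarrow> C_k k (\<lambda>x. f x + g x)"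
proof (induction k arbitrary: f g)
  case 0
  then show ?case by (auto intro: continuous_intros)
next
  case (Suc k)
  have "partial_deriv i (\<lambda>x. f x + g x) = (\<lambda>x. partial_deriv i f x + partial_deriv i g x)" for i
  proof
    fix x
    have "(f has_derivative frechet_derivative f (at x)) (at x)"
      "(g has_derivative frechet_derivative g (at x)) (at x)"
      using Suc.prems by (simp_all add: frechet_derivative_works[symmetric])
    from partial_deriv_eq[OF has_derivative_add[OF this]]
    show "partial_deriv i (\<lambda>x. f x + g x) x = partial_deriv i f x + partial_deriv i g x"
      by (simp add: partial_deriv_def)
  qed
  then show ?case using Suc by (auto intro: differentiable_add)
qed

lemma partial_deriv_mult:
  assumes "f differentiable at x" "g differentiable at x"
  shows "partial_deriv i (\<lambda>x. f x * g x) x = f x * partial_deriv i g x + partial_deriv i f x * g x"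
proof -
  have "(f has_derivative frechet_derivative f (at x)) (at x)"
    "(g has_derivative frechet_derivative g (at x)) (at x)"
    using assms frechet_derivative_works by auto
  from partial_deriv_eq[OF has_derivative_mult[OF this]]
  show ?thesis by (simp add: partial_deriv_def)
qed

lemma C_k_mult: "C_k k f \<Longrightarrow> C_k k g \<Longrightarrow> C_k k (\<lambda>x. f x * g x)"
proof (induction k arbitrary: f g)
  case 0
  then show ?case by (auto intro: continuous_intros)
next
  case (Suc k)
  have "partial_deriv i (\<lambda>x. f x * g x) =
      (\<lambda>x. f x * partial_deriv i g x + partial_deriv i f x * g x)" for i
    using Suc.prems partial_deriv_mult by auto
  moreover have "C_k k f" "C_k k g"
    using Suc.prems C_k_Suc_imp_C_k by auto
  ultimately show ?case
    using Suc by (auto intro!: C_k_add)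
qed

text \<open>
  For \<open>t > 0\<close> this is \<open>p (1/t) e^(-1/t)\<close>. The polynomial factor makes the family closed under
  differentiation, which is what makes smoothness provable by induction; the member \<open>p = 1\<close> is
  the classical smooth function that vanishes exactly for \<open>t \<le> 0\<close>.
\<close>

definition flat_exp :: "real poly \<Rightarrow> real \<Rightarrow> real" where
  "flat_exp p t = (if t > 0 then poly p (inverse t) * exp (- inverse t) else 0)"

lemma poly_times_exp_minus_tendsto_0:
  fixes p :: "real poly"
  shows "((\<lambda>s. poly p s * exp (- s)) \<longlongrightarrow> 0) at_top"
proof -
  have "((\<lambda>s. \<Sum>i\<le>degree p. coeff p i * (s ^ i / exp s)) \<longlongrightarrow> (\<Sum>i\<le>degree p. coeff p i * 0)) at_top"
    by (intro tendsto_sum tendsto_mult tendsto_const tendsto_power_div_exp_0)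
  then show ?thesis
    by (simp add: poly_altdef sum_distrib_right exp_minus divide_inverse mult.assoc)
qed

lemma flat_tendsto_0: "((\<lambda>t. flat_exp p t) \<longlongrightarrow> 0) (at_right 0)"
proof -
  have "((\<lambda>t. poly p (inverse t) * exp (- inverse t)) \<longlongrightarrow> 0) (at_right (0::real))"
    using filterlim_compose[OF poly_times_exp_minus_tendsto_0 filterlim_inverse_at_top_right] .
  then show ?thesis
    by (rule Lim_transform_eventually) (auto simp: flat_exp_def eventually_at_filter)
qed

text \<open>
  The derivative of \<open>p (1/t) e^(-1/t)\<close> is \<open>(1/t)^2 (p - p') (1/t) e^(-1/t)\<close>, and at \<open>0\<close> the
  difference quotient belongs to the same family, hence tends to zero.
\<close>

lemma flat_has_derivative:
  "(flat_exp p has_real_derivative flat_exp ([:0, 0, 1:] * (p - pderiv p)) t) (at t)"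
proof -
  consider "t > 0" | "t < 0" | "t = 0" by linarith
  then show ?thesis
  proof cases
    case 1
    have "((\<lambda>t. poly p (inverse t) * exp (- inverse t)) has_real_derivative
        flat_exp ([:0, 0, 1:] * (p - pderiv p)) t) (at t)"
      using 1 by (auto intro!: derivative_eq_intros DERIV_chain2[OF poly_DERIV] simp: flat_exp_def)
         (simp add: algebra_simps)
    then show ?thesis
      by (rule has_field_derivative_transform_within_open[where S="{0<..}"]) (use 1 in \<open>auto simp: flat_exp_def\<close>)
  next
    case 2
    have "((\<lambda>t. 0) has_real_derivative flat_exp ([:0, 0, 1:] * (p - pderiv p)) t) (at t)"
      using 2 by (auto simp: flat_exp_def)
    then show ?thesis
      by (rule has_field_derivative_transform_within_open[where S="{..<0}"]) (use 2 in \<open>auto simp: flat_exp_def\<close>)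
  next
    case 3
    have "((\<lambda>h. (flat_exp p (0 + h) - flat_exp p 0) / h) \<longlongrightarrow> 0) (at 0)"
    proof (rule filterlim_split_at)
      show "((\<lambda>h. (flat_exp p (0 + h) - flat_exp p 0) / h) \<longlongrightarrow> 0) (at_left 0)"
        by (rule Lim_transform_eventually[OF tendsto_const])
           (auto simp: flat_exp_def eventually_at_filter)
      show "((\<lambda>h. (flat_exp p (0 + h) - flat_exp p 0) / h) \<longlongrightarrow> 0) (at_right 0)"
        by (rule Lim_transform_eventually[OF flat_tendsto_0[of "[:0,1:] * p"]])
           (auto simp: flat_exp_def eventually_at_filter field_simps)
    qed
    then show ?thesis
      using 3 by (simp add: DERIV_def flat_exp_def)
  qed
qed

lemma flat_affine_has_derivative:
  fixes q :: plane
  shows "((\<lambda>x. flat_exp p (q \<bullet> x + d)) has_derivative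
      (\<lambda>h. flat_exp ([:0, 0, 1:] * (p - pderiv p)) (q \<bullet> x + d) * (q \<bullet> h))) (at x)"
proof -
  have "((\<lambda>x. q \<bullet> x + d) has_derivative (\<lambda>h. q \<bullet> h)) (at x)"
    by (auto intro!: derivative_eq_intros)
  from DERIV_compose_FDERIV[OF flat_has_derivative this] show ?thesis
    by (simp add: mult.commute)
qed

text \<open>
  Smooth cut-offs at a half plane; products of three of them will be the bump functions on
  triangles.
\<close>

lemma C_k_flat_affine: "C_k k (\<lambda>x. flat_exp p (q \<bullet> x + d))"
proof (induction k arbitrary: p)
  case 0
  then show ?case
    by (auto intro!: continuous_at_imp_continuous_on has_derivative_continuous[OF flat_affine_has_derivative])
next
  case (Suc k)
  have "partial_deriv i (\<lambda>x. flat_exp p (q \<bullet> x + d)) =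
      (\<lambda>x. flat_exp ([:0, 0, 1:] * (p - pderiv p)) (q \<bullet> x + d) * (q \<bullet> axis i 1))" for i
    by (rule ext, rule partial_deriv_eq[OF flat_affine_has_derivative])
  then show ?case
    using Suc differentiableI[OF flat_affine_has_derivative] by (simp add: C_k_mult C_k_const)
qed

lemma flat_1_bounds: "0 \<le> flat_exp 1 t" "flat_exp 1 t \<le> 1"
  by (auto simp: flat_exp_def)

lemma flat_1_pos: "t > 0 \<Longrightarrow> flat_exp 1 t > 0"
  by (auto simp: flat_exp_def)

text \<open>
  The shift by \<open>1\<close> keeps the support away from \<open>t = 0\<close>, and the scaling lets it exhaust \<open>t > 0\<close>.
\<close>

lemma flat_1_tendsto_1:
  assumes "t > 0"
  shows "(\<lambda>n. flat_exp 1 (real n * t - 1)) \<longlonglongrightarrow> 1"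
proof -
  have "filterlim (\<lambda>n. real n * t) at_top sequentially"
    using filterlim_at_top_mult_tendsto_pos[OF tendsto_const assms filterlim_real_sequentially] .
  then have lim: "filterlim (\<lambda>n. real n * t - 1) at_top sequentially"
    using filterlim_tendsto_add_at_top[OF tendsto_const[of "-1"]] by simp
  have "(\<lambda>n. exp (- inverse (real n * t - 1))) \<longlonglongrightarrow> exp (- 0)"
    by (intro tendsto_intros tendsto_inverse_0_at_top lim)
  moreover have "\<forall>\<^sub>F n in sequentially. exp (- inverse (real n * t - 1)) = flat_exp 1 (real n * t - 1)"
    using lim[unfolded filterlim_at_top_dense, rule_format, of 0]
    by (rule eventually_mono) (simp add: flat_exp_def)
  ultimately show ?thesis
    by (simp add: tendsto_cong)
qed

text \<open>
  The pointwise gradient, in contrast to \<^const>\<open>grad\<close>, which even for a smooth function is only some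
  representative up to null sets.
\<close>

definition classical_grad :: "(plane \<Rightarrow> real) \<Rightarrow> plane \<Rightarrow> plane" where
  "classical_grad \<phi> x = (\<chi> i. partial_deriv i \<phi> x)"

lemma vec2_eq_sum_axis: "(h :: plane) = h $ 1 *\<^sub>R axis 1 1 + h $ 2 *\<^sub>R axis 2 1"
  by (simp add: vec_eq_iff forall_2 axis_def)

lemma inner_plane: "(x::plane) \<bullet> y = x $ 1 * y $ 1 + x $ 2 * y $ 2"
  by (simp add: inner_vec_def sum_2)

lemma differentiable_has_classical_grad:
  assumes "\<phi> differentiable at x"
  shows "(\<phi> has_derivative (\<lambda>h. classical_grad \<phi> x \<bullet> h)) (at x)"
proof -
  let ?D = "frechet_derivative \<phi> (at x)"
  have D: "(\<phi> has_derivative ?D) (at x)"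
    using assms frechet_derivative_works by blast
  interpret linear ?D
    using D has_derivative_linear by blast
  have "?D h = classical_grad \<phi> x \<bullet> h" for h
  proof -
    have "?D h = ?D (h $ 1 *\<^sub>R axis 1 1 + h $ 2 *\<^sub>R axis 2 1)"
      using vec2_eq_sum_axis[of h] by simp
    also have "\<dots> = classical_grad \<phi> x \<bullet> h"
      unfolding add scale by (simp add: inner_plane classical_grad_def partial_deriv_def)
    finally show ?thesis .
  qed
  then have "?D = (\<lambda>h. classical_grad \<phi> x \<bullet> h)" by auto
  with D show ?thesis by simp
qed

lemma C_k_1_classical_grad:
  assumes "C_k 1 \<phi>"
  shows "(\<phi> has_derivative (\<lambda>h. classical_grad \<phi> x \<bullet> h)) (at x)"
    and "continuous_on UNIV (classical_grad \<phi>)" and "continuous_on UNIV \<phi>"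
proof -
  show "(\<phi> has_derivative (\<lambda>h. classical_grad \<phi> x \<bullet> h)) (at x)"
    using assms by (intro differentiable_has_classical_grad) simp
  show "continuous_on UNIV (classical_grad \<phi>)"
    unfolding classical_grad_def using assms by (intro continuous_on_vec_lambda) simp
  show "continuous_on UNIV \<phi>"
    using C_k_Suc_imp_C_k[of 0 \<phi>] assms by simp
qed

lemma test_functionsD:
  assumes "\<phi> \<in> test_functions \<Omega>"
  shows "C_k k \<phi>" and "\<exists>K. compact K \<and> K \<subseteq> \<Omega> \<and> (\<forall>x. x \<notin> K \<longrightarrow> \<phi> x = 0)"
  using assms by (auto simp: test_functions_def)

lemma partial_deriv_test_function:
  assumes "\<phi> \<in> test_functions \<Omega>"
  shows "partial_deriv i \<phi> \<in> test_functions \<Omega>"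
proof -
  obtain K where K: "compact K" "K \<subseteq> \<Omega>" "\<And>x. x \<notin> K \<Longrightarrow> \<phi> x = 0"
    using test_functionsD(2)[OF assms] by blast
  have "partial_deriv i \<phi> x = 0" if "x \<notin> K" for x
  proof -
    have "open (- K)" using K(1) by (simp add: compact_imp_closed open_Compl)
    have "(\<phi> has_derivative (\<lambda>h. 0)) (at x)"
      by (rule has_derivative_transform_within_open[OF has_derivative_const \<open>open (- K)\<close>])
         (use that K in auto)
    from partial_deriv_eq[OF this] show ?thesis by simp
  qed
  moreover have "C_k k (partial_deriv i \<phi>)" for k
    using test_functionsD(1)[OF assms, of "Suc k"] by simp
  ultimately show ?thesis
    using K(1,2) unfolding test_functions_def by blast
qed

lemma test_function_mult:
  assumes "\<phi> \<in> test_functions \<Omega>" "\<theta> \<in> test_functions \<Omega>"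
  shows "(\<lambda>x. \<phi> x * \<theta> x) \<in> test_functions \<Omega>"
proof -
  obtain K where "compact K" "K \<subseteq> \<Omega>" "\<And>x. x \<notin> K \<Longrightarrow> \<phi> x = 0"
    using test_functionsD(2)[OF assms(1)] by blast
  moreover have "C_k k (\<lambda>x. \<phi> x * \<theta> x)" for k
    using assms test_functionsD(1) C_k_mult by blast
  ultimately show ?thesis
    unfolding test_functions_def by auto
qed

section \<open>Barycentric coordinates\<close>

text \<open>
  The determinant of two vectors. For \<open>b - a\<close> and \<open>c - a\<close> it is twice the signed area of the
  triangle \<open>a b c\<close>, so that its sign says on which side of the line \<open>a b\<close> the point \<open>c\<close> lies.
\<close>

definition cross :: "plane \<Rightarrow> plane \<Rightarrow> real" where
  "cross x y = x $ 1 * y $ 2 - x $ 2 * y $ 1"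

text \<open>
  The barycentric coordinate of \<open>x\<close> for the vertex \<open>a\<close>, as a quotient of signed areas; rotating
  the vertices cyclically gives the other two coordinates.
\<close>

definition bary :: "plane \<Rightarrow> plane \<Rightarrow> plane \<Rightarrow> plane \<Rightarrow> real" where
  "bary a b c x = cross (b - x) (c - x) / cross (b - a) (c - a)"

lemma cross_self [simp]: "cross x x = 0" and cross_0 [simp]: "cross 0 x = 0" "cross x 0 = 0"
  by (simp_all add: cross_def)

lemma cross_commute: "cross x y = - cross y x"
  by (simp add: cross_def)

lemma cross_rotate: "cross (c - b) (a - b) = cross (b - a) (c - a)"
  by (simp add: cross_def algebra_simps)

lemma bary_affine:
  obtains q d where "\<And>x. bary a b c x = q \<bullet> x + d"
proof
  fix x
  show "bary a b c x = vector [(b $ 2 - c $ 2) / cross (b - a) (c - a),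
      (c $ 1 - b $ 1) / cross (b - a) (c - a)] \<bullet> x + cross b c / cross (b - a) (c - a)"
    unfolding bary_def inner_plane vector_2 add_divide_distrib[symmetric] times_divide_eq_left
    by (simp add: cross_def algebra_simps)
qed

lemma bary_sum:
  assumes "cross (b - a) (c - a) \<noteq> 0"
  shows "bary a b c x + bary b c a x + bary c a b x = 1"
proof -
  have "cross (c - b) (a - b) = cross (b - a) (c - a)" "cross (a - c) (b - c) = cross (b - a) (c - a)"
    by (simp_all add: cross_def algebra_simps)
  moreover have "cross (b - x) (c - x) + cross (c - x) (a - x) + cross (a - x) (b - x) = cross (b - a) (c - a)"
    by (simp add: cross_def algebra_simps)
  ultimately show ?thesis
    unfolding bary_def using assms by (simp add: add_divide_distrib[symmetric])
qed

lemma bary_at: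
  assumes "cross (b - a) (c - a) \<noteq> 0"
  shows "bary a b c a = 1" "bary a b c b = 0" "bary a b c c = 0"
  using assms by (simp_all add: bary_def)

lemma bary_combination:
  assumes "cross (b - a) (c - a) \<noteq> 0" "x = s *\<^sub>R a + t *\<^sub>R b + r *\<^sub>R c" "s + t + r = 1"
  shows "bary a b c x = s"
proof -
  have s: "s = 1 - t - r" using assms(3) by simp
  have "cross (b - x) (c - x) = s * cross (b - a) (c - a)"
    unfolding assms(2) s by (simp add: cross_def algebra_simps)
  then show ?thesis using assms(1) by (simp add: bary_def)
qed

lemma bary_expansion:
  assumes "cross (b - a) (c - a) \<noteq> 0"
  shows "x = bary a b c x *\<^sub>R a + bary b c a x *\<^sub>R b + bary c a b x *\<^sub>R c"
proof -
  let ?D = "cross (b - a) (c - a)"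
  have D: "cross (c - b) (a - b) = ?D" "cross (a - c) (b - c) = ?D"
    by (simp_all add: cross_def algebra_simps)
  have "?D *\<^sub>R x = cross (b - x) (c - x) *\<^sub>R a + cross (c - x) (a - x) *\<^sub>R b + cross (a - x) (b - x) *\<^sub>R c"
    by (simp add: vec_eq_iff forall_2 cross_def algebra_simps)
  then have "(1 / ?D) *\<^sub>R (?D *\<^sub>R x) = (1 / ?D) *\<^sub>R (cross (b - x) (c - x) *\<^sub>R a + cross (c - x) (a - x) *\<^sub>R b + cross (a - x) (b - x) *\<^sub>R c)"
    by simp
  then show ?thesis
    using assms unfolding bary_def D by (simp add: scaleR_add_right)
qed

lemma triangle_eq_bary:
  assumes "cross (b - a) (c - a) \<noteq> 0"
  shows "convex hull {a, b, c} = {x. bary a b c x \<ge> 0 \<and> bary b c a x \<ge> 0 \<and> bary c a b x \<ge> 0}" (is "?L = ?R")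
proof
  have nz: "cross (c - b) (a - b) \<noteq> 0" "cross (a - c) (b - c) \<noteq> 0"
    using assms cross_rotate by metis+
  show "?L \<subseteq> ?R"
  proof
    fix x assume "x \<in> ?L"
    then obtain s t r where *: "0 \<le> s" "0 \<le> t" "0 \<le> r" "s + t + r = 1" "x = s *\<^sub>R a + t *\<^sub>R b + r *\<^sub>R c"
      unfolding convex_hull_3 by auto
    moreover have "bary a b c x = s" using bary_combination[OF assms *(5,4)] .
    moreover have "bary b c a x = t" using bary_combination[OF nz(1), of x t r s] * by (simp add: algebra_simps)
    moreover have "bary c a b x = r" using bary_combination[OF nz(2), of x r s t] * by (simp add: algebra_simps)
    ultimately show "x \<in> ?R" by simp
  qed
  show "?R \<subseteq> ?L"
  proof
    fix x assume "x \<in> ?R"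
    then show "x \<in> ?L"
      using bary_expansion[OF assms, of x] bary_sum[OF assms, of x]
      unfolding convex_hull_3 by fast
  qed
qed

lemma continuous_on_bary: "continuous_on UNIV (bary a b c)"
proof -
  obtain q d where "\<And>x. bary a b c x = q \<bullet> x + d" using bary_affine by blast
  then have "bary a b c = (\<lambda>x. q \<bullet> x + d)" by auto
  then show ?thesis by (auto intro!: continuous_intros)
qed

abbreviation open_triangle :: "plane \<Rightarrow> plane \<Rightarrow> plane \<Rightarrow> plane set" where
  "open_triangle a b c \<equiv> {x. bary a b c x > 0 \<and> bary b c a x > 0 \<and> bary c a b x > 0}"

text \<open>
  Where a barycentric coordinate is below \<open>1/n\<close> its factor vanishes, so the support is a compact
  subset of the open triangle; as \<open>n\<close> grows these functions increase to the indicator of the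
  open triangle.
\<close>

definition bump :: "plane \<Rightarrow> plane \<Rightarrow> plane \<Rightarrow> nat \<Rightarrow> plane \<Rightarrow> real" where
  "bump a b c n x = flat_exp 1 (real n * bary a b c x - 1) * flat_exp 1 (real n * bary b c a x - 1)
     * flat_exp 1 (real n * bary c a b x - 1)"

lemma C_k_flat_bary: "C_k k (\<lambda>x. flat_exp 1 (real n * bary a b c x - 1))"
proof -
  obtain q d where "\<And>x. bary a b c x = q \<bullet> x + d" using bary_affine by blast
  then have "(\<lambda>x. flat_exp 1 (real n * bary a b c x - 1)) = (\<lambda>x. flat_exp 1 ((real n *\<^sub>R q) \<bullet> x + (real n * d - 1)))"
    by (simp add: algebra_simps)
  then show ?thesis using C_k_flat_affine[of k 1 "real n *\<^sub>R q" "real n * d - 1"] by simp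
qed

lemma bump_bounds: "0 \<le> bump a b c n x" "bump a b c n x \<le> 1"
  unfolding bump_def using flat_1_bounds by (auto intro!: mult_le_one)

lemma bump_test_function:
  assumes nz: "cross (b - a) (c - a) \<noteq> 0"
    and sub: "open_triangle a b c \<subseteq> \<Omega>"
  shows "bump a b c n \<in> test_functions \<Omega>"
proof -
  let ?K = "{x. real n * bary a b c x \<ge> 1 \<and> real n * bary b c a x \<ge> 1 \<and> real n * bary c a b x \<ge> 1}"
  have pos: "r > 0" if "real n * r \<ge> 1" for r
    using that mult_nonneg_nonpos[of "real n" r] by (cases "r > 0") auto
  have K: "?K \<subseteq> open_triangle a b c"
    using pos by blast
  also have "\<dots> \<subseteq> convex hull {a, b, c}"
    unfolding triangle_eq_bary[OF nz] by auto
  finally have hull: "?K \<subseteq> convex hull {a, b, c}" .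
  have "bounded ?K"
    by (rule bounded_subset[OF compact_imp_bounded[OF finite_imp_compact_convex_hull] hull]) simp
  moreover have "closed ?K"
    by (intro closed_Collect_conj closed_Collect_le continuous_on_const continuous_on_mult_left continuous_on_bary)
  ultimately have "compact ?K"
    by (simp add: compact_eq_bounded_closed)
  moreover have "C_k k (bump a b c n)" for k
    unfolding bump_def by (intro C_k_mult C_k_flat_bary)
  moreover have "bump a b c n x = 0" if "x \<notin> ?K" for x
    using that by (auto simp: bump_def flat_exp_def)
  ultimately show ?thesis
    using K sub unfolding test_functions_def by blast
qed

lemma bump_tendsto_1:
  assumes "bary a b c x > 0" "bary b c a x > 0" "bary c a b x > 0"
  shows "(\<lambda>n. bump a b c n x) \<longlonglongrightarrow> 1"
  using tendsto_mult[OF tendsto_mult[OF flat_1_tendsto_1[OF assms(1)] flat_1_tendsto_1[OF assms(2)]]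
      flat_1_tendsto_1[OF assms(3)]]
  by (simp add: bump_def)

section \<open>Integrals over triangles\<close>

lemma LINT_compact:
  fixes f :: "'a::euclidean_space \<Rightarrow> real"
  assumes "compact S" "continuous_on S f"
  shows "integrable (lebesgue_on S) f"
    and "integrable lborel (\<lambda>x. indicator S x * f x)"
    and "(LINT x|lebesgue_on S. f x) = (LINT x|lborel. indicator S x * f x)"
proof -
  show lb: "integrable lborel (\<lambda>x. indicator S x * f x)"
    using borel_integrable_compact[OF assms] by simp
  have S: "S \<inter> space lebesgue \<in> sets lebesgue"
    using assms(1) lmeasurable_compact by blast
  show "integrable (lebesgue_on S) f"
    using lb integrable_completion[OF borel_measurable_integrable[OF lb]]
    unfolding integrable_restrict_space[OF S] by simp
  show "(LINT x|lebesgue_on S. f x) = (LINT x|lborel. indicator S x * f x)"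
    unfolding integral_restrict_space[OF S] using lb by (simp add: integral_completion)
qed

definition to_plane :: "real \<times> real \<Rightarrow> plane" where
  "to_plane p = fst p *\<^sub>R axis 1 1 + snd p *\<^sub>R axis 2 1"

lemma to_plane_nth [simp]: "to_plane p $ 1 = fst p" "to_plane p $ 2 = snd p"
  by (simp_all add: to_plane_def axis_def)

lemma Basis_plane: "(Basis :: plane set) = {axis 1 1, axis 2 1}"
  unfolding Basis_vec_def by (auto simp: UNIV_2)

lemma to_plane_borel [measurable]: "to_plane \<in> borel_measurable borel"
  unfolding to_plane_def by (intro borel_measurable_continuous_onI continuous_intros)

text \<open>
  Identifies the measure on \<open>real^2\<close> with the product measure on pairs, for which Fubini's
  theorem is available.
\<close>

lemma lborel_plane: "(lborel :: plane measure) = distr lborel borel to_plane"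
proof (rule lborel_eqI)
  fix l u :: plane assume lu: "\<And>b. b \<in> Basis \<Longrightarrow> l \<bullet> b \<le> u \<bullet> b"
  have le: "l $ 1 \<le> u $ 1" "l $ 2 \<le> u $ 2"
    using lu[of "axis 1 1"] lu[of "axis 2 1"] by (simp_all add: Basis_plane inner_axis)
  have "to_plane -` box l u = box (l $ 1, l $ 2) (u $ 1, u $ 2)"
    by (auto simp: mem_box Basis_plane inner_axis Basis_prod_def)
  then have "emeasure (distr lborel borel to_plane) (box l u) = emeasure lborel (box (l $ 1, l $ 2) (u $ 1, u $ 2))"
    by (subst emeasure_distr) auto
  also have "\<dots> = (\<Prod>b\<in>Basis. ((u $ 1, u $ 2) - (l $ 1, l $ 2)) \<bullet> b)"
    by (rule emeasure_lborel_box) (auto simp: Basis_prod_def le)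
  also have "(\<Prod>b\<in>Basis. ((u $ 1, u $ 2) - (l $ 1, l $ 2)) \<bullet> b) = (u $ 1 - l $ 1) * (u $ 2 - l $ 2)"
    by (simp add: Basis_prod_def)
  also have "\<dots> = (\<Prod>b\<in>Basis. (u - l) \<bullet> b)"
    by (simp add: Basis_plane inner_axis axis_eq_axis)
  finally show "emeasure (distr lborel borel to_plane) (box l u) = ennreal (\<Prod>b\<in>Basis. (u - l) \<bullet> b)" .
qed simp

definition unit_triangle :: "plane set" where
  "unit_triangle = convex hull {0, axis 1 1, axis 2 1}"

lemma unit_triangle_eq: "unit_triangle = {p. 0 \<le> p $ 1 \<and> 0 \<le> p $ 2 \<and> p $ 1 + p $ 2 \<le> 1}"
proof -
  have "cross (axis 1 1 - 0) (axis 2 1 - 0) \<noteq> 0"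
    by (simp add: cross_def axis_def)
  from triangle_eq_bary[OF this] show ?thesis
    unfolding unit_triangle_def by (auto simp: bary_def cross_def axis_def algebra_simps)
qed

lemma compact_unit_triangle: "compact unit_triangle"
  unfolding unit_triangle_def by (intro finite_imp_compact_convex_hull) auto

lemma LINT_unit_triangle:
  fixes h :: "plane \<Rightarrow> real"
  assumes "continuous_on UNIV h"
  shows "(LINT p|lebesgue_on unit_triangle. h p) =
    integral {0..1} (\<lambda>y. integral {0..1 - y} (\<lambda>x. h (to_plane (x, y))))" (is ?eq)
    and "(\<lambda>y. integral {0..1 - y} (\<lambda>x. h (to_plane (x, y)))) integrable_on {0..1}" (is ?int)
proof -
  have cont: "continuous_on unit_triangle h"
    using assms continuous_on_subset by blast
  let ?k = "\<lambda>p. indicator unit_triangle p * h p"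
  let ?f = "\<lambda>x y. ?k (to_plane (x, y))"
  have hb: "h \<in> borel_measurable borel"
    using assms by (rule borel_measurable_continuous_onI)
  have Rb: "unit_triangle \<in> sets borel"
    using compact_unit_triangle by (simp add: compact_imp_closed)
  have kb: "?k \<in> borel_measurable borel"
    using hb Rb by measurable
  have "integrable (distr lborel borel to_plane) ?k"
    using LINT_compact(2)[OF compact_unit_triangle cont] unfolding lborel_plane .
  then have "integrable (lborel :: (real \<times> real) measure) (\<lambda>p. ?k (to_plane p))"
    by (subst (asm) integrable_distr_eq) (use kb in auto)
  then have int: "integrable (lborel \<Otimes>\<^sub>M lborel) (case_prod ?f)"
    unfolding lborel_prod by (simp add: split_beta')
  have inner: "(\<lambda>y. LINT x|lborel. ?f x y) =
      (\<lambda>y. if y \<in> {0..1} then integral {0..1 - y} (\<lambda>x. h (to_plane (x, y))) else 0)"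
  proof
    fix y :: real
    show "(LINT x|lborel. ?f x y) = (if y \<in> {0..1} then integral {0..1 - y} (\<lambda>x. h (to_plane (x, y))) else 0)"
    proof (cases "y \<in> {0..1}")
      case True
      have "(\<lambda>x. ?f x y) = (\<lambda>x. indicator {0..1 - y} x *\<^sub>R h (to_plane (x, y)))"
        using True by (intro ext) (auto simp: unit_triangle_eq indicator_def)
      moreover have "continuous_on {0..1 - y} (\<lambda>x. h (to_plane (x, y)))"
        unfolding to_plane_def
        by (rule continuous_on_compose2[OF assms]) (auto intro!: continuous_intros)
      ultimately show ?thesis
        using True set_borel_integral_eq_integral(2)[of "{0..1 - y}" "\<lambda>x. h (to_plane (x, y))"]
          borel_integrable_compact[of "{0..1 - y}" "\<lambda>x. h (to_plane (x, y))"]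
        by (simp add: set_lebesgue_integral_def set_integrable_def)
    next
      case False
      then have "(\<lambda>x. ?f x y) = (\<lambda>x. 0)"
        by (auto simp: unit_triangle_eq indicator_def)
      with False show ?thesis by auto
    qed
  qed
  let ?g = "\<lambda>y. integral {0..1 - y} (\<lambda>x. h (to_plane (x, y)))"
  have "integrable lborel (\<lambda>y. LINT x|lborel. ?f x y)"
    using lborel_pair.integrable_snd[OF int] by (simp add: split_beta')
  then have gint: "integrable lborel (\<lambda>y. if y \<in> {0..1} then ?g y else 0)"
    unfolding inner .
  then show ?int
    using integrable_on_lborel Henstock_Kurzweil_Integration.integrable_restrict_UNIV by blast
  have "(LINT p|lebesgue_on unit_triangle. h p) = (LINT p|lborel. ?k p)"
    by (rule LINT_compact(3)[OF compact_unit_triangle cont])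
  also have "\<dots> = (LINT p|lborel. ?k (to_plane p))"
    unfolding lborel_plane by (rule integral_distr) (use kb in auto)
  also have "\<dots> = (LINT y|lborel. (LINT x|lborel. ?f x y))"
    using lborel_pair.integral_snd[OF int] unfolding lborel_prod by (simp add: split_beta')
  also have "\<dots> = (LINT y|lborel. (if y \<in> {0..1} then ?g y else 0))"
    unfolding inner ..
  also have "\<dots> = integral {0..1} ?g"
    using integral_lborel[OF gint] by (simp only: Henstock_Kurzweil_Integration.integral_restrict_UNIV)
  finally show ?eq .
qed

lemma compact_image_linear:
  fixes L :: "'a::euclidean_space \<Rightarrow> 'b::real_normed_vector"
  assumes "linear L" "compact S"
  shows "compact (L ` S)"
  using assms by (intro compact_continuous_image linear_continuous_on) (auto simp: linear_conv_bounded_linear)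

lemma LINT_translation:
  fixes a :: "'a::euclidean_space" and g :: "'a \<Rightarrow> real"
  assumes "compact S" "continuous_on ((+) a ` S) g"
  shows "(LINT x|lebesgue_on ((+) a ` S). g x) = (LINT x|lebesgue_on S. g (a + x))"
proof -
  have S: "compact ((+) a ` S)"
    using compact_translation[OF assms(1)] by simp
  have cont: "continuous_on S (\<lambda>x. g (a + x))"
    by (rule continuous_on_compose2[OF assms(2)]) (auto intro!: continuous_intros)
  have m: "(\<lambda>x. indicator ((+) a ` S) x * g x) \<in> borel_measurable borel"
    using LINT_compact(2)[OF S assms(2)] by auto
  have "(LINT x|lebesgue_on ((+) a ` S). g x) = (LINT x|distr lborel borel ((+) a). indicator ((+) a ` S) x * g x)"
    unfolding LINT_compact(3)[OF S assms(2)] lborel_distr_plus ..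
  also have "\<dots> = (LINT x|lborel. indicator ((+) a ` S) (a + x) * g (a + x))"
    by (rule integral_distr) (use m in auto)
  also have "\<dots> = (LINT x|lborel. indicator S x * g (a + x))"
    by (rule Bochner_Integration.integral_cong) (auto simp: indicator_def)
  also have "\<dots> = (LINT x|lebesgue_on S. g (a + x))"
    by (rule LINT_compact(3)[OF assms(1) cont, symmetric])
  finally show ?thesis .
qed

text \<open>
  The linear change of variables for Henstock--Kurzweil integrals concerns vector-valued
  functions, hence the passage through one-dimensional vectors.
\<close>

lemma LINT_linear_image:
  fixes g :: "plane \<Rightarrow> real"
  assumes "linear L" "compact S" "continuous_on (L ` S) g"
  shows "(LINT x|lebesgue_on (L ` S). g x) = \<bar>det (matrix L)\<bar> * (LINT x|lebesgue_on S. g (L x))"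
proof -
  have LS: "compact (L ` S)"
    using assms(1,2) compact_image_linear by blast
  have contS: "continuous_on S (\<lambda>x. g (L x))"
    by (rule continuous_on_compose2[OF assms(3)]) (auto intro: linear_continuous_on_compose continuous_on_id assms(1))
  have sets: "L ` S \<in> sets lebesgue" "S \<in> sets lebesgue"
    using LS assms(2) lmeasurable_compact by blast+
  let ?v = "\<lambda>x. (\<chi> i::1. g x)"
  have ac: "(\<lambda>x. ?v x) absolutely_integrable_on (L ` S)"
    using borel_integrable_compact[OF LS continuous_on_vec_lambda[OF assms(3)]]
    unfolding set_integrable_def
    using integrable_completion borel_measurable_integrable by blast
  have ac': "(\<lambda>x. ?v (L x)) absolutely_integrable_on S"
    using borel_integrable_compact[OF assms(2) continuous_on_vec_lambda[OF contS]]
    unfolding set_integrable_def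
    using integrable_completion borel_measurable_integrable by blast
  have eq: "integral (L ` S) ?v = \<bar>det (matrix L)\<bar> *\<^sub>R integral S (?v \<circ> L)"
    by (rule integral_change_of_variables_linear) (use assms(1) ac in auto)
  have "(LINT x|lebesgue_on (L ` S). g x) = integral (L ` S) g"
    by (rule lebesgue_integral_eq_integral[OF LINT_compact(1)[OF LS assms(3)] sets(1)])
  also have "\<dots> = integral (L ` S) (\<lambda>x. ?v x $ 1)" by simp
  also have "\<dots> = integral (L ` S) ?v $ 1"
    by (rule integral_component_eq_cart) (use ac set_lebesgue_integral_eq_integral(1) in blast)
  also have "\<dots> = \<bar>det (matrix L)\<bar> * integral S (\<lambda>x. ?v (L x)) $ 1"
    unfolding eq by (simp add: o_def)
  also have "integral S (\<lambda>x. ?v (L x)) $ 1 = integral S (\<lambda>x. ?v (L x) $ 1)"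
    by (rule integral_component_eq_cart[symmetric]) (use ac' set_lebesgue_integral_eq_integral(1) in blast)
  also have "\<dots> = (LINT x|lebesgue_on S. g (L x))"
    using lebesgue_integral_eq_integral[OF LINT_compact(1)[OF assms(2) contS] sets(2)] by simp
  finally show ?thesis .
qed

text \<open>
  The triangle is the image of the unit triangle under an affine map whose determinant is twice
  its area. Interchanging \<open>b\<close> and \<open>c\<close> gives the iterated integral in the other order.
\<close>

lemma LINT_triangle:
  fixes g :: "plane \<Rightarrow> real"
  assumes "continuous_on UNIV g"
  shows "(LINT x|lebesgue_on (convex hull {a, b, c}). g x) = \<bar>cross (b - a) (c - a)\<bar> *
    integral {0..1} (\<lambda>y. integral {0..1 - y} (\<lambda>x. g (a + x *\<^sub>R (b - a) + y *\<^sub>R (c - a))))" (is ?eq)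
    and "(\<lambda>y. integral {0..1 - y} (\<lambda>x. g (a + x *\<^sub>R (b - a) + y *\<^sub>R (c - a)))) integrable_on {0..1}" (is ?int)
proof -
  let ?L = "\<lambda>p::plane. p $ 1 *\<^sub>R (b - a) + p $ 2 *\<^sub>R (c - a)"
  have L: "linear ?L"
    by (rule linearI) (simp_all add: algebra_simps scaleR_add_left)
  have axis: "axis (1::2) (1::real) $ 1 = 1" "axis (1::2) (1::real) $ 2 = 0"
    "axis (2::2) (1::real) $ 1 = 0" "axis (2::2) (1::real) $ 2 = 1"
    by (simp_all add: axis_def)
  have det: "\<bar>det (matrix ?L)\<bar> = \<bar>cross (b - a) (c - a)\<bar>"
    by (simp add: det_2 matrix_def cross_def axis algebra_simps)
  have img: "?L ` unit_triangle = convex hull {0, b - a, c - a}"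
    unfolding unit_triangle_def convex_hull_linear_image[OF L] by (simp add: axis)
  have T: "convex hull {a, b, c} = (+) a ` (?L ` unit_triangle)"
    unfolding img convex_hull_translation[symmetric] by simp
  have cont: "continuous_on X (\<lambda>x. g (f x))" if "continuous_on X f" for X and f :: "plane \<Rightarrow> plane"
    by (rule continuous_on_compose2[OF assms that]) simp
  have "(LINT x|lebesgue_on (convex hull {a, b, c}). g x) = (LINT x|lebesgue_on (?L ` unit_triangle). g (a + x))"
    unfolding T
    by (intro LINT_translation compact_image_linear L compact_unit_triangle continuous_on_subset[OF assms]) auto
  also have "\<dots> = \<bar>det (matrix ?L)\<bar> * (LINT x|lebesgue_on unit_triangle. g (a + ?L x))"
    by (intro LINT_linear_image L compact_unit_triangle cont continuous_intros)
  also have "(LINT x|lebesgue_on unit_triangle. g (a + ?L x)) =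
      integral {0..1} (\<lambda>y. integral {0..1 - y} (\<lambda>x. g (a + ?L (to_plane (x, y)))))"
    by (intro LINT_unit_triangle cont continuous_intros)
  finally show ?eq
    unfolding det by (simp add: add.assoc)
  have "continuous_on UNIV (\<lambda>x. g (a + ?L x))"
    by (intro cont continuous_intros)
  from LINT_unit_triangle(2)[OF this] show ?int
    by (simp add: add.assoc)
qed

lemma integral_reflect_unit:
  fixes f :: "real \<Rightarrow> real"
  shows "integral {0..1} (\<lambda>t. f (1 - t)) = integral {0..1} f"
    and "(\<lambda>t. f (1 - t)) integrable_on {0..1} \<longleftrightarrow> f integrable_on {0..1}"
proof -
  have iff: "((\<lambda>t. f (1 - t)) has_integral i) {0..1}" if "(f has_integral i) {0..1}" for f :: "real \<Rightarrow> real" and i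
  proof -
    have "((\<lambda>x. f (- x)) has_integral i) {-1..0}"
      using that has_integral_reflect_real[of f i 1 0] by simp
    then show ?thesis
      using has_integral_shift_real_ivl_iff[of "\<lambda>x. f (- x)" i "-1" 0 "-1"] by (simp add: algebra_simps)
  qed
  have iff': "(f has_integral i) {0..1} \<longleftrightarrow> ((\<lambda>t. f (1 - t)) has_integral i) {0..1}" for i
    using iff[of f i] iff[of "\<lambda>t. f (1 - t)" i] by auto
  then show "(\<lambda>t. f (1 - t)) integrable_on {0..1} \<longleftrightarrow> f integrable_on {0..1}"
    unfolding integrable_on_def by simp
  show "integral {0..1} (\<lambda>t. f (1 - t)) = integral {0..1} f"
    unfolding Henstock_Kurzweil_Integration.integral_def integrable_on_def iff' ..
qed

text \<open>
  The integral of the square of \<open>f\<close> minus its mean is nonnegative.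
\<close>

lemma integral_square_le:
  fixes f :: "real \<Rightarrow> real"
  assumes "a \<le> b" "continuous_on {a..b} f"
  shows "(integral {a..b} f)\<^sup>2 \<le> (b - a) * integral {a..b} (\<lambda>x. (f x)\<^sup>2)"
proof (cases "a = b")
  case False
  then have ab: "b - a > 0" using assms(1) by simp
  let ?I = "integral {a..b} f" and ?k = "integral {a..b} f / (b - a)"
  have "0 \<le> integral {a..b} (\<lambda>x. (f x - ?k)\<^sup>2)"
    by (intro integral_nonneg integrable_continuous_real continuous_intros assms(2)) auto
  also have "(\<lambda>x. (f x - ?k)\<^sup>2) = (\<lambda>x. (f x)\<^sup>2 - 2 * ?k * f x + ?k\<^sup>2)"
    by (auto simp: power2_eq_square algebra_simps)
  also have "integral {a..b} \<dots> = integral {a..b} (\<lambda>x. (f x)\<^sup>2) - integral {a..b} (\<lambda>x. 2 * ?k * f x)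
      + integral {a..b} (\<lambda>x. ?k\<^sup>2)"
    by (subst Henstock_Kurzweil_Integration.integral_add Henstock_Kurzweil_Integration.integral_diff;
        (intro integrable_continuous_real continuous_intros assms(2))?)+ simp
  also have "\<dots> = integral {a..b} (\<lambda>x. (f x)\<^sup>2) - 2 * ?k * ?I + ?k\<^sup>2 * (b - a)"
    using assms(1) by simp
  also have "\<dots> = integral {a..b} (\<lambda>x. (f x)\<^sup>2) - ?I\<^sup>2 / (b - a)"
  proof -
    have "- 2 * (i / l) * i + (i / l)\<^sup>2 * l = - (i\<^sup>2 / l)" if "l > 0" for i l :: real
      using that by (simp add: power2_eq_square field_simps)
    from this[OF ab, of ?I] show ?thesis by simp
  qed
  finally show ?thesis
    using ab by (simp add: field_simps)
qed auto

text \<open>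
  Unlike \<^const>\<open>edge_integral\<close>, which chooses endpoints, this is a function of given endpoints; its
  symmetry makes the choice irrelevant.
\<close>

definition seg_mean :: "plane \<Rightarrow> plane \<Rightarrow> (plane \<Rightarrow> real) \<Rightarrow> real" where
  "seg_mean a b g = integral {0..1} (\<lambda>t. g ((1 - t) *\<^sub>R a + t *\<^sub>R b))"

lemma seg_mean_commute: "seg_mean a b g = seg_mean b a g"
  unfolding seg_mean_def
  using integral_reflect_unit(1)[of "\<lambda>t. g ((1 - t) *\<^sub>R b + t *\<^sub>R a)"] by (simp add: add.commute)

lemma continuous_on_segment_param:
  fixes a b :: plane
  assumes "continuous_on UNIV (g :: plane \<Rightarrow> real)"
  shows "continuous_on X (\<lambda>t. g ((1 - t) *\<^sub>R a + t *\<^sub>R b))"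
  by (rule continuous_on_compose2[OF assms]) (auto intro!: continuous_intros)

lemma edge_integral_closed_segment:
  assumes "continuous_on UNIV g"
  shows "edge_integral (closed_segment a b) g = dist a b * seg_mean a b g"
proof -
  define P where "P = (\<lambda>(p, q). closed_segment a b = closed_segment p (q::plane))"
  have "P (a, b)" by (simp add: P_def)
  then have "P (Eps P)" by (rule someI)
  moreover obtain p q where pq: "Eps P = (p, q)" by fastforce
  ultimately have "{p, q} = {a, b}"
    unfolding P_def by (metis (mono_tags, lifting) closed_segment_eq case_prod_conv)
  moreover have "edge_integral (closed_segment a b) g = dist p q * seg_mean p q g"
    unfolding edge_integral_def P_def[symmetric] pq seg_mean_def
    using lebesgue_integral_eq_integral[of "{0..1}" "\<lambda>t. g ((1 - t) *\<^sub>R p + t *\<^sub>R q)"]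
      LINT_compact(1)[OF compact_Icc continuous_on_segment_param[OF assms]] by simp
  ultimately show ?thesis
    using seg_mean_commute[of a b g] by (auto simp: doubleton_eq_iff dist_commute)
qed

lemma C_k_1_path_derivative:
  assumes "C_k 1 \<phi>"
  shows "((\<lambda>t. \<phi> (p + t *\<^sub>R w)) has_real_derivative classical_grad \<phi> (p + t *\<^sub>R w) \<bullet> w) (at t within X)"
proof -
  have "((\<lambda>t. p + t *\<^sub>R w) has_derivative (\<lambda>h. h *\<^sub>R w)) (at t within X)"
    by (auto intro!: derivative_eq_intros)
  from has_derivative_compose[OF this C_k_1_classical_grad(1)[OF assms]]
  show ?thesis
    by (simp add: has_field_derivative_def mult.commute mult_commute_abs)
qed

text \<open>
  The fundamental theorem on each chord parallel to \<open>a b\<close>; the endpoints of the chords run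
  through the other two sides at constant speed, so integrating over the chords gives the means
  over these sides. Both the comparison of edge means and the divergence theorem on a triangle
  come from this identity.
\<close>

lemma LINT_grad_along_side:
  assumes "C_k 1 \<phi>"
  shows "(LINT x|lebesgue_on (convex hull {a, b, c}). classical_grad \<phi> x \<bullet> (b - a)) =
    \<bar>cross (b - a) (c - a)\<bar> * (seg_mean b c \<phi> - seg_mean a c \<phi>)"
proof -
  note phi = C_k_1_classical_grad[OF assms]
  have "continuous_on UNIV (\<lambda>x. classical_grad \<phi> x \<bullet> (b - a))"
    by (intro continuous_intros phi)
  note tri = LINT_triangle(1)[OF this, of a b c]
  have inner: "integral {0..1 - y} (\<lambda>x. classical_grad \<phi> (a + x *\<^sub>R (b - a) + y *\<^sub>R (c - a)) \<bullet> (b - a))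
      = \<phi> ((1 - y) *\<^sub>R b + y *\<^sub>R c) - \<phi> ((1 - y) *\<^sub>R a + y *\<^sub>R c)" if "y \<in> {0..1}" for y
  proof -
    let ?p = "a + y *\<^sub>R (c - a)"
    have "((\<lambda>x. classical_grad \<phi> (?p + x *\<^sub>R (b - a)) \<bullet> (b - a)) has_integral
        (\<phi> (?p + (1 - y) *\<^sub>R (b - a)) - \<phi> (?p + 0 *\<^sub>R (b - a)))) {0..1 - y}"
      by (rule fundamental_theorem_of_calculus)
         (use that C_k_1_path_derivative[OF assms] in \<open>auto simp: has_real_derivative_iff_has_vector_derivative\<close>)
    moreover have "?p + (1 - y) *\<^sub>R (b - a) = (1 - y) *\<^sub>R b + y *\<^sub>R c" "?p + 0 *\<^sub>R (b - a) = (1 - y) *\<^sub>R a + y *\<^sub>R c"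
      by (simp_all add: algebra_simps)
    ultimately show ?thesis
      by (simp add: integral_unique add.commute add.left_commute add.assoc)
  qed
  have "integral {0..1} (\<lambda>y. integral {0..1 - y} (\<lambda>x. classical_grad \<phi> (a + x *\<^sub>R (b - a) + y *\<^sub>R (c - a)) \<bullet> (b - a)))
     = integral {0..1} (\<lambda>y. \<phi> ((1 - y) *\<^sub>R b + y *\<^sub>R c) - \<phi> ((1 - y) *\<^sub>R a + y *\<^sub>R c))"
    by (rule Henstock_Kurzweil_Integration.integral_cong) (rule inner)
  also have "\<dots> = seg_mean b c \<phi> - seg_mean a c \<phi>"
    unfolding seg_mean_def
    by (intro Henstock_Kurzweil_Integration.integral_diff integrable_continuous_real continuous_on_segment_param phi)
  finally show ?thesis unfolding tri by simp
qed

text \<open>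
  The fundamental theorem and the Cauchy--Schwarz inequality; intervals of length at most one
  save the length factor.
\<close>

lemma unit_interval_oscillation:
  fixes f f' :: "real \<Rightarrow> real"
  assumes "\<And>t. (f has_real_derivative f' t) (at t)" "continuous_on UNIV f'" "L \<le> 1"
    and "x \<in> {0..L}" "s \<in> {0..L}"
  shows "(f x - f s)\<^sup>2 \<le> integral {0..L} (\<lambda>t. (f' t)\<^sup>2)"
proof -
  have *: "(f x - f s)\<^sup>2 \<le> integral {0..L} (\<lambda>t. (f' t)\<^sup>2)" if "0 \<le> s" "s \<le> x" "x \<le> L" for x s
  proof -
    have cont: "continuous_on X f'" for X using assms(2) continuous_on_subset by blast
    have "(f' has_integral f x - f s) {s..x}"
      by (rule fundamental_theorem_of_calculus)
         (use that assms(1) in \<open>auto simp: has_real_derivative_iff_has_vector_derivative[symmetric] has_field_derivative_at_within\<close>)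
    then have "(f x - f s)\<^sup>2 = (integral {s..x} f')\<^sup>2"
      by (simp add: integral_unique)
    also have "\<dots> \<le> (x - s) * integral {s..x} (\<lambda>t. (f' t)\<^sup>2)"
      by (rule integral_square_le[OF that(2) cont])
    also have "\<dots> \<le> 1 * integral {s..x} (\<lambda>t. (f' t)\<^sup>2)"
      using that assms(3) by (intro mult_right_mono integral_nonneg integrable_continuous_real continuous_intros cont) auto
    also have "\<dots> \<le> integral {0..L} (\<lambda>t. (f' t)\<^sup>2)"
      using that by (simp, intro integral_subset_le integrable_continuous_real continuous_intros cont) auto
    finally show ?thesis .
  qed
  show ?thesis
  proof (cases "s \<le> x")
    case True then show ?thesis using * assms by auto
  next
    case False
    then have "(f s - f x)\<^sup>2 \<le> integral {0..L} (\<lambda>t. (f' t)\<^sup>2)" using *[of x s] assms by auto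
    then show ?thesis by (simp add: power2_commute)
  qed
qed

section \<open>Cauchy--Schwarz and Poincare inequalities\<close>

text \<open>
  Nonnegativity of the integral of \<open>(f - t g) \<bullet> (f - t g)\<close>, a quadratic in \<open>t\<close>.
\<close>

lemma integral_Cauchy_Schwarz:
  fixes f g :: "'a \<Rightarrow> 'b::euclidean_space"
  assumes f: "f \<in> borel_measurable M" "integrable M (\<lambda>x. f x \<bullet> f x)"
    and g: "g \<in> borel_measurable M" "integrable M (\<lambda>x. g x \<bullet> g x)"
  shows "integrable M (\<lambda>x. f x \<bullet> g x)"
    and "(LINT x|M. f x \<bullet> g x)\<^sup>2 \<le> (LINT x|M. f x \<bullet> f x) * (LINT x|M. g x \<bullet> g x)"
proof -
  have ineq: "2 * \<bar>v \<bullet> w\<bar> \<le> v \<bullet> v + w \<bullet> w" for v w :: 'b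
  proof -
    have "0 \<le> (v - w) \<bullet> (v - w)" "0 \<le> (v + w) \<bullet> (v + w)" by simp_all
    then show ?thesis
      by (simp add: inner_diff_left inner_diff_right inner_add_left inner_add_right inner_commute abs_if)
  qed
  show int: "integrable M (\<lambda>x. f x \<bullet> g x)"
  proof (rule Bochner_Integration.integrable_bound[OF Bochner_Integration.integrable_add[OF f(2) g(2)]])
    show "(\<lambda>x. f x \<bullet> g x) \<in> borel_measurable M" using f(1) g(1) by simp
    show "AE x in M. norm (f x \<bullet> g x) \<le> norm (f x \<bullet> f x + g x \<bullet> g x)"
      using ineq by (intro AE_I2) (smt (verit) inner_ge_zero real_norm_def)
  qed
  let ?A = "LINT x|M. f x \<bullet> f x" and ?B = "LINT x|M. g x \<bullet> g x" and ?C = "LINT x|M. f x \<bullet> g x"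
  have quad: "0 \<le> ?A - 2 * t * ?C + t\<^sup>2 * ?B" for t
  proof -
    have "0 \<le> (LINT x|M. (f x - t *\<^sub>R g x) \<bullet> (f x - t *\<^sub>R g x))"
      by (rule Bochner_Integration.integral_nonneg) simp
    also have "(\<lambda>x. (f x - t *\<^sub>R g x) \<bullet> (f x - t *\<^sub>R g x)) = (\<lambda>x. f x \<bullet> f x - (2 * t) * (f x \<bullet> g x) + t\<^sup>2 * (g x \<bullet> g x))"
      by (auto simp: inner_diff_left inner_diff_right inner_commute power2_eq_square algebra_simps)
    finally show ?thesis
      using f(2) g(2) int by simp
  qed
  show "?C\<^sup>2 \<le> ?A * ?B"
  proof (cases "?B = 0")
    case True
    have "?C = 0"
    proof (rule ccontr)
      \<comment> \<open>With \<open>B = 0\<close> the quadratic is affine in \<open>t\<close>, and this \<open>t\<close> makes it negative.\<close>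
      assume "?C \<noteq> 0"
      then show False
        using quad[of "(?A + 1) / (2 * ?C)"] True by (simp add: field_simps)
    qed
    then show ?thesis using True by simp
  next
    case False
    have "?B \<ge> 0"
      by (rule Bochner_Integration.integral_nonneg) simp
    with False have "?B > 0" by (metis order_le_less)
    then show ?thesis
      using quad[of "?C / ?B"] by (simp add: field_simps power2_eq_square)
  qed
qed

lemma compact_triangle: "compact (convex hull {a, b, c :: plane})"
  by (intro finite_imp_compact_convex_hull) auto

lemma continuous_imp_measurable_on:
  fixes f :: "'a::euclidean_space \<Rightarrow> 'b::real_normed_vector"
  assumes "continuous_on UNIV f"
  shows "f \<in> borel_measurable (lebesgue_on S)"
  using borel_measurable_continuous_onI[OF assms]
  by (intro measurable_restrict_space1) (simp add: borel_measurable_if_I measurable_completion)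

lemma measure_triangle:
  "measure lebesgue (convex hull {a, b, c}) = \<bar>cross (b - a) (c - a)\<bar> / 2"
proof -
  let ?T = "convex hull {a, b, c}"
  have T: "?T \<in> sets lebesgue" using compact_triangle lmeasurable_compact by blast
  have "measure lebesgue ?T = (LINT x|lebesgue_on ?T. 1)"
    using T by (simp add: measure_restrict_space)
  also have "\<dots> = \<bar>cross (b - a) (c - a)\<bar> * integral {0..1} (\<lambda>y::real. integral {0..1 - y} (\<lambda>x::real. 1))"
    by (rule LINT_triangle(1)[where g = "\<lambda>_. 1"]) simp
  also have "integral {0..1} (\<lambda>y::real. integral {0..1 - y} (\<lambda>x::real. 1)) = integral {0..1} (\<lambda>y. 1 - y :: real)"
    by (rule Henstock_Kurzweil_Integration.integral_cong) simp
  also have "\<dots> = 1 / 2"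
    using ident_has_integral[of 0 "1::real"] by (subst Henstock_Kurzweil_Integration.integral_diff) (auto simp: integral_unique)
  finally show ?thesis by simp
qed

definition energy :: "(plane \<Rightarrow> real) \<Rightarrow> plane set \<Rightarrow> real" where
  "energy \<phi> S = (LINT x|lebesgue_on S. classical_grad \<phi> x \<bullet> classical_grad \<phi> x)"

lemma energy_nonneg: "energy \<phi> S \<ge> 0"
  unfolding energy_def by (rule Bochner_Integration.integral_nonneg) simp

text \<open>
  The factor is a ratio of a squared length and an area: rescaling the triangle does not change
  it.
\<close>

lemma seg_mean_diff_le:
  assumes "C_k 1 \<phi>" and nz: "cross (b - a) (c - a) \<noteq> 0"
  shows "(seg_mean b c \<phi> - seg_mean a c \<phi>)\<^sup>2 \<le> (dist a b)\<^sup>2 / (2 * \<bar>cross (b - a) (c - a)\<bar>) *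
     energy \<phi> (convex hull {a, b, c})"
proof -
  let ?T = "convex hull {a, b, c}" and ?D = "\<bar>cross (b - a) (c - a)\<bar>"
  let ?S = "LINT x|lebesgue_on ?T. classical_grad \<phi> x \<bullet> classical_grad \<phi> x"
  note phi = C_k_1_classical_grad[OF assms(1)]
  have D: "?D > 0" using nz by simp
  have "(?D * (seg_mean b c \<phi> - seg_mean a c \<phi>))\<^sup>2 = (LINT x|lebesgue_on ?T. classical_grad \<phi> x \<bullet> (b - a))\<^sup>2"
    unfolding LINT_grad_along_side[OF assms(1)] ..
  also have "\<dots> \<le> ?S * (LINT x|lebesgue_on ?T. (b - a) \<bullet> (b - a))"
    by (intro integral_Cauchy_Schwarz(2) continuous_imp_measurable_on LINT_compact(1) compact_triangle
        continuous_on_subset[OF continuous_on_inner[OF phi(2) phi(2)]] phi continuous_intros) auto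
  also have "(LINT x|lebesgue_on ?T. (b - a) \<bullet> (b - a)) = (?D / 2) * (dist a b)\<^sup>2"
  proof -
    have T: "?T \<in> sets lebesgue" using compact_triangle lmeasurable_compact by blast
    have "(b - a) \<bullet> (b - a) = (dist a b)\<^sup>2"
      by (simp add: dist_norm norm_minus_commute power2_norm_eq_inner[symmetric])
    then show ?thesis
      using T by (simp add: measure_restrict_space measure_triangle)
  qed
  finally have *: "?D\<^sup>2 * (seg_mean b c \<phi> - seg_mean a c \<phi>)\<^sup>2 \<le> ?S * ((?D / 2) * (dist a b)\<^sup>2)"
    by (simp only: power_mult_distrib)
  have "?D * (?D * (seg_mean b c \<phi> - seg_mean a c \<phi>)\<^sup>2) \<le> ?D * (?S * (1 / 2) * (dist a b)\<^sup>2)"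
    using * by (simp add: power2_eq_square algebra_simps)
  then have "?D * (seg_mean b c \<phi> - seg_mean a c \<phi>)\<^sup>2 \<le> ?S * (1 / 2) * (dist a b)\<^sup>2"
    using D mult_left_le_imp_le by blast
  then show ?thesis unfolding energy_def using D by (simp add: field_simps)
qed

text \<open>
  In coordinates with \<open>a\<close> as origin and \<open>b\<close>, \<open>c\<close> as unit points, the edge \<open>b c\<close> consists of the
  points \<open>(s, 1 - s)\<close>. A point \<open>(x, y)\<close> is joined to such a point by a horizontal and a vertical
  segment through one of the corners \<open>(s, y)\<close>, \<open>(x, 1 - s)\<close>, and one of the two corners always
  lies in the triangle. The squared difference of the values is then bounded by one-dimensional
  energies along rows and columns, which integrate to the energy of the triangle.
\<close>

lemma triangle_Poincare:
  assumes "C_k 1 \<phi>"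
  shows "(LINT x|lebesgue_on (convex hull {a, b, c}). (\<phi> x - seg_mean b c \<phi>)\<^sup>2) \<le>
     4 * ((dist a b)\<^sup>2 + (dist a c)\<^sup>2) *
     energy \<phi> (convex hull {a, b, c})"
proof -
  let ?T = "convex hull {a, b, c}" and ?D = "\<bar>cross (b - a) (c - a)\<bar>"
  let ?S = "LINT x|lebesgue_on ?T. classical_grad \<phi> x \<bullet> classical_grad \<phi> x"
  note phi = C_k_1_classical_grad[OF assms(1)]
  have phi_cont: "continuous_on X (\<lambda>x. \<phi> (f x))" "continuous_on X (\<lambda>x. classical_grad \<phi> (f x))"
    if "continuous_on X f" for X and f :: "'z::topological_space \<Rightarrow> plane"
    by (rule continuous_on_compose2[OF phi(3) that] continuous_on_compose2[OF phi(2) that]; simp)+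
  let ?P = "\<lambda>x y. a + x *\<^sub>R (b - a) + y *\<^sub>R (c - a)"
  let ?m = "seg_mean b c \<phi>"
  define F where "F x y = \<phi> (?P x y)" for x y
  define Fx where "Fx x y = classical_grad \<phi> (?P x y) \<bullet> (b - a)" for x y
  define Fy where "Fy x y = classical_grad \<phi> (?P x y) \<bullet> (c - a)" for x y
  \<comment> \<open>Energies along a row and along a column of the triangle.\<close>
  define A where "A y = integral {0..1 - y} (\<lambda>x. (Fx x y)\<^sup>2)" for y
  define B where "B x = integral {0..1 - x} (\<lambda>y. (Fy x y)\<^sup>2)" for x
  define \<alpha> where "\<alpha> = integral {0..1} A"
  define \<beta> where "\<beta> = integral {0..1} B"
  have cont: "continuous_on X (\<lambda>t. F (f t) (g t))" "continuous_on X (\<lambda>t. Fx (f t) (g t))" "continuous_on X (\<lambda>t. Fy (f t) (g t))"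
    if "continuous_on X f" "continuous_on X g" for X and f g :: "real \<Rightarrow> real"
    unfolding F_def Fx_def Fy_def by (intro phi_cont continuous_intros that)+
  have swapP: "a + x *\<^sub>R (c - a) + y *\<^sub>R (b - a) = ?P y x" for x y
    by (simp add: algebra_simps)
  have A0: "A y \<ge> 0" and B0: "B y \<ge> 0" for y
    unfolding A_def B_def by (intro integral_nonneg integrable_continuous_real continuous_intros cont; simp)+
  have contx: "continuous_on UNIV (\<lambda>x. (classical_grad \<phi> x \<bullet> w)\<^sup>2)" for w
    by (intro continuous_intros phi)
  have Aint: "A integrable_on {0..1}" and Bint: "B integrable_on {0..1}"
    using LINT_triangle(2)[OF contx[of "b - a"], of a b c] LINT_triangle(2)[OF contx[of "c - a"], of a c b]
    unfolding A_def B_def Fx_def Fy_def swapP by simp_all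
  have S_int: "integrable (lebesgue_on ?T) (\<lambda>x. classical_grad \<phi> x \<bullet> classical_grad \<phi> x)"
    by (intro LINT_compact(1) compact_triangle continuous_intros continuous_on_subset[OF phi(2)]) auto
  have side: "(LINT x|lebesgue_on ?T. (classical_grad \<phi> x \<bullet> w)\<^sup>2) \<le> (norm w)\<^sup>2 * ?S" for w
  proof -
    have "(LINT x|lebesgue_on ?T. (classical_grad \<phi> x \<bullet> w)\<^sup>2) \<le>
        (LINT x|lebesgue_on ?T. (norm w)\<^sup>2 * (classical_grad \<phi> x \<bullet> classical_grad \<phi> x))"
    proof (rule Bochner_Integration.integral_mono)
      show "integrable (lebesgue_on ?T) (\<lambda>x. (classical_grad \<phi> x \<bullet> w)\<^sup>2)"
        by (intro LINT_compact(1) compact_triangle continuous_on_subset[OF contx]) auto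
      show "integrable (lebesgue_on ?T) (\<lambda>x. (norm w)\<^sup>2 * (classical_grad \<phi> x \<bullet> classical_grad \<phi> x))"
        using S_int by simp
      show "(classical_grad \<phi> x \<bullet> w)\<^sup>2 \<le> (norm w)\<^sup>2 * (classical_grad \<phi> x \<bullet> classical_grad \<phi> x)" for x
        using Cauchy_Schwarz_ineq[of "classical_grad \<phi> x" w] by (simp add: power2_norm_eq_inner mult.commute)
    qed
    then show ?thesis by simp
  qed
  have D\<alpha>: "?D * \<alpha> \<le> (dist a b)\<^sup>2 * ?S"
    using side[of "b - a"] LINT_triangle(1)[OF contx[of "b - a"], of a b c]
    unfolding \<alpha>_def A_def Fx_def by (simp add: dist_norm norm_minus_commute)
  have swapT: "convex hull {a, c, b} = ?T" "\<bar>cross (c - a) (b - a)\<bar> = ?D"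
    using cross_commute[of "c - a" "b - a"] by (auto simp: insert_commute)
  have D\<beta>: "?D * \<beta> \<le> (dist a c)\<^sup>2 * ?S"
    using side[of "c - a"] LINT_triangle(1)[OF contx[of "c - a"], of a c b]
    unfolding \<beta>_def B_def Fy_def swapP swapT by (simp add: dist_norm norm_minus_commute)
  have \<alpha>0: "\<alpha> \<ge> 0" and \<beta>0: "\<beta> \<ge> 0"
    unfolding \<alpha>_def \<beta>_def using A0 B0 Aint Bint by (auto intro: integral_nonneg)
  have dx: "((\<lambda>x. F x y) has_real_derivative Fx x y) (at x)" for x y
    using C_k_1_path_derivative[OF assms, of "a + y *\<^sub>R (c - a)" "b - a" x UNIV]
    unfolding F_def Fx_def by (simp add: algebra_simps)
  have dy: "((\<lambda>y. F x y) has_real_derivative Fy x y) (at y)" for x y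
    using C_k_1_path_derivative[OF assms, of "a + x *\<^sub>R (b - a)" "c - a" y UNIV]
    unfolding F_def Fy_def .
  have hor: "(F x y - F s y)\<^sup>2 \<le> A y" if "0 \<le> y" "x \<in> {0..1 - y}" "s \<in> {0..1 - y}" for x s y
    unfolding A_def by (rule unit_interval_oscillation[OF dx]) (use that in \<open>auto intro!: cont continuous_intros\<close>)
  have ver: "(F x y - F x s)\<^sup>2 \<le> B x" if "0 \<le> x" "y \<in> {0..1 - x}" "s \<in> {0..1 - x}" for x s y
    unfolding B_def by (rule unit_interval_oscillation[OF dy]) (use that in \<open>auto intro!: cont continuous_intros\<close>)
  have sq: "(p - r)\<^sup>2 \<le> 2 * ((p - q)\<^sup>2 + (q - r)\<^sup>2)" for p q r :: real
    using zero_le_power2[of "p - 2 * q + r"] by (simp add: power2_eq_square algebra_simps)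
  \<comment> \<open>The corner \<open>(s, y)\<close> is in the triangle if \<open>s + y \<le> 1\<close>, the corner \<open>(x, 1 - s)\<close> otherwise;
      adding the energies of both paths makes the bound uniform.\<close>
  have path: "(F x y - F s (1 - s))\<^sup>2 \<le> 2 * (A y + B x) + 2 * (A (1 - s) + B s)"
    if "0 \<le> x" "0 \<le> y" "x + y \<le> 1" "s \<in> {0..1}" for x y s
  proof (cases "s + y \<le> 1")
    case True
    have "(F x y - F s (1 - s))\<^sup>2 \<le> 2 * ((F x y - F s y)\<^sup>2 + (F s y - F s (1 - s))\<^sup>2)" by (rule sq)
    also have "\<dots> \<le> 2 * (A y + B s)"
      using hor[of y x s] ver[of s y "1 - s"] that True by auto
    finally show ?thesis using A0[of "1 - s"] B0[of x] by simp
  next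
    case False
    have "(F x y - F s (1 - s))\<^sup>2 \<le> 2 * ((F x y - F x (1 - s))\<^sup>2 + (F x (1 - s) - F s (1 - s))\<^sup>2)" by (rule sq)
    also have "\<dots> \<le> 2 * (B x + A (1 - s))"
      using ver[of x y "1 - s"] hor[of "1 - s" x s] that False by auto
    finally show ?thesis using A0[of y] B0[of s] by simp
  qed
  have mF: "?m = integral {0..1} (\<lambda>s. F s (1 - s))"
  proof -
    have "?m = integral {0..1} (\<lambda>s. \<phi> ((1 - s) *\<^sub>R c + s *\<^sub>R b))"
      by (subst seg_mean_commute) (simp add: seg_mean_def)
    also have "(\<lambda>s. \<phi> ((1 - s) *\<^sub>R c + s *\<^sub>R b)) = (\<lambda>s. F s (1 - s))"
      unfolding F_def by (intro ext arg_cong[where f = \<phi>]) (simp add: algebra_simps)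
    finally show ?thesis .
  qed
  have hA: "(A has_integral \<alpha>) {0..1}" and hB: "(B has_integral \<beta>) {0..1}"
    using Aint Bint unfolding \<alpha>_def \<beta>_def by (simp_all add: integrable_integral)
  have hA': "((\<lambda>s. A (1 - s)) has_integral \<alpha>) {0..1}"
    using Aint integral_reflect_unit[of A] unfolding \<alpha>_def by (simp add: has_integral_iff)
  have hc: "((\<lambda>s. k) has_integral k * (r - l)) {l..r}" if "l \<le> r" for k l r :: real
    using has_integral_const_real[of k l r] that by (simp add: mult.commute)
  have point: "(F x y - ?m)\<^sup>2 \<le> 2 * (A y + B x) + 2 * (\<alpha> + \<beta>)" if "0 \<le> x" "0 \<le> y" "x + y \<le> 1" for x y
  proof -
    have c1: "continuous_on {0..1} (\<lambda>s. F x y - F s (1 - s))"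
      by (intro continuous_intros cont)
    have "F x y - ?m = integral {0..1} (\<lambda>s. F x y - F s (1 - s))"
      unfolding mF
      by (subst Henstock_Kurzweil_Integration.integral_diff) (auto intro!: integrable_continuous_real continuous_intros cont)
    also have "\<dots>\<^sup>2 \<le> (1 - 0) * integral {0..1} (\<lambda>s. (F x y - F s (1 - s))\<^sup>2)"
      by (rule integral_square_le[OF _ c1]) simp
    also have "\<dots> \<le> 2 * (A y + B x) * (1 - 0) + 2 * (\<alpha> + \<beta>)"
    proof -
      have "(\<lambda>s. (F x y - F s (1 - s))\<^sup>2) integrable_on {0..1}"
        by (intro integrable_continuous_real continuous_on_power c1)
      moreover have "((\<lambda>s. 2 * (A y + B x) + 2 * (A (1 - s) + B s)) has_integral
          2 * (A y + B x) * (1 - 0) + 2 * (\<alpha> + \<beta>)) {0..1}"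
        by (intro has_integral_add has_integral_mult_right hc hA' hB) simp
      ultimately have "integral {0..1} (\<lambda>s. (F x y - F s (1 - s))\<^sup>2) \<le> 2 * (A y + B x) * (1 - 0) + 2 * (\<alpha> + \<beta>)"
        using has_integral_le[OF integrable_integral] path[OF that] by blast
      then show ?thesis by simp
    qed
    finally show ?thesis by simp
  qed
  have contm: "continuous_on UNIV (\<lambda>x. (\<phi> x - ?m)\<^sup>2)"
    by (intro continuous_intros phi)
  have inner: "integral {0..1 - y} (\<lambda>x. (F x y - ?m)\<^sup>2) \<le> 2 * A y + (2 * \<alpha> + 4 * \<beta>)" if "y \<in> {0..1}" for y
  proof -
    have sub: "{0..1 - y} \<subseteq> {0..1}" using that by auto
    have Bint': "B integrable_on {0..1 - y}"
      by (rule integrable_on_subinterval[OF Bint sub])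
    have "integral {0..1 - y} (\<lambda>x. (F x y - ?m)\<^sup>2)
        \<le> (2 * A y + 2 * (\<alpha> + \<beta>)) * (1 - y - 0) + 2 * integral {0..1 - y} B"
    proof -
      have "(\<lambda>x. (F x y - ?m)\<^sup>2) integrable_on {0..1 - y}"
        by (intro integrable_continuous_real continuous_intros cont)
      moreover have "((\<lambda>x. (2 * A y + 2 * (\<alpha> + \<beta>)) + 2 * B x) has_integral
          (2 * A y + 2 * (\<alpha> + \<beta>)) * (1 - y - 0) + 2 * integral {0..1 - y} B) {0..1 - y}"
        using that by (intro has_integral_add has_integral_mult_right hc integrable_integral Bint') simp
      moreover have "(F x y - ?m)\<^sup>2 \<le> (2 * A y + 2 * (\<alpha> + \<beta>)) + 2 * B x" if "x \<in> {0..1 - y}" for x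
        using point[of x y] that \<open>y \<in> {0..1}\<close> by (simp add: algebra_simps)
      ultimately show ?thesis
        using has_integral_le[OF integrable_integral] by blast
    qed
    also have "\<dots> \<le> (2 * A y + 2 * (\<alpha> + \<beta>)) * 1 + 2 * \<beta>"
    proof -
      have "integral {0..1 - y} B \<le> \<beta>"
        unfolding \<beta>_def by (rule integral_subset_le[OF sub Bint' Bint]) (use B0 in auto)
      moreover have "(2 * A y + 2 * (\<alpha> + \<beta>)) * (1 - y - 0) \<le> (2 * A y + 2 * (\<alpha> + \<beta>)) * 1"
        using that A0[of y] \<alpha>0 \<beta>0 by (intro mult_left_mono) auto
      ultimately show ?thesis by linarith
    qed
    finally show ?thesis by (simp add: algebra_simps)
  qed
  have "integral {0..1} (\<lambda>y. integral {0..1 - y} (\<lambda>x. (F x y - ?m)\<^sup>2))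
      \<le> 2 * \<alpha> + (2 * \<alpha> + 4 * \<beta>) * (1 - 0)"
  proof -
    have "(\<lambda>y. integral {0..1 - y} (\<lambda>x. (F x y - ?m)\<^sup>2)) integrable_on {0..1}"
      using LINT_triangle(2)[OF contm, of a b c] unfolding F_def .
    moreover have "((\<lambda>y. 2 * A y + (2 * \<alpha> + 4 * \<beta>)) has_integral 2 * \<alpha> + (2 * \<alpha> + 4 * \<beta>) * (1 - 0)) {0..1}"
      by (intro has_integral_add has_integral_mult_right hc hA) simp
    ultimately show ?thesis
      using has_integral_le[OF integrable_integral] inner by blast
  qed
  also have "\<dots> = 4 * \<alpha> + 4 * \<beta>" by simp
  finally have "?D * integral {0..1} (\<lambda>y. integral {0..1 - y} (\<lambda>x. (F x y - ?m)\<^sup>2)) \<le> ?D * (4 * \<alpha> + 4 * \<beta>)"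
    by (intro mult_left_mono) auto
  also have "\<dots> \<le> 4 * ((dist a b)\<^sup>2 + (dist a c)\<^sup>2) * ?S"
    using D\<alpha> D\<beta> by (simp add: algebra_simps)
  finally show ?thesis
    unfolding energy_def LINT_triangle(1)[OF contm, of a b c] F_def .
qed

section \<open>Test functions and weak gradients\<close>

lemma integrable_lebesgue_on_iff:
  fixes h :: "'a::euclidean_space \<Rightarrow> real"
  assumes "S \<in> sets lebesgue"
  shows "integrable (lebesgue_on S) h \<longleftrightarrow> h absolutely_integrable_on S"
  using assms by (simp add: set_integrable_def integrable_restrict_space)

text \<open>
  Closed triangles of a mesh may stick out of the open domain by a null set; functions defined
  up to null sets in the domain are integrated over them by this lemma.
\<close>

lemma LINT_on_almost_subset:
  fixes h :: "'a::euclidean_space \<Rightarrow> real"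
  assumes "\<Omega> \<in> sets lebesgue" "S \<in> sets lebesgue" "negligible (S - \<Omega>)" "integrable (lebesgue_on \<Omega>) h"
  shows "integrable (lebesgue_on S) h"
    and "(LINT x|lebesgue_on S. h x) = (LINT x|lebesgue_on \<Omega>. indicator S x * h x)"
proof -
  have "h absolutely_integrable_on \<Omega>"
    using assms(1,4) by (simp add: integrable_lebesgue_on_iff)
  then have 1: "h absolutely_integrable_on (S \<inter> \<Omega>)"
    by (rule set_integrable_subset) (use assms(1,2) in auto)
  have neg: "negligible {x \<in> S \<inter> \<Omega> - S. h x \<noteq> 0}" "negligible {x \<in> S - S \<inter> \<Omega>. h x \<noteq> 0}"
    by (auto intro: negligible_subset[OF assms(3)])
  have 2: "h absolutely_integrable_on S"
    using 1 absolutely_integrable_spike_set_eq[OF neg] by simp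
  then show 3: "integrable (lebesgue_on S) h"
    using assms(2) by (simp add: integrable_lebesgue_on_iff)
  have "(LINT x|lebesgue_on S. h x) = integral S h"
    by (rule lebesgue_integral_eq_integral[OF 3 assms(2)])
  also have "\<dots> = integral (S \<inter> \<Omega>) h"
    by (rule integral_spike_set[OF neg(2,1)])
  also have "\<dots> = (LINT x:S \<inter> \<Omega>|lebesgue. h x)"
    using set_lebesgue_integral_eq_integral(2)[OF 1] by simp
  also have "\<dots> = (LINT x|lebesgue. indicator \<Omega> x *\<^sub>R (indicator S x * h x))"
    unfolding set_lebesgue_integral_def
    by (rule Bochner_Integration.integral_cong) (auto simp: indicator_def)
  also have "\<dots> = (LINT x|lebesgue_on \<Omega>. indicator S x * h x)"
    using assms(1) by (simp add: integral_restrict_space)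
  finally show "(LINT x|lebesgue_on S. h x) = (LINT x|lebesgue_on \<Omega>. indicator S x * h x)" .
qed

lemma sum_LINT_partition:
  fixes h :: "'a::euclidean_space \<Rightarrow> real"
  assumes "finite M" "\<Omega> \<in> sets lebesgue" "\<And>T. T \<in> M \<Longrightarrow> T \<in> sets lebesgue"
    and "\<And>T T'. T \<in> M \<Longrightarrow> T' \<in> M \<Longrightarrow> T \<noteq> T' \<Longrightarrow> negligible (T \<inter> T')"
    and "negligible (\<Union>M - \<Omega>)" "negligible (\<Omega> - \<Union>M)"
    and h: "integrable (lebesgue_on \<Omega>) h"
  shows "(\<Sum>T\<in>M. LINT x|lebesgue_on T. h x) = (LINT x|lebesgue_on \<Omega>. h x)"
proof -
  have Un: "\<Union>M \<in> sets lebesgue"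
    using assms(1,3) by (intro sets.finite_Union) auto
  have T: "integrable (lebesgue_on T) h" if "T \<in> M" for T
    by (rule LINT_on_almost_subset(1)[OF assms(2) assms(3)[OF that] _ h])
       (use that in \<open>auto intro: negligible_subset[OF assms(5)]\<close>)
  have U: "integrable (lebesgue_on (\<Union>M)) h"
    by (rule LINT_on_almost_subset(1)[OF assms(2) Un assms(5) h])
  have "(\<Sum>T\<in>M. LINT x|lebesgue_on T. h x) = (\<Sum>T\<in>M. LINT x:T|lebesgue. h x)"
    using assms(3) by (intro sum.cong) (auto simp: set_lebesgue_integral_def integral_restrict_space)
  also have "\<dots> = (LINT x:(\<Union>T\<in>M. T)|lebesgue. h x)"
  proof (rule set_integral_finite_UN_AE[symmetric])
    show "AE x in lebesgue. x \<in> T \<and> x \<in> T' \<longrightarrow> T = T'" if "T \<in> M" "T' \<in> M" for T T'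
    proof (cases "T = T'")
      case False
      with assms(4) that have "T \<inter> T' \<in> null_sets lebesgue"
        by (simp add: negligible_iff_null_sets)
      from AE_not_in[OF this] show ?thesis
        by (rule AE_mp) auto
    qed simp
  qed (use assms(1,3) T in \<open>auto simp: integrable_lebesgue_on_iff\<close>)
  also have "\<dots> = (LINT x|lebesgue_on (\<Union>M). h x)"
    using Un by (simp add: set_lebesgue_integral_def integral_restrict_space)
  also have "\<dots> = integral (\<Union>M) h"
    by (rule lebesgue_integral_eq_integral[OF U Un])
  also have "\<dots> = integral \<Omega> h"
    by (rule integral_spike_set) (auto intro: negligible_subset[OF assms(5)] negligible_subset[OF assms(6)])
  also have "\<dots> = (LINT x|lebesgue_on \<Omega>. h x)"
    by (rule lebesgue_integral_eq_integral[OF h assms(2), symmetric])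
  finally show ?thesis .
qed

lemma L2_mult_integrable:
  assumes "f \<in> L2 \<Omega>" "g \<in> L2 \<Omega>"
  shows "integrable (lebesgue_on \<Omega>) (\<lambda>x. f x * g x)"
    and "(LINT x|lebesgue_on \<Omega>. f x * g x)\<^sup>2 \<le> (LINT x|lebesgue_on \<Omega>. (f x)\<^sup>2) * (LINT x|lebesgue_on \<Omega>. (g x)\<^sup>2)"
  using integral_Cauchy_Schwarz[of f "lebesgue_on \<Omega>" g] assms
  by (simp_all add: L2_def power2_eq_square)

lemma L2_diff:
  assumes "f \<in> L2 \<Omega>" "g \<in> L2 \<Omega>"
  shows "(\<lambda>x. f x - g x) \<in> L2 \<Omega>"
proof -
  have f: "f \<in> borel_measurable (lebesgue_on \<Omega>)" "integrable (lebesgue_on \<Omega>) (\<lambda>x. (f x)\<^sup>2)"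
    and g: "g \<in> borel_measurable (lebesgue_on \<Omega>)" "integrable (lebesgue_on \<Omega>) (\<lambda>x. (g x)\<^sup>2)"
    using assms by (auto simp: L2_def)
  have "integrable (lebesgue_on \<Omega>) (\<lambda>x. (f x)\<^sup>2 - 2 * (f x * g x) + (g x)\<^sup>2)"
    by (intro Bochner_Integration.integrable_add Bochner_Integration.integrable_diff f g
        integrable_mult_right L2_mult_integrable(1)[OF assms])
  also have "(\<lambda>x. (f x)\<^sup>2 - 2 * (f x * g x) + (g x)\<^sup>2) = (\<lambda>x. (f x - g x)\<^sup>2)"
    by (rule ext) (simp add: power2_eq_square algebra_simps)
  finally show ?thesis
    using f(1) g(1) unfolding L2_def by simp
qed

lemma L2_const:
  assumes "S \<in> lmeasurable"
  shows "(\<lambda>x. c) \<in> L2 S"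
proof -
  have "integrable (lebesgue_on S) (\<lambda>x. c\<^sup>2)"
    by (rule finite_measure.integrable_const[OF finite_measure_lebesgue_on[OF assms]])
  then show ?thesis by (simp add: L2_def)
qed

lemma L2_integrable:
  assumes "S \<in> lmeasurable" "f \<in> L2 S"
  shows "integrable (lebesgue_on S) f"
  using L2_mult_integrable(1)[OF assms(2) L2_const[OF assms(1), of 1]] by simp

lemma L2_almost_subset:
  assumes "\<Omega> \<in> lmeasurable" "S \<in> sets lebesgue" "negligible (S - \<Omega>)" "f \<in> L2 \<Omega>"
  shows "f \<in> L2 S"
proof -
  have "\<Omega> \<in> sets lebesgue" using assms(1) by blast
  note sub = LINT_on_almost_subset(1)[OF this assms(2,3)]
  have "integrable (lebesgue_on S) f"
    by (rule sub[OF L2_integrable[OF assms(1,4)]])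
  moreover have "integrable (lebesgue_on S) (\<lambda>x. (f x)\<^sup>2)"
    by (rule sub) (use assms(4) in \<open>simp add: L2_def\<close>)
  ultimately show ?thesis by (auto simp: L2_def)
qed

lemma LINT_compact_support:
  fixes k :: "'a::euclidean_space \<Rightarrow> real"
  assumes "continuous_on UNIV k" "compact K" "\<And>x. x \<notin> K \<Longrightarrow> k x = 0" "K \<subseteq> S" "S \<in> sets lebesgue"
  shows "integrable (lebesgue_on S) k" "(LINT x|lebesgue_on S. k x) = (LINT x|lborel. k x)"
proof -
  have "(\<lambda>x. indicator K x *\<^sub>R k x) = k"
    using assms(3) by (intro ext) (auto simp: indicator_def)
  moreover have "integrable lborel (\<lambda>x. indicator K x *\<^sub>R k x)"
    by (rule borel_integrable_compact[OF assms(2) continuous_on_subset[OF assms(1)]]) simp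
  ultimately have lb: "integrable lborel k" by metis
  then have leb: "integrable lebesgue k" "integral\<^sup>L lebesgue k = integral\<^sup>L lborel k"
    by (simp_all add: integrable_completion integral_completion borel_measurable_integrable)
  have S: "S \<inter> space lebesgue \<in> sets lebesgue" using assms(5) by simp
  have ind: "(\<lambda>x. indicator S x *\<^sub>R k x) = k"
    using assms(3,4) by (intro ext) (auto simp: indicator_def)
  show "integrable (lebesgue_on S) k" "(LINT x|lebesgue_on S. k x) = (LINT x|lborel. k x)"
    unfolding integrable_restrict_space[OF S] integral_restrict_space[OF S] ind using leb by simp_all
qed

lemma test_function_continuous: "\<phi> \<in> test_functions \<Omega> \<Longrightarrow> continuous_on UNIV \<phi>"
  using test_functionsD(1)[of \<phi> \<Omega> 0] by simp

lemma test_function_integral: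
  assumes "\<phi> \<in> test_functions \<Omega>" "\<Omega> \<in> sets lebesgue"
  shows "integrable (lebesgue_on \<Omega>) \<phi>" "(LINT x|lebesgue_on \<Omega>. \<phi> x) = (LINT x|lborel. \<phi> x)"
proof -
  obtain K where "compact K" "K \<subseteq> \<Omega>" "\<And>x. x \<notin> K \<Longrightarrow> \<phi> x = 0"
    using test_functionsD(2)[OF assms(1)] by blast
  then show "integrable (lebesgue_on \<Omega>) \<phi>" "(LINT x|lebesgue_on \<Omega>. \<phi> x) = (LINT x|lborel. \<phi> x)"
    using LINT_compact_support[OF test_function_continuous[OF assms(1)], of K] assms(2) by blast+
qed

lemma test_function_L2:
  assumes "\<phi> \<in> test_functions \<Omega>" "\<Omega> \<in> sets lebesgue"
  shows "\<phi> \<in> L2 \<Omega>"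
  using test_function_integral(1)[OF test_function_mult[OF assms(1,1)] assms(2)]
    continuous_imp_measurable_on[OF test_function_continuous[OF assms(1)]]
  by (simp add: L2_def power2_eq_square)

lemma test_function_C1: "\<phi> \<in> test_functions \<Omega> \<Longrightarrow> C_k 1 \<phi>"
  using test_functionsD(1) by blast

text \<open>
  On a triangle so large that its edges miss the support, \<open>LINT_grad_along_side\<close> gives zero for
  the two axis directions.
\<close>

lemma integral_partial_deriv_test_function:
  assumes "w \<in> test_functions \<Omega>"
  shows "(LINT x|lborel. partial_deriv i w x) = 0"
proof -
  obtain K where K: "compact K" "K \<subseteq> \<Omega>" "\<And>x. x \<notin> K \<Longrightarrow> w x = 0"
    using test_functionsD(2)[OF assms] by blast
  obtain K' where K': "compact K'" "\<And>x. x \<notin> K' \<Longrightarrow> partial_deriv i w x = 0"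
    using test_functionsD(2)[OF partial_deriv_test_function[OF assms]] by blast
  have "bounded (K \<union> K')" using K(1) K'(1) compact_imp_bounded by blast
  then obtain R where R: "R > 0" "\<And>x. x \<in> K \<union> K' \<Longrightarrow> norm x < R"
    unfolding bounded_pos_less by blast
  have comp: "\<bar>x $ j\<bar> < R" if "x \<in> K \<union> K'" for x j
    using R(2)[OF that] component_le_norm_cart[of x j] by linarith
  \<comment> \<open>A right triangle around the square \<open>[-R, R]^2\<close>; its hypotenuse passes through the corner
      \<open>(R, R)\<close>, which is outside the support.\<close>
  define a b c :: plane where "a = vector [-R, -R]" and "b = vector [3 * R, -R]" and "c = vector [-R, 3 * R]"
  have abc: "a $ 1 = -R" "a $ 2 = -R" "b $ 1 = 3 * R" "b $ 2 = -R" "c $ 1 = -R" "c $ 2 = 3 * R"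
    by (simp_all add: a_def b_def c_def vector_2)
  have D: "cross (b - a) (c - a) = 16 * R\<^sup>2"
    by (simp add: abc cross_def power2_eq_square)
  have sub: "K' \<subseteq> convex hull {a, b, c}"
  proof
    fix x assume "x \<in> K'"
    then have *: "\<bar>x $ 1\<bar> < R" "\<bar>x $ 2\<bar> < R" using comp by auto
    have D': "cross (c - b) (a - b) = 16 * R\<^sup>2" "cross (a - c) (b - c) = 16 * R\<^sup>2"
      using D by (simp_all add: cross_def algebra_simps)
    have "cross (b - x) (c - x) = 4 * R * (2 * R - x $ 1 - x $ 2)" "cross (c - x) (a - x) = 4 * R * (x $ 1 + R)"
      "cross (a - x) (b - x) = 4 * R * (x $ 2 + R)"
      by (simp_all add: abc cross_def algebra_simps)
    moreover have "0 \<le> 4 * R * (2 * R - x $ 1 - x $ 2)" "0 \<le> 4 * R * (x $ 1 + R)" "0 \<le> 4 * R * (x $ 2 + R)"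
      using * R(1) by (intro mult_nonneg_nonneg; linarith)+
    moreover have "cross (b - a) (c - a) \<noteq> 0" using D R(1) by simp
    ultimately show "x \<in> convex hull {a, b, c}"
      unfolding triangle_eq_bary[OF \<open>cross (b - a) (c - a) \<noteq> 0\<close>] bary_def D D' by simp
  qed
  have zero: "seg_mean p q w = 0" if "\<And>t. t \<in> {0..1} \<Longrightarrow> (1 - t) *\<^sub>R p + t *\<^sub>R q \<notin> K" for p q
  proof -
    have "seg_mean p q w = integral {0..1} (\<lambda>t::real. 0)"
      unfolding seg_mean_def by (rule Henstock_Kurzweil_Integration.integral_cong) (use that K(3) in auto)
    then show ?thesis by simp
  qed
  have ab: "seg_mean a b w = 0"
  proof (rule zero)
    show "(1 - t) *\<^sub>R a + t *\<^sub>R b \<notin> K" if "t \<in> {0..1}" for t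
      using comp[of "(1 - t) *\<^sub>R a + t *\<^sub>R b" 2] R(1) by (auto simp: abc algebra_simps)
  qed
  have ac: "seg_mean a c w = 0"
  proof (rule zero)
    show "(1 - t) *\<^sub>R a + t *\<^sub>R c \<notin> K" if "t \<in> {0..1}" for t
      using comp[of "(1 - t) *\<^sub>R a + t *\<^sub>R c" 1] R(1) by (auto simp: abc algebra_simps)
  qed
  have bc: "seg_mean b c w = 0"
  proof (rule zero)
    show "(1 - t) *\<^sub>R b + t *\<^sub>R c \<notin> K" if "t \<in> {0..1}" for t
    proof
      assume "(1 - t) *\<^sub>R b + t *\<^sub>R c \<in> K"
      then have "\<bar>(1 - t) * (3 * R) + t * (- R)\<bar> < R" "\<bar>(1 - t) * (- R) + t * (3 * R)\<bar> < R"
        using comp[of "(1 - t) *\<^sub>R b + t *\<^sub>R c" 1] comp[of "(1 - t) *\<^sub>R b + t *\<^sub>R c" 2]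
        by (simp_all add: abc)
      then have "((1 - t) * (3 * R) + t * (- R)) + ((1 - t) * (- R) + t * (3 * R)) < R + R"
        by linarith
      then show False by (simp add: algebra_simps)
    qed
  qed
  let ?T = "convex hull {a, b, c}"
  have C1: "C_k 1 w" using assms test_function_C1 by blast
  have g1: "classical_grad w x \<bullet> (b - a) = 4 * R * partial_deriv 1 w x"
    and g2: "classical_grad w x \<bullet> (c - a) = 4 * R * partial_deriv 2 w x" for x
    by (simp_all add: inner_plane classical_grad_def abc)
  have "(LINT x|lebesgue_on ?T. 4 * R * partial_deriv 1 w x) = 0"
    using LINT_grad_along_side[OF C1, of a b c] unfolding g1 bc ac by simp
  moreover have "(LINT x|lebesgue_on ?T. 4 * R * partial_deriv 2 w x) = 0"
    using LINT_grad_along_side[OF C1, of a c b] unfolding g2 seg_mean_commute[of c b] bc ab by (simp add: insert_commute)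
  ultimately have "(LINT x|lebesgue_on ?T. partial_deriv i w x) = 0"
    using R(1) exhaust_2[of i] by auto
  then show ?thesis
    using LINT_compact_support(2)[OF test_function_continuous[OF partial_deriv_test_function[OF assms]] K' sub]
      compact_triangle lmeasurable_compact by (metis fmeasurableD)
qed

text \<open>
  Integration by parts: the partial derivatives of a product of test functions have integral
  zero.
\<close>

lemma test_function_weak_grad:
  assumes "\<phi> \<in> test_functions \<Omega>" "\<Omega> \<in> sets lebesgue"
  shows "has_weak_grad \<Omega> \<phi> (classical_grad \<phi>)"
  unfolding has_weak_grad_def
proof (intro conjI allI ballI)
  show "\<phi> \<in> L2 \<Omega>" using test_function_L2[OF assms] .
  show "(\<lambda>x. classical_grad \<phi> x $ i) \<in> L2 \<Omega>" for i
    using test_function_L2[OF partial_deriv_test_function[OF assms(1)] assms(2), of i]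
    by (simp add: classical_grad_def)
  fix \<theta> and i :: 2 assume \<theta>: "\<theta> \<in> test_functions \<Omega>"
  note int = test_function_integral[OF test_function_mult assms(2)]
  note d = partial_deriv_test_function
  have "partial_deriv i (\<lambda>x. \<phi> x * \<theta> x) = (\<lambda>x. \<phi> x * partial_deriv i \<theta> x + partial_deriv i \<phi> x * \<theta> x)"
    using test_function_C1[OF assms(1)] test_function_C1[OF \<theta>] partial_deriv_mult by auto
  then have "(LINT x|lebesgue_on \<Omega>. \<phi> x * partial_deriv i \<theta> x + partial_deriv i \<phi> x * \<theta> x) = 0"
    using integral_partial_deriv_test_function[OF test_function_mult[OF assms(1) \<theta>], of i]
      test_function_integral(2)[OF d[OF test_function_mult[OF assms(1) \<theta>]] assms(2), of i] by simp
  then show "(LINT x|lebesgue_on \<Omega>. \<phi> x * partial_deriv i \<theta> x) = - (LINT x|lebesgue_on \<Omega>. classical_grad \<phi> x $ i * \<theta> x)"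
    using int(1)[OF assms(1) d[OF \<theta>]] int(1)[OF d[OF assms(1)] \<theta>]
    by (simp add: classical_grad_def)
qed

lemma has_weak_grad_diff:
  assumes "has_weak_grad \<Omega> v g" "has_weak_grad \<Omega> w h" "\<Omega> \<in> sets lebesgue"
  shows "has_weak_grad \<Omega> (v - w) (\<lambda>x. g x - h x)"
  unfolding has_weak_grad_def
proof (intro conjI allI ballI)
  note v = assms(1)[unfolded has_weak_grad_def] and w = assms(2)[unfolded has_weak_grad_def]
  show "v - w \<in> L2 \<Omega>"
    using v w L2_diff[of v \<Omega> w] by (simp add: fun_diff_def)
  show "(\<lambda>x. (g x - h x) $ i) \<in> L2 \<Omega>" for i
    using v w L2_diff[of "\<lambda>x. g x $ i" \<Omega> "\<lambda>x. h x $ i"] by simp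
  fix \<theta> and i :: 2 assume \<theta>: "\<theta> \<in> test_functions \<Omega>"
  have L: "\<theta> \<in> L2 \<Omega>" "partial_deriv i \<theta> \<in> L2 \<Omega>"
    using \<theta> assms(3) test_function_L2 partial_deriv_test_function by blast+
  have "(LINT x|lebesgue_on \<Omega>. (v - w) x * partial_deriv i \<theta> x) =
      (LINT x|lebesgue_on \<Omega>. v x * partial_deriv i \<theta> x) - (LINT x|lebesgue_on \<Omega>. w x * partial_deriv i \<theta> x)"
    using v w L L2_mult_integrable(1) by (simp add: left_diff_distrib)
  also have "\<dots> = - (LINT x|lebesgue_on \<Omega>. g x $ i * \<theta> x) + (LINT x|lebesgue_on \<Omega>. h x $ i * \<theta> x)"
    using v w \<theta> by simp
  also have "\<dots> = - (LINT x|lebesgue_on \<Omega>. (g x - h x) $ i * \<theta> x)"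
    using v w L L2_mult_integrable(1) by (simp add: left_diff_distrib)
  finally show "(LINT x|lebesgue_on \<Omega>. (v - w) x * partial_deriv i \<theta> x) = - (LINT x|lebesgue_on \<Omega>. (g x - h x) $ i * \<theta> x)" .
qed

text \<open>
  Two weak gradients of \<open>v\<close> have the same integrals against bump functions, and these converge
  to the indicator of the open triangle. Weak gradients are in fact equal almost everywhere, but
  integrals over triangles are all that the residual contains.
\<close>

lemma weak_grad_integral_unique:
  assumes g: "has_weak_grad \<Omega> v g" and h: "has_weak_grad \<Omega> v h" and \<Omega>: "\<Omega> \<in> lmeasurable"
    and nz: "cross (b - a) (c - a) \<noteq> 0"
    and inner: "open_triangle a b c \<subseteq> \<Omega>"
    and bd: "negligible (convex hull {a, b, c} - \<Omega>)"
    and bd': "negligible (convex hull {a, b, c} - open_triangle a b c)"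
  shows "(LINT x|lebesgue_on (convex hull {a, b, c}). g x $ i) = (LINT x|lebesgue_on (convex hull {a, b, c}). h x $ i)"
proof -
  let ?I = "open_triangle a b c"
  let ?T = "convex hull {a, b, c}"
  have T: "?T \<in> sets lebesgue" using compact_triangle lmeasurable_compact by blast
  have \<Omega>': "\<Omega> \<in> sets lebesgue" using \<Omega> by blast
  let ?d = "\<lambda>x. g x $ i - h x $ i"
  have Lg: "(\<lambda>x. g x $ i) \<in> L2 \<Omega>" and Lh: "(\<lambda>x. h x $ i) \<in> L2 \<Omega>"
    using g h by (simp_all add: has_weak_grad_def)
  have d: "integrable (lebesgue_on \<Omega>) ?d"
    using L2_integrable[OF \<Omega> Lg] L2_integrable[OF \<Omega> Lh] by simp
  have zero: "(LINT x|lebesgue_on \<Omega>. ?d x * bump a b c n x) = 0" for n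
  proof -
    have t: "bump a b c n \<in> test_functions \<Omega>"
      by (rule bump_test_function[OF nz inner])
    note t2 = test_function_L2[OF t \<Omega>']
    show ?thesis
      using g h t L2_mult_integrable(1)[OF Lg t2] L2_mult_integrable(1)[OF Lh t2]
      unfolding has_weak_grad_def by (simp add: left_diff_distrib)
  qed
  have I: "?I \<in> sets lebesgue"
    by (rule sets_completionI_sets, rule lborelD, rule borel_open,
        intro open_Collect_conj open_Collect_less continuous_on_const continuous_on_bary)
  have IT: "?I \<subseteq> ?T"
    unfolding triangle_eq_bary[OF nz] by auto
  have "(\<lambda>n. LINT x|lebesgue_on \<Omega>. ?d x * bump a b c n x) \<longlonglongrightarrow> (LINT x|lebesgue_on \<Omega>. ?d x * indicator ?I x)"
  proof (rule integral_dominated_convergence[where w = "\<lambda>x. \<bar>?d x\<bar>"])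
    show "(\<lambda>x. ?d x * indicator ?I x) \<in> borel_measurable (lebesgue_on \<Omega>)"
      using d I by (intro borel_measurable_times borel_measurable_integrable borel_measurable_indicator)
        (auto simp: sets_restrict_space_iff \<Omega>' inner Int_absorb2)
    show "(\<lambda>x. ?d x * bump a b c n x) \<in> borel_measurable (lebesgue_on \<Omega>)" for n
      using d test_function_L2[OF bump_test_function[OF nz inner] \<Omega>', of n]
      by (auto simp: L2_def)
    show "integrable (lebesgue_on \<Omega>) (\<lambda>x. \<bar>?d x\<bar>)" using d by simp
    show "AE x in lebesgue_on \<Omega>. (\<lambda>n. ?d x * bump a b c n x) \<longlonglongrightarrow> ?d x * indicator ?I x"
    proof (rule AE_I2)
      fix x
      show "(\<lambda>n. ?d x * bump a b c n x) \<longlonglongrightarrow> ?d x * indicator ?I x"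
      proof (cases "x \<in> ?I")
        case True
        then show ?thesis
          using tendsto_mult[OF tendsto_const bump_tendsto_1[of a b c x]] by simp
      next
        case False
        have z: "flat_exp 1 (real n * r - 1) = 0" if "r \<le> 0" for r n
          using that mult_nonneg_nonpos[of "real n" r] by (simp add: flat_exp_def)
        have "bary a b c x \<le> 0 \<or> bary b c a x \<le> 0 \<or> bary c a b x \<le> 0"
          using False by auto
        then have "bump a b c n x = 0" for n
          unfolding bump_def by (elim disjE) (simp_all only: z mult_zero_left mult_zero_right)
        with False show ?thesis by simp
      qed
    qed
    show "AE x in lebesgue_on \<Omega>. norm (?d x * bump a b c n x) \<le> \<bar>?d x\<bar>" for n
    proof (rule AE_I2)
      show "norm (?d x * bump a b c n x) \<le> \<bar>?d x\<bar>" for x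
        using bump_bounds[of a b c n x] mult_left_mono[of "\<bar>bump a b c n x\<bar>" 1 "\<bar>?d x\<bar>"]
        by (simp add: abs_mult)
    qed
  qed
  then have "(\<lambda>n. 0) \<longlonglongrightarrow> (LINT x|lebesgue_on \<Omega>. ?d x * indicator ?I x)"
    unfolding zero .
  from LIMSEQ_unique[OF this tendsto_const]
  have "(LINT x|lebesgue_on \<Omega>. indicator ?I x * ?d x) = 0"
    by (simp only: mult.commute)
  moreover have "negligible (?I - \<Omega>)" using inner by (simp add: Diff_eq_empty_iff[THEN iffD2])
  ultimately have I0: "(LINT x|lebesgue_on ?I. ?d x) = 0" and Iint: "integrable (lebesgue_on ?I) ?d"
    using LINT_on_almost_subset[OF \<Omega>' I _ d] by auto
  have Tint: "integrable (lebesgue_on ?T) ?d"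
    by (rule LINT_on_almost_subset(1)[OF \<Omega>' T bd d])
  have "(LINT x|lebesgue_on ?T. ?d x) = integral ?T ?d"
    by (rule lebesgue_integral_eq_integral[OF Tint T])
  also have "\<dots> = integral ?I ?d"
    using IT by (intro integral_spike_set) (auto intro: negligible_subset[OF bd'])
  also have "\<dots> = 0"
    using lebesgue_integral_eq_integral[OF Iint I] I0 by simp
  finally have "(LINT x|lebesgue_on ?T. g x $ i - h x $ i) = 0" .
  moreover have "integrable (lebesgue_on ?T) (\<lambda>x. g x $ i)" "integrable (lebesgue_on ?T) (\<lambda>x. h x $ i)"
    using LINT_on_almost_subset(1)[OF \<Omega>' T bd] L2_integrable[OF \<Omega>] Lg Lh by blast+
  ultimately show ?thesis by simp
qed

lemma L2_inner:
  fixes g h :: "plane \<Rightarrow> plane"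
  assumes "\<And>i. (\<lambda>x. g x $ i) \<in> L2 \<Omega>" "\<And>i. (\<lambda>x. h x $ i) \<in> L2 \<Omega>"
  shows "integrable (lebesgue_on \<Omega>) (\<lambda>x. g x \<bullet> h x)"
    and "(LINT x|lebesgue_on \<Omega>. g x \<bullet> h x) = (\<Sum>i\<in>UNIV. LINT x|lebesgue_on \<Omega>. g x $ i * h x $ i)"
    and "g \<in> borel_measurable (lebesgue_on \<Omega>)"
proof -
  have "\<And>i. integrable (lebesgue_on \<Omega>) (\<lambda>x. g x $ i * h x $ i)"
    using assms L2_mult_integrable(1) by blast
  then show "integrable (lebesgue_on \<Omega>) (\<lambda>x. g x \<bullet> h x)"
    and "(LINT x|lebesgue_on \<Omega>. g x \<bullet> h x) = (\<Sum>i\<in>UNIV. LINT x|lebesgue_on \<Omega>. g x $ i * h x $ i)"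
    by (simp_all add: inner_vec_def)
  show "g \<in> borel_measurable (lebesgue_on \<Omega>)"
    using assms(1) by (subst borel_measurable_euclidean_space) (auto simp: L2_def Basis_plane inner_axis)
qed

text \<open>
  The partial derivatives of a test function are test functions, so they can be used in the
  definition of the weak gradient. By the Cauchy--Schwarz inequality the classical gradient has
  the least norm among the weak gradients of \<open>\<phi>\<close>.
\<close>

lemma energy_eq_weak_grad_pairing:
  assumes \<phi>: "\<phi> \<in> test_functions \<Omega>" and \<Omega>: "\<Omega> \<in> sets lebesgue" and g: "has_weak_grad \<Omega> \<phi> g"
  shows "energy \<phi> \<Omega> = (LINT x|lebesgue_on \<Omega>. g x \<bullet> classical_grad \<phi> x)"
proof -
  note c = test_function_weak_grad[OF \<phi> \<Omega>]
  have Lc: "\<And>i. (\<lambda>x. classical_grad \<phi> x $ i) \<in> L2 \<Omega>" and Lg: "\<And>i. (\<lambda>x. g x $ i) \<in> L2 \<Omega>"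
    using c g by (simp_all add: has_weak_grad_def)
  have "(LINT x|lebesgue_on \<Omega>. classical_grad \<phi> x $ i * classical_grad \<phi> x $ i) =
      (LINT x|lebesgue_on \<Omega>. g x $ i * classical_grad \<phi> x $ i)" for i
  proof -
    have t: "partial_deriv i \<phi> \<in> test_functions \<Omega>"
      using partial_deriv_test_function[OF \<phi>] .
    have eq: "- (LINT x|lebesgue_on \<Omega>. h x $ i * partial_deriv i \<phi> x) =
        (LINT x|lebesgue_on \<Omega>. \<phi> x * partial_deriv i (partial_deriv i \<phi>) x)" if "has_weak_grad \<Omega> \<phi> h" for h
      using that t by (simp add: has_weak_grad_def)
    from eq[OF c] eq[OF g] show ?thesis
      by (simp add: classical_grad_def)
  qed
  then show ?thesis
    unfolding energy_def L2_inner(2)[OF Lc Lc] L2_inner(2)[OF Lg Lc] by simp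
qed

section \<open>Reduction to test functions\<close>

lemma grad_spec: "v \<in> H1 \<Omega> \<Longrightarrow> has_weak_grad \<Omega> v (grad \<Omega> v)"
  unfolding H1_def grad_def using someI_ex[of "has_weak_grad \<Omega> v"] by simp

lemma LINT_mono_subset:
  fixes h :: "plane \<Rightarrow> real"
  assumes "\<Omega> \<in> sets lebesgue" "S \<in> sets lebesgue" "negligible (S - \<Omega>)" "integrable (lebesgue_on \<Omega>) h" "\<And>x. 0 \<le> h x"
  shows "(LINT x|lebesgue_on S. h x) \<le> (LINT x|lebesgue_on \<Omega>. h x)"
proof -
  have ind: "integrable (lebesgue_on \<Omega>) (\<lambda>x. indicator S x * h x)"
  proof (rule Bochner_Integration.integrable_bound[OF assms(4)])
    have "S \<inter> \<Omega> \<in> sets (lebesgue_on \<Omega>)"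
      using assms(1,2) by (simp add: sets_restrict_space_iff)
    then have "(\<lambda>x. indicator (S \<inter> \<Omega>) x * h x) \<in> borel_measurable (lebesgue_on \<Omega>)"
      using assms(4) by (intro borel_measurable_times borel_measurable_indicator borel_measurable_integrable)
    then show "(\<lambda>x. indicator S x * h x) \<in> borel_measurable (lebesgue_on \<Omega>)"
      by (rule subst[OF measurable_cong, rotated]) (auto simp: indicator_def)
  qed (use assms(5) in \<open>auto simp: indicator_def\<close>)
  show ?thesis
    unfolding LINT_on_almost_subset(2)[OF assms(1-4)]
    by (rule Bochner_Integration.integral_mono[OF ind assms(4)]) (use assms(5) in \<open>auto simp: indicator_def\<close>)
qed

text \<open>
  Here \<open>c\<close> stands for the discrete multiplier and \<open>p\<close> for the discrete weak gradient, both
  constant on each triangle, and \<open>g\<close> for a gradient of \<open>v\<close>. Only the integrals of \<open>g\<close> over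
  triangles enter, which makes the value independent of the representative.
\<close>

abbreviation residual :: "mesh \<Rightarrow> (plane \<Rightarrow> real) \<Rightarrow> (plane set \<Rightarrow> real) \<Rightarrow> (plane set \<Rightarrow> plane)
    \<Rightarrow> (plane \<Rightarrow> real) \<Rightarrow> (plane \<Rightarrow> plane) \<Rightarrow> real" where
  "residual M f c p v g \<equiv> \<Sum>T\<in>M. (LINT x|lebesgue_on T. (f x - c T) * v x) -
     (\<Sum>i\<in>UNIV. p T $ i * (LINT x|lebesgue_on T. g x $ i))"

text \<open>
  Continuity with a constant that may depend on the mesh; it is used only to pass to the limit.
\<close>

lemma residual_bounded:
  assumes \<Omega>: "\<Omega> \<in> lmeasurable" and "finite M"
    and M: "\<And>T. T \<in> M \<Longrightarrow> T \<in> lmeasurable" "\<And>T. T \<in> M \<Longrightarrow> negligible (T - \<Omega>)"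
    and f: "f \<in> L2 \<Omega>"
  obtains K where "K \<ge> 0" and "\<And>w g. w \<in> L2 \<Omega> \<Longrightarrow> (\<And>i. (\<lambda>x. g x $ i) \<in> L2 \<Omega>) \<Longrightarrow>
     \<bar>residual M f c p w g\<bar>
       \<le> K * sqrt ((LINT x|lebesgue_on \<Omega>. (w x)\<^sup>2) + (LINT x|lebesgue_on \<Omega>. g x \<bullet> g x))"
proof -
  have \<Omega>': "\<Omega> \<in> sets lebesgue" using \<Omega> by blast
  let ?a = "\<lambda>T. sqrt (LINT x|lebesgue_on T. (f x - c T)\<^sup>2)"
  let ?b = "\<lambda>T. sqrt (LINT x|lebesgue_on T. 1\<^sup>2)"
  define K where "K = (\<Sum>T\<in>M. ?a T + (\<Sum>i\<in>UNIV. \<bar>p T $ i\<bar> * ?b T))"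
  have "K \<ge> 0"
    unfolding K_def by (intro sum_nonneg add_nonneg_nonneg mult_nonneg_nonneg real_sqrt_ge_zero
        Bochner_Integration.integral_nonneg) auto
  moreover have "\<bar>residual M f c p w g\<bar>
       \<le> K * sqrt ((LINT x|lebesgue_on \<Omega>. (w x)\<^sup>2) + (LINT x|lebesgue_on \<Omega>. g x \<bullet> g x))"
    if w: "w \<in> L2 \<Omega>" and g: "\<And>i. (\<lambda>x. g x $ i) \<in> L2 \<Omega>" for w g
  proof -
    let ?N = "sqrt ((LINT x|lebesgue_on \<Omega>. (w x)\<^sup>2) + (LINT x|lebesgue_on \<Omega>. g x \<bullet> g x))"
    have w0: "0 \<le> (LINT x|lebesgue_on \<Omega>. (w x)\<^sup>2)" and g0: "0 \<le> (LINT x|lebesgue_on \<Omega>. g x \<bullet> g x)"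
      by (rule Bochner_Integration.integral_nonneg; simp)+
    have T: "\<bar>LINT x|lebesgue_on T. h x * k x\<bar> \<le> sqrt (LINT x|lebesgue_on T. (h x)\<^sup>2) * ?N"
      if T: "T \<in> M" and h: "h \<in> L2 T" and k: "k \<in> L2 \<Omega>"
        and kN: "(LINT x|lebesgue_on \<Omega>. (k x)\<^sup>2) \<le> (LINT x|lebesgue_on \<Omega>. (w x)\<^sup>2) + (LINT x|lebesgue_on \<Omega>. g x \<bullet> g x)"
      for T and h k :: "plane \<Rightarrow> real"
    proof -
      have TT: "T \<in> sets lebesgue" using M(1)[OF T] by blast
      have kT: "k \<in> L2 T" by (rule L2_almost_subset[OF \<Omega> TT M(2)[OF T] k])
      have "(LINT x|lebesgue_on T. (k x)\<^sup>2) \<le> (LINT x|lebesgue_on \<Omega>. (k x)\<^sup>2)"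
        by (rule LINT_mono_subset[OF \<Omega>' TT M(2)[OF T]]) (use k in \<open>auto simp: L2_def\<close>)
      then have le: "sqrt (LINT x|lebesgue_on T. (k x)\<^sup>2) \<le> ?N"
        using kN by (intro real_sqrt_le_mono) linarith
      have "\<bar>LINT x|lebesgue_on T. h x * k x\<bar> \<le> sqrt ((LINT x|lebesgue_on T. (h x)\<^sup>2) * (LINT x|lebesgue_on T. (k x)\<^sup>2))"
        using real_sqrt_le_mono[OF L2_mult_integrable(2)[OF h kT]] by (simp only: real_sqrt_abs)
      also have "\<dots> \<le> sqrt (LINT x|lebesgue_on T. (h x)\<^sup>2) * ?N"
        unfolding real_sqrt_mult by (intro mult_left_mono le real_sqrt_ge_zero Bochner_Integration.integral_nonneg) simp
      finally show ?thesis .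
    qed
    have comp: "(LINT x|lebesgue_on \<Omega>. (g x $ i)\<^sup>2) \<le> (LINT x|lebesgue_on \<Omega>. g x \<bullet> g x)" for i
    proof (rule Bochner_Integration.integral_mono)
      show "integrable (lebesgue_on \<Omega>) (\<lambda>x. (g x $ i)\<^sup>2)" using g by (simp add: L2_def)
      show "integrable (lebesgue_on \<Omega>) (\<lambda>x. g x \<bullet> g x)" using L2_inner(1)[OF g g] .
      show "(g x $ i)\<^sup>2 \<le> g x \<bullet> g x" for x
        using exhaust_2[of i] by (auto simp: inner_plane power2_eq_square)
    qed
    have "\<bar>(LINT x|lebesgue_on T. (f x - c T) * w x) - (\<Sum>i\<in>UNIV. p T $ i * (LINT x|lebesgue_on T. g x $ i))\<bar>
       \<le> (?a T + (\<Sum>i\<in>UNIV. \<bar>p T $ i\<bar> * ?b T)) * ?N" if TM: "T \<in> M" for T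
    proof -
      have TT: "T \<in> sets lebesgue" using M(1)[OF TM] by blast
      have fc: "(\<lambda>x. f x - c T) \<in> L2 T"
        by (intro L2_diff L2_const M(1) TM L2_almost_subset[OF \<Omega> TT M(2)[OF TM] f])
      have 1: "\<bar>LINT x|lebesgue_on T. (f x - c T) * w x\<bar> \<le> ?a T * ?N"
        by (rule T[OF TM fc w]) (use g0 in simp)
      have 2: "\<bar>LINT x|lebesgue_on T. 1 * g x $ i\<bar> \<le> ?b T * ?N" for i
        by (rule T[OF TM L2_const[OF M(1)[OF TM]] g]) (use comp[of i] w0 in linarith)
      have "\<bar>\<Sum>i\<in>UNIV. p T $ i * (LINT x|lebesgue_on T. g x $ i)\<bar> \<le> (\<Sum>i\<in>UNIV. \<bar>p T $ i\<bar> * (?b T * ?N))"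
        by (rule order_trans[OF sum_abs], rule sum_mono) (use 2 in \<open>simp add: abs_mult mult_left_mono\<close>)
      then show ?thesis
        using 1 by (simp add: distrib_right sum_distrib_right mult.assoc)
    qed
    then show ?thesis
      unfolding K_def sum_distrib_right
      by (rule order_trans[OF sum_abs sum_mono])
  qed
  ultimately show ?thesis using that by blast
qed

text \<open>
  For \<open>\<phi>\<close> close to \<open>v\<close> in the norm of \<open>H1\<close>, the residual at \<open>v - \<phi>\<close> is small by continuity. The
  bound at \<open>\<phi>\<close> is in terms of the classical gradient of \<open>\<phi>\<close>, whereas the norm of \<open>v - \<phi>\<close>
  involves a chosen weak gradient; since the classical gradient is the smallest one, its norm is
  at most that of \<open>v\<close> plus that of \<open>v - \<phi>\<close>.
\<close>

lemma H10_bound_from_test_functions: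
  assumes \<Omega>: "\<Omega> \<in> lmeasurable" and fin: "finite M"
    and M: "\<And>T. T \<in> M \<Longrightarrow> T \<in> lmeasurable" "\<And>T. T \<in> M \<Longrightarrow> negligible (T - \<Omega>)"
    and uniq: "\<And>T v g h i. T \<in> M \<Longrightarrow> has_weak_grad \<Omega> v g \<Longrightarrow> has_weak_grad \<Omega> v h \<Longrightarrow>
        (LINT x|lebesgue_on T. g x $ i) = (LINT x|lebesgue_on T. h x $ i)"
    and f: "f \<in> L2 \<Omega>" and B: "B \<ge> 0"
    and bound: "\<And>\<phi>. \<phi> \<in> test_functions \<Omega> \<Longrightarrow>
      \<bar>residual M f c p \<phi> (classical_grad \<phi>)\<bar>
       \<le> B * sqrt (energy \<phi> \<Omega>)"
    and v: "v \<in> H10 \<Omega>"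
  shows "\<bar>residual M f c p v (grad \<Omega> v)\<bar> \<le> B * H1_norm \<Omega> v"
proof -
  have \<Omega>': "\<Omega> \<in> sets lebesgue" using \<Omega> by blast
  define R where "R w g = residual M f c p w g" for w and g :: "plane \<Rightarrow> plane"
  obtain K where K: "K \<ge> 0" "\<And>w g. w \<in> L2 \<Omega> \<Longrightarrow> (\<And>i. (\<lambda>x. g x $ i) \<in> L2 \<Omega>) \<Longrightarrow>
     \<bar>R w g\<bar> \<le> K * sqrt ((LINT x|lebesgue_on \<Omega>. (w x)\<^sup>2) + (LINT x|lebesgue_on \<Omega>. g x \<bullet> g x))"
    using residual_bounded[OF \<Omega> fin M f, of c p] unfolding R_def by blast
  have vH: "v \<in> H1 \<Omega>" using v by (simp add: H10_def)
  note gv = grad_spec[OF vH]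
  have main: "\<bar>R v (grad \<Omega> v)\<bar> \<le> B * H1_norm \<Omega> v + (B + K) * \<epsilon>" if eps: "\<epsilon> > 0" for \<epsilon>
  proof -
    obtain \<phi> where \<phi>: "\<phi> \<in> test_functions \<Omega>" "H1_norm \<Omega> (v - \<phi>) < \<epsilon>"
      using v eps by (auto simp: H10_def)
    note c\<phi> = test_function_weak_grad[OF \<phi>(1) \<Omega>']
    let ?c = "classical_grad \<phi>" and ?w = "v - \<phi>"
    note d = has_weak_grad_diff[OF gv c\<phi> \<Omega>']
    have wH: "?w \<in> H1 \<Omega>" using d unfolding H1_def by blast
    note gw = grad_spec[OF wH]
    let ?g = "grad \<Omega> ?w"
    have L: "v \<in> L2 \<Omega>" "\<phi> \<in> L2 \<Omega>" "?w \<in> L2 \<Omega>" "\<And>i. (\<lambda>x. grad \<Omega> v x $ i) \<in> L2 \<Omega>"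
      "\<And>i. (\<lambda>x. ?c x $ i) \<in> L2 \<Omega>" "\<And>i. (\<lambda>x. ?g x $ i) \<in> L2 \<Omega>"
      using gv c\<phi> gw by (simp_all add: has_weak_grad_def)
    have split: "R v (grad \<Omega> v) = R \<phi> ?c + R ?w ?g"
    proof -
      have "(LINT x|lebesgue_on T. (f x - c T) * v x) - (\<Sum>i\<in>UNIV. p T $ i * (LINT x|lebesgue_on T. grad \<Omega> v x $ i))
        = ((LINT x|lebesgue_on T. (f x - c T) * \<phi> x) - (\<Sum>i\<in>UNIV. p T $ i * (LINT x|lebesgue_on T. ?c x $ i)))
        + ((LINT x|lebesgue_on T. (f x - c T) * ?w x) - (\<Sum>i\<in>UNIV. p T $ i * (LINT x|lebesgue_on T. ?g x $ i)))"
        if T: "T \<in> M" for T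
      proof -
        have TT: "T \<in> sets lebesgue" using M(1)[OF T] by blast
        note sub = L2_almost_subset[OF \<Omega> TT M(2)[OF T]]
        have fc: "(\<lambda>x. f x - c T) \<in> L2 T"
          by (intro L2_diff L2_const M(1) T sub f)
        have "(LINT x|lebesgue_on T. (f x - c T) * ?w x) = (LINT x|lebesgue_on T. (f x - c T) * v x - (f x - c T) * \<phi> x)"
          by (simp add: right_diff_distrib)
        also have "\<dots> = (LINT x|lebesgue_on T. (f x - c T) * v x) - (LINT x|lebesgue_on T. (f x - c T) * \<phi> x)"
          by (rule Bochner_Integration.integral_diff) (rule L2_mult_integrable(1)[OF fc sub[OF L(1)]] L2_mult_integrable(1)[OF fc sub[OF L(2)]])+
        finally have 1: "(LINT x|lebesgue_on T. (f x - c T) * v x) =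
            (LINT x|lebesgue_on T. (f x - c T) * \<phi> x) + (LINT x|lebesgue_on T. (f x - c T) * ?w x)" by simp
        have 2: "(LINT x|lebesgue_on T. grad \<Omega> v x $ i) = (LINT x|lebesgue_on T. ?c x $ i) + (LINT x|lebesgue_on T. ?g x $ i)" for i
        proof -
          have "(LINT x|lebesgue_on T. ?g x $ i) = (LINT x|lebesgue_on T. (grad \<Omega> v x - ?c x) $ i)"
            by (rule uniq[OF T gw d])
          also have "\<dots> = (LINT x|lebesgue_on T. grad \<Omega> v x $ i) - (LINT x|lebesgue_on T. ?c x $ i)"
            using L2_integrable[OF M(1)[OF T] sub[OF L(4)]] L2_integrable[OF M(1)[OF T] sub[OF L(5)]]
            by simp
          finally show ?thesis by simp
        qed
        show ?thesis unfolding 1 2 by (simp add: distrib_left sum.distrib)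
      qed
      then show ?thesis unfolding R_def by (simp add: sum.distrib[symmetric])
    qed
    have Rw: "\<bar>R ?w ?g\<bar> \<le> K * \<epsilon>"
    proof -
      have "\<bar>R ?w ?g\<bar> \<le> K * H1_norm \<Omega> ?w"
        unfolding H1_norm_def by (rule K(2)[OF L(3,6)])
      also have "\<dots> \<le> K * \<epsilon>" using \<phi>(2) K(1) by (intro mult_left_mono) auto
      finally show ?thesis .
    qed
    let ?S = "LINT x|lebesgue_on \<Omega>. ?c x \<bullet> ?c x"
    have S0: "?S \<ge> 0" by (rule Bochner_Integration.integral_nonneg) simp
    have gn: "sqrt (LINT x|lebesgue_on \<Omega>. grad \<Omega> z x \<bullet> grad \<Omega> z x) \<le> H1_norm \<Omega> z" for z
      unfolding H1_norm_def by (intro real_sqrt_le_mono) (simp add: Bochner_Integration.integral_nonneg)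
    have CS: "\<bar>LINT x|lebesgue_on \<Omega>. grad \<Omega> z x \<bullet> ?c x\<bar> \<le> H1_norm \<Omega> z * sqrt ?S"
      if "\<And>i. (\<lambda>x. grad \<Omega> z x $ i) \<in> L2 \<Omega>" for z
    proof -
      have "(LINT x|lebesgue_on \<Omega>. grad \<Omega> z x \<bullet> ?c x)\<^sup>2 \<le> (LINT x|lebesgue_on \<Omega>. grad \<Omega> z x \<bullet> grad \<Omega> z x) * ?S"
        by (rule integral_Cauchy_Schwarz(2)) (rule L2_inner[OF that that] L2_inner[OF L(5) L(5)])+
      then have "\<bar>LINT x|lebesgue_on \<Omega>. grad \<Omega> z x \<bullet> ?c x\<bar> \<le> sqrt (LINT x|lebesgue_on \<Omega>. grad \<Omega> z x \<bullet> grad \<Omega> z x) * sqrt ?S"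
        unfolding real_sqrt_mult[symmetric] by (drule_tac real_sqrt_le_mono) (simp only: real_sqrt_abs)
      also have "\<dots> \<le> H1_norm \<Omega> z * sqrt ?S"
        using gn S0 by (intro mult_right_mono) auto
      finally show ?thesis .
    qed
    \<comment> \<open>The difference of the chosen gradients of \<open>v\<close> and \<open>v - \<phi>\<close> is one of the weak gradients
        of \<open>\<phi>\<close>.\<close>
    have "?S \<le> (H1_norm \<Omega> v + \<epsilon>) * sqrt ?S"
    proof -
      have "v - ?w = \<phi>" by (simp add: fun_eq_iff)
      with has_weak_grad_diff[OF gv gw \<Omega>'] have "has_weak_grad \<Omega> \<phi> (\<lambda>x. grad \<Omega> v x - ?g x)"
        by (simp only:)
      then have "?S = (LINT x|lebesgue_on \<Omega>. (grad \<Omega> v x - ?g x) \<bullet> ?c x)"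
        by (rule energy_eq_weak_grad_pairing[OF \<phi>(1) \<Omega>', unfolded energy_def])
      also have "\<dots> = (LINT x|lebesgue_on \<Omega>. grad \<Omega> v x \<bullet> ?c x) - (LINT x|lebesgue_on \<Omega>. ?g x \<bullet> ?c x)"
        using L2_inner(1)[OF L(4,5)] L2_inner(1)[OF L(6,5)] by (simp add: inner_diff_left)
      also have "\<dots> \<le> H1_norm \<Omega> v * sqrt ?S + H1_norm \<Omega> ?w * sqrt ?S"
        using CS[OF L(4)] CS[OF L(6)] by linarith
      also have "\<dots> \<le> (H1_norm \<Omega> v + \<epsilon>) * sqrt ?S"
        using \<phi>(2) S0 by (simp add: distrib_right mult_right_mono)
      finally show ?thesis .
    qed
    then have S: "sqrt ?S \<le> H1_norm \<Omega> v + \<epsilon>"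
    proof (cases "sqrt ?S = 0")
      case True
      have "0 \<le> H1_norm \<Omega> v"
        unfolding H1_norm_def by (intro real_sqrt_ge_zero add_nonneg_nonneg Bochner_Integration.integral_nonneg) auto
      then show ?thesis using True eps by simp
    next
      case False
      with real_sqrt_ge_zero[OF S0] have "sqrt ?S > 0" by (metis order_le_less)
      moreover have "sqrt ?S * sqrt ?S \<le> (H1_norm \<Omega> v + \<epsilon>) * sqrt ?S"
        using \<open>?S \<le> _\<close> S0 by simp
      ultimately show ?thesis using mult_right_le_imp_le by blast
    qed
    have "\<bar>R \<phi> ?c\<bar> \<le> B * sqrt ?S"
      unfolding R_def by (rule bound[OF \<phi>(1), unfolded energy_def])
    also have "\<dots> \<le> B * (H1_norm \<Omega> v + \<epsilon>)"
      by (rule mult_left_mono[OF S B])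
    finally show ?thesis
      using Rw split by (simp add: algebra_simps)
  qed
  have "\<bar>R v (grad \<Omega> v)\<bar> \<le> B * H1_norm \<Omega> v"
  proof (rule field_le_epsilon)
    fix e :: real assume e: "e > 0"
    let ?\<epsilon> = "e / (B + K + 1)"
    have pos: "B + K + 1 > 0" using B K(1) by simp
    then have "(B + K) * ?\<epsilon> \<le> e"
      using e B K(1) by (simp add: field_simps)
    moreover have "?\<epsilon> > 0" using e pos by simp
    ultimately show "\<bar>R v (grad \<Omega> v)\<bar> \<le> B * H1_norm \<Omega> v + e"
      using main[of ?\<epsilon>] by linarith
  qed
  then show ?thesis unfolding R_def .
qed

section \<open>Triangles, edges and normals\<close>

text \<open>
  Links the determinant, in which all computations are made, to affine independence, in which
  simplices are defined.
\<close>

lemma cross_nonzero_iff: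
  "cross (b - a) (c - a) \<noteq> 0 \<longleftrightarrow> a \<noteq> b \<and> b \<noteq> c \<and> a \<noteq> c \<and> \<not> affine_dependent {a, b, c}"
proof -
  let ?u = "b - a" and ?w = "c - a"
  have "cross ?u ?w = 0 \<longleftrightarrow> collinear {0, ?u, ?w}"
  proof
    assume 0: "cross ?u ?w = 0"
    have "(?u \<bullet> ?u) *\<^sub>R ?w = (?w \<bullet> ?u) *\<^sub>R ?u + cross ?u ?w *\<^sub>R vector [- ?u $ 2, ?u $ 1]"
      by (simp add: vec_eq_iff forall_2 inner_plane cross_def algebra_simps)
    with 0 have "(?u \<bullet> ?u) *\<^sub>R ?w = (?w \<bullet> ?u) *\<^sub>R ?u" by simp
    then have "(1 / (?u \<bullet> ?u)) *\<^sub>R (?u \<bullet> ?u) *\<^sub>R ?w = (1 / (?u \<bullet> ?u)) *\<^sub>R (?w \<bullet> ?u) *\<^sub>R ?u" by simp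
    then have "?u \<noteq> 0 \<Longrightarrow> ?w = (?w \<bullet> ?u / (?u \<bullet> ?u)) *\<^sub>R ?u" by simp
    then show "collinear {0, ?u, ?w}"
      unfolding collinear_lemma by blast
  next
    assume "collinear {0, ?u, ?w}"
    then consider "?u = 0" | "?w = 0" | k where "?w = k *\<^sub>R ?u"
      unfolding collinear_lemma by blast
    then show "cross ?u ?w = 0"
      by cases (simp_all add: cross_def)
  qed
  also have "\<dots> \<longleftrightarrow> collinear {b, a, c}"
    by (simp add: collinear_3)
  also have "\<dots> \<longleftrightarrow> a = b \<or> b = c \<or> a = c \<or> affine_dependent {a, b, c}"
    unfolding collinear_3_eq_affine_dependent by (auto simp: insert_commute)
  finally show ?thesis by blast
qed

lemma simplex_2_iff: "2 simplex T \<longleftrightarrow> (\<exists>a b c. T = convex hull {a, b, c :: plane} \<and> cross (b - a) (c - a) \<noteq> 0)"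
proof
  assume "2 simplex T"
  then obtain C where C: "\<not> affine_dependent C" "int (card C) = 2 + 1" "T = convex hull C"
    unfolding simplex_def by blast
  then have "card C = 3" by simp
  then obtain a b c where "C = {a, b, c}" "a \<noteq> b" "b \<noteq> c" "a \<noteq> c"
    unfolding card_3_iff by metis
  then show "\<exists>a b c. T = convex hull {a, b, c} \<and> cross (b - a) (c - a) \<noteq> 0"
    using C unfolding cross_nonzero_iff by blast
next
  assume "\<exists>a b c. T = convex hull {a, b, c} \<and> cross (b - a) (c - a) \<noteq> 0"
  then obtain a b c where *: "T = convex hull {a, b, c}" "a \<noteq> b" "b \<noteq> c" "a \<noteq> c" "\<not> affine_dependent {a, b, c}"
    unfolding cross_nonzero_iff by blast
  then have "int (card {a, b, c}) = 2 + 1" by simp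
  then show "2 simplex T"
    unfolding simplex_def using * by blast
qed

lemma cross_cyclic:
  assumes "cross (b - a) (c - a) \<noteq> 0"
  shows "cross (c - b) (a - b) \<noteq> 0" "cross (a - c) (b - c) \<noteq> 0" "cross (c - a) (b - a) \<noteq> 0"
  using assms by (simp_all add: cross_def algebra_simps)

lemma edge_of_triangle:
  assumes "cross (b - a) (c - a) \<noteq> 0"
  shows "e edge_of convex hull {a, b, c} \<longleftrightarrow> e = closed_segment a b \<or> e = closed_segment b c \<or> e = closed_segment c a"
proof -
  have d: "a \<noteq> b" "b \<noteq> c" "a \<noteq> c" and ind: "\<not> affine_dependent {a, b, c}"
    using assms unfolding cross_nonzero_iff by auto
  have dim2: "aff_dim (convex hull {a, b, c}) = 2"
    using aff_dim_affine_independent[OF ind] d by (simp add: aff_dim_convex_hull)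
  have dims: "aff_dim (convex hull {p, q}) = (if p = q then 0 else 1)" for p q :: plane
    by (simp add: aff_dim_convex_hull aff_dim_2)
  show ?thesis
  proof
    assume "e edge_of convex hull {a, b, c}"
    then obtain C where C: "C \<subseteq> {a, b, c}" "e = convex hull C" and 1: "aff_dim e = 1"
      unfolding edge_of_def face_of_convex_hull_affine_independent[OF ind] by blast
    have "C \<in> Pow {a, b, c}" using C(1) by simp
    then consider "C = {}" | p where "C = {p, p}" | "C = {a, b}" | "C = {b, c}" | "C = {c, a}" | "C = {a, b, c}"
      unfolding Pow_insert by auto
    then show "e = closed_segment a b \<or> e = closed_segment b c \<or> e = closed_segment c a"
    proof cases
      case 1 then show ?thesis using C(2) \<open>aff_dim e = 1\<close> by simp
    next
      case (2 p) then show ?thesis using C(2) \<open>aff_dim e = 1\<close> dims[of p p] by simp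
    next
      case 6 then show ?thesis using C(2) \<open>aff_dim e = 1\<close> dim2 by simp
    qed (use C(2) in \<open>simp_all add: segment_convex_hull\<close>)
  next
    assume e: "e = closed_segment a b \<or> e = closed_segment b c \<or> e = closed_segment c a"
    have f: "convex hull C edge_of convex hull {a, b, c}" if "C \<subseteq> {a, b, c}" "aff_dim (convex hull C) = 1" for C
      using that unfolding edge_of_def face_of_convex_hull_affine_independent[OF ind] by blast
    show "e edge_of convex hull {a, b, c}"
      using e d unfolding segment_convex_hull by (elim disjE) (simp_all add: f dims)
  qed
qed

lemma extreme_point_of_triangle:
  assumes "cross (b - a) (c - a) \<noteq> 0"
  shows "z extreme_point_of convex hull {a, b, c} \<longleftrightarrow> z = a \<or> z = b \<or> z = c"
  using extreme_point_of_convex_hull_affine_independent[of "{a, b, c}" z] assms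
  unfolding cross_nonzero_iff by auto

lemma triangle_rotate: "convex hull {b, c, a} = convex hull {a, b, c}" "convex hull {c, a, b} = convex hull {a, b, c}"
  "convex hull {a, c, b} = convex hull {a, b, c}" "convex hull {b, a, c} = convex hull {a, b, c}"
  by (simp_all add: insert_commute)

lemma triangle_at_edge:
  assumes "2 simplex T" "closed_segment a b edge_of T"
  obtains c where "T = convex hull {a, b, c}" "cross (b - a) (c - a) \<noteq> 0"
proof -
  obtain p q r where T: "T = convex hull {p, q, r}" and nz: "cross (q - p) (r - p) \<noteq> 0"
    using assms(1) unfolding simplex_2_iff by blast
  have "\<exists>c. {a, b, c} = {p, q, r}"
    using assms(2) unfolding T edge_of_triangle[OF nz] closed_segment_eq
    by (auto simp: doubleton_eq_iff)
  then obtain c where c: "{a, b, c} = {p, q, r}" by blast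
  have "T = convex hull {a, b, c}" unfolding T c ..
  moreover have "cross (b - a) (c - a) \<noteq> 0"
  proof -
    have "card {p, q, r} = 3" using nz unfolding cross_nonzero_iff by auto
    then have "card {a, b, c} = 3" unfolding c .
    then have "a \<noteq> b" "b \<noteq> c" "a \<noteq> c" by (auto simp: card_insert_if split: if_splits)
    moreover have "\<not> affine_dependent {a, b, c}"
      using nz unfolding cross_nonzero_iff c by blast
    ultimately show ?thesis unfolding cross_nonzero_iff by blast
  qed
  ultimately show thesis using that by blast
qed

lemma edge_obtains_segment:
  assumes "2 simplex T" "(e :: plane set) edge_of T"
  obtains a b where "e = closed_segment a b" "a \<noteq> b"
proof -
  obtain p q r where T: "T = convex hull {p, q, r}" and nz: "cross (q - p) (r - p) \<noteq> 0"
    using assms(1) unfolding simplex_2_iff by blast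
  then show thesis
    using assms(2) that unfolding T edge_of_triangle[OF nz] cross_nonzero_iff by metis
qed

lemma triangle_at_vertex:
  assumes "2 simplex T" "(z :: plane) extreme_point_of T"
  obtains b c where "T = convex hull {z, b, c}" "cross (b - z) (c - z) \<noteq> 0"
proof -
  obtain p q r where T: "T = convex hull {p, q, r}" and nz: "cross (q - p) (r - p) \<noteq> 0"
    using assms(1) unfolding simplex_2_iff by blast
  have "z = p \<or> z = q \<or> z = r"
    using assms(2) unfolding T extreme_point_of_triangle[OF nz] .
  then show thesis
    using that[of q r] that[of r p] that[of p q] nz cross_cyclic[OF nz] triangle_rotate[of p q r]
    unfolding T by metis
qed

lemma aff_dim_triangle: "2 simplex (T :: plane set) \<Longrightarrow> aff_dim T = 2"
  using aff_dim_simplex by blast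

lemma face_of_triangle_negligible:
  assumes "2 simplex T" "F face_of T" "F \<noteq> (T :: plane set)"
  shows "negligible F"
proof -
  have cT: "convex T" using assms(1) unfolding simplex_2_iff by auto
  have "aff_dim F < 2"
    using face_of_aff_dim_lt[OF cT assms(2,3)] aff_dim_triangle[OF assms(1)] by simp
  then have "interior F = {}"
    using aff_dim_nonempty_interior[of F] by force
  then show ?thesis
    using negligible_convex_interior face_of_imp_convex[OF assms(2)] by blast
qed

text \<open>
  A common face that is not the whole triangle has smaller affine dimension, and a triangle
  cannot be a proper face of another.
\<close>

lemma conforming_triangles_negligible:
  assumes "2 simplex T" "2 simplex T'" "T \<inter> T' face_of T" "T \<inter> T' face_of T'" "T \<noteq> (T' :: plane set)"
  shows "negligible (T \<inter> T')"
proof (cases "T \<inter> T' = T")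
  case True
  have "convex T'" using assms(2) unfolding simplex_2_iff by auto
  from face_of_aff_dim_lt[OF this assms(4)] have False
    using True assms aff_dim_triangle by auto
  then show ?thesis ..
next
  case False
  then show ?thesis by (rule face_of_triangle_negligible[OF assms(1,3)])
qed

lemma open_triangle_open:
  "open (open_triangle a b c)"
  by (intro open_Collect_conj open_Collect_less continuous_on_const continuous_on_bary)

lemma negligible_bary_zero:
  assumes "cross (b - a) (c - a) \<noteq> 0"
  shows "negligible {x. bary a b c x = 0}"
proof -
  obtain q d where q: "\<And>x. bary a b c x = q \<bullet> x + d" using bary_affine by blast
  have "q \<noteq> 0"
    using bary_at(1,2)[OF assms] q[of a] q[of b] by auto
  moreover have "{x. bary a b c x = 0} = {x. q \<bullet> x = - d}" using q by auto
  ultimately show ?thesis using negligible_hyperplane by auto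
qed

lemma triangle_boundary_negligible:
  assumes nz: "cross (b - a) (c - a) \<noteq> 0"
  shows "negligible (convex hull {a, b, c} - open_triangle a b c)"
proof (rule negligible_subset)
  show "negligible ({x. bary a b c x = 0} \<union> {x. bary b c a x = 0} \<union> {x. bary c a b x = 0})"
    using negligible_bary_zero[OF nz] negligible_bary_zero[OF cross_cyclic(1)[OF nz]]
      negligible_bary_zero[OF cross_cyclic(2)[OF nz]] by auto
qed (auto simp: triangle_eq_bary[OF nz])

lemma bary_open_segment:
  assumes nz: "cross (b - a) (c - a) \<noteq> 0" and x: "x \<in> open_segment a b"
  shows "bary a b c x > 0" "bary b c a x > 0"
proof -
  obtain t where t: "0 < t" "t < 1" "x = (1 - t) *\<^sub>R a + t *\<^sub>R b"
    using x unfolding in_segment by blast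
  show "bary a b c x > 0"
    using bary_combination[OF nz, of x "1 - t" t 0] t by simp
  show "bary b c a x > 0"
    using bary_combination[OF cross_cyclic(1)[OF nz], of x t 0 "1 - t"] t by (simp add: add.commute)
qed

text \<open>
  Near a relative interior point of the edge the coordinates of \<open>a\<close> and \<open>b\<close> are positive, and
  only the sign of the third one decides membership.
\<close>

lemma triangle_locally_half_plane:
  assumes nz: "cross (b - a) (c - a) \<noteq> 0" and x: "x \<in> open_segment a b"
  obtains \<epsilon> where "\<epsilon> > 0" "\<And>y. y \<in> ball x \<epsilon> \<Longrightarrow>
    y \<in> convex hull {a, b, c} \<longleftrightarrow> cross (b - a) (c - a) * cross (b - a) (y - a) \<ge> 0"
proof -
  have op: "open {x. bary a b c x > 0 \<and> bary b c a x > 0}"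
    by (intro open_Collect_conj open_Collect_less continuous_on_const continuous_on_bary)
  moreover have "x \<in> {x. bary a b c x > 0 \<and> bary b c a x > 0}"
    using bary_open_segment[OF nz x] by blast
  ultimately obtain \<epsilon> where \<epsilon>: "\<epsilon> > 0" "ball x \<epsilon> \<subseteq> {x. bary a b c x > 0 \<and> bary b c a x > 0}"
    unfolding open_contains_ball by blast
  show thesis
  proof (rule that[OF \<epsilon>(1)])
    fix y assume "y \<in> ball x \<epsilon>"
    then have "bary a b c y > 0" "bary b c a y > 0" using \<epsilon>(2) by auto
    then have "y \<in> convex hull {a, b, c} \<longleftrightarrow> bary c a b y \<ge> 0"
      unfolding triangle_eq_bary[OF nz] by auto
    also have "bary c a b y = cross (b - a) (y - a) / cross (b - a) (c - a)"
      unfolding bary_def by (rule arg_cong2[where f = "(/)"]) (simp_all add: cross_def algebra_simps)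
    also have "\<dots> \<ge> 0 \<longleftrightarrow> cross (b - a) (c - a) * cross (b - a) (y - a) \<ge> 0"
      using nz by (auto simp: zero_le_divide_iff zero_le_mult_iff)
    finally show "y \<in> convex hull {a, b, c} \<longleftrightarrow> cross (b - a) (c - a) * cross (b - a) (y - a) \<ge> 0" .
  qed
qed

text \<open>
  Near the midpoint of the common edge both triangles are the same half plane.
\<close>

lemma same_side_triangles_overlap:
  assumes "cross (b - a) (c - a) * cross (b - a) (d - a) > 0"
  shows "\<not> negligible (convex hull {a, b, c} \<inter> convex hull {a, b, d})"
proof -
  let ?C = "cross (b - a) (c - a)" and ?D = "cross (b - a) (d - a)"
  have nz: "?C \<noteq> 0" "?D \<noteq> 0" using assms by auto
  have "a \<noteq> b" using nz by auto
  define x where "x = midpoint a b"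
  have x: "x \<in> open_segment a b"
    unfolding x_def using \<open>a \<noteq> b\<close> by (simp add: midpoint_in_open_segment)
  obtain \<epsilon> \<delta> where \<epsilon>: "\<epsilon> > 0" "\<And>y. y \<in> ball x \<epsilon> \<Longrightarrow> y \<in> convex hull {a, b, c} \<longleftrightarrow> ?C * cross (b - a) (y - a) \<ge> 0"
    and \<delta>: "\<delta> > 0" "\<And>y. y \<in> ball x \<delta> \<Longrightarrow> y \<in> convex hull {a, b, d} \<longleftrightarrow> ?D * cross (b - a) (y - a) \<ge> 0"
    using triangle_locally_half_plane[OF nz(1) x] triangle_locally_half_plane[OF nz(2) x] by metis
  let ?U = "ball x (min \<epsilon> \<delta>) \<inter> {y. ?C * cross (b - a) (y - a) > 0}"
  have "open ?U"
    unfolding cross_def by (intro open_Int open_ball open_Collect_less continuous_intros)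
  moreover have "?U \<noteq> {}"
  proof -
    let ?s = "min \<epsilon> \<delta> / (2 * (norm (c - a) + 1))"
    let ?y = "x + ?s *\<^sub>R (c - a)"
    have pos: "norm (c - a) + 1 > 0" by (simp add: add_nonneg_pos)
    have s: "?s > 0" using \<epsilon>(1) \<delta>(1) pos by simp
    have "norm (?s *\<^sub>R (c - a)) < min \<epsilon> \<delta>"
    proof -
      have "norm (?s *\<^sub>R (c - a)) = ?s * norm (c - a)"
        unfolding norm_scaleR abs_of_pos[OF s] ..
      also have "\<dots> < ?s * (2 * (norm (c - a) + 1))"
      proof (rule mult_strict_left_mono[OF _ s])
        have "0 \<le> norm (c - a)" by simp
        then show "norm (c - a) < 2 * (norm (c - a) + 1)" by (simp only: distrib_left)
      qed
      also have "\<dots> = min \<epsilon> \<delta>" using pos by (simp add: field_simps)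
      finally show ?thesis .
    qed
    then have "?y \<in> ball x (min \<epsilon> \<delta>)" by (simp add: dist_norm)
    moreover have "cross (b - a) (?y - a) = ?s * ?C"
    proof -
      have "x - a = (1 / 2) *\<^sub>R (b - a)"
        by (simp add: x_def midpoint_def vec_eq_iff field_simps)
      then have "?y - a = (1 / 2) *\<^sub>R (b - a) + ?s *\<^sub>R (c - a)"
        by (simp add: algebra_simps)
      moreover have "cross u ((1 / 2) *\<^sub>R u + s *\<^sub>R w) = s * cross u w" for u w s
        by (simp add: cross_def algebra_simps)
      ultimately show ?thesis by (simp only:)
    qed
    then have "?C * cross (b - a) (?y - a) = ?s * ?C\<^sup>2" by (simp add: power2_eq_square)
    moreover have "?s * ?C\<^sup>2 > 0" using nz by (intro mult_pos_pos s) simp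
    ultimately show ?thesis by auto
  qed
  moreover have "?U \<subseteq> convex hull {a, b, c} \<inter> convex hull {a, b, d}"
  proof
    fix y assume y: "y \<in> ?U"
    then have "?D * cross (b - a) (y - a) \<ge> 0"
      using assms by (auto simp: zero_less_mult_iff zero_le_mult_iff)
    then show "y \<in> convex hull {a, b, c} \<inter> convex hull {a, b, d}"
      using y \<epsilon>(2) \<delta>(2) by auto
  qed
  ultimately show ?thesis
    using negligible_subset open_not_negligible by blast
qed

text \<open>
  Near \<open>x\<close> the two triangles are complementary half planes.
\<close>

lemma opposite_triangles_neighbourhood:
  assumes "cross (b - a) (c - a) * cross (b - a) (d - a) < 0" "x \<in> open_segment a b"
  shows "x \<in> interior (convex hull {a, b, c} \<union> convex hull {a, b, d})"
proof -
  let ?C = "cross (b - a) (c - a)" and ?D = "cross (b - a) (d - a)"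
  have nz: "?C \<noteq> 0" "?D \<noteq> 0" using assms by auto
  obtain \<epsilon> \<delta> where \<epsilon>: "\<epsilon> > 0" "\<And>y. y \<in> ball x \<epsilon> \<Longrightarrow> y \<in> convex hull {a, b, c} \<longleftrightarrow> ?C * cross (b - a) (y - a) \<ge> 0"
    and \<delta>: "\<delta> > 0" "\<And>y. y \<in> ball x \<delta> \<Longrightarrow> y \<in> convex hull {a, b, d} \<longleftrightarrow> ?D * cross (b - a) (y - a) \<ge> 0"
    using triangle_locally_half_plane[OF nz(1) assms(2)] triangle_locally_half_plane[OF nz(2) assms(2)] by metis
  have "ball x (min \<epsilon> \<delta>) \<subseteq> convex hull {a, b, c} \<union> convex hull {a, b, d}"
  proof
    fix y assume y: "y \<in> ball x (min \<epsilon> \<delta>)"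
    have "?C * cross (b - a) (y - a) \<ge> 0 \<or> ?D * cross (b - a) (y - a) \<ge> 0"
      using assms(1) by (auto simp: mult_less_0_iff zero_le_mult_iff)
    then show "y \<in> convex hull {a, b, c} \<union> convex hull {a, b, d}"
      using y \<epsilon>(2) \<delta>(2) by auto
  qed
  moreover have "ball x (min \<epsilon> \<delta>) \<noteq> {}" "x \<in> ball x (min \<epsilon> \<delta>)" using \<epsilon>(1) \<delta>(1) by auto
  ultimately show ?thesis
    using mem_interior \<epsilon>(1) \<delta>(1) by (metis min_less_iff_conj)
qed

text \<open>
  The normal times the length of the edge is the edge vector turned by a right angle, the sign
  being the orientation of the triangle. The inequality that defines the normal forces
  orthogonality to the edge, because it can be applied to the endpoints in both orders, and the
  third vertex fixes the sign.
\<close>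

lemma outward_normal_triangle:
  assumes nz: "cross (b - a) (c - a) \<noteq> 0"
  shows "dist a b *\<^sub>R outward_normal (convex hull {a, b, c}) (closed_segment a b) =
     sgn (cross (b - a) (c - a)) *\<^sub>R vector [(b - a) $ 2, - ((b - a) $ 1)]"
proof -
  let ?D = "cross (b - a) (c - a)" and ?u = "b - a" and ?w = "c - a"
  let ?r = "vector [(b - a) $ 2, - ((b - a) $ 1)] :: plane"
  let ?P = "\<lambda>n. norm n = 1 \<and> (\<forall>x\<in>closed_segment a b. \<forall>y\<in>convex hull {a, b, c}. n \<bullet> (y - x) \<le> 0)"
  define n where "n = (sgn ?D / dist a b) *\<^sub>R ?r"
  have ab: "dist a b > 0" using nz by auto
  have ru: "?r \<bullet> ?u = 0" and rw: "?r \<bullet> ?w = - ?D" and rr: "?r \<bullet> ?r = (dist a b)\<^sup>2"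
    by (simp_all add: inner_plane vector_2 cross_def dist_norm power2_norm_eq_inner)
       (simp_all add: algebra_simps)
  have "norm ?r = dist a b"
    using rr ab by (metis norm_eq_sqrt_inner real_sqrt_unique zero_le_dist)
  then have n1: "norm n = 1"
    using ab nz unfolding n_def by (simp add: abs_sgn_eq)
  have nu: "n \<bullet> ?u = 0" unfolding n_def using ru by simp
  have "n \<bullet> ?w = - (\<bar>?D\<bar> / dist a b)" unfolding n_def using rw by (simp add: abs_sgn)
  then have nw: "n \<bullet> ?w < 0" using ab nz by simp
  have Pn: "?P n"
  proof (intro conjI ballI)
    fix x y assume x: "x \<in> closed_segment a b" and y: "y \<in> convex hull {a, b, c}"
    obtain t where t: "x = (1 - t) *\<^sub>R a + t *\<^sub>R b" using x unfolding in_segment by blast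
    obtain p q r where *: "0 \<le> r" "p + q + r = 1" "y = p *\<^sub>R a + q *\<^sub>R b + r *\<^sub>R c"
      using y unfolding convex_hull_3 by blast
    have p: "p = 1 - q - r" using *(2) by simp
    have "y - x = (q - t) *\<^sub>R ?u + r *\<^sub>R ?w"
      unfolding *(3) t p by (simp add: algebra_simps)
    then have "n \<bullet> (y - x) = r * (n \<bullet> ?w)"
      using nu by (simp add: inner_add_right)
    then show "n \<bullet> (y - x) \<le> 0" using *(1) nw by (simp add: mult_nonneg_nonpos)
  qed (fact n1)
  moreover have "m = n" if m: "?P m" for m
  proof -
    have in1: "a \<in> closed_segment a b" "b \<in> closed_segment a b" by auto
    have in2: "a \<in> convex hull {a, b, c}" "b \<in> convex hull {a, b, c}" "c \<in> convex hull {a, b, c}"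
      by (auto intro: hull_inc)
    have "m \<bullet> (b - a) \<le> 0" "m \<bullet> (a - b) \<le> 0" and mw: "m \<bullet> ?w \<le> 0" using m in1 in2 by blast+
    then have mu: "m \<bullet> ?u = 0" by (simp add: inner_diff_right)
    define k where "k = (m \<bullet> ?r) / (dist a b)\<^sup>2"
    have "(?u \<bullet> ?u) *\<^sub>R m = (m \<bullet> ?u) *\<^sub>R ?u + (m \<bullet> ?r) *\<^sub>R ?r"
      by (simp add: vec_eq_iff forall_2 inner_plane vector_2 algebra_simps)
    moreover have uu: "?u \<bullet> ?u = (dist a b)\<^sup>2"
      by (simp add: dist_norm norm_minus_commute[of a b] power2_norm_eq_inner)
    ultimately have "(dist a b)\<^sup>2 *\<^sub>R m = (m \<bullet> ?r) *\<^sub>R ?r" using mu by simp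
    then have "(1 / (dist a b)\<^sup>2) *\<^sub>R (dist a b)\<^sup>2 *\<^sub>R m = (1 / (dist a b)\<^sup>2) *\<^sub>R (m \<bullet> ?r) *\<^sub>R ?r" by simp
    then have mk: "m = k *\<^sub>R ?r" using ab unfolding k_def by simp
    have "\<bar>k\<bar> * dist a b = 1"
      using m \<open>norm ?r = dist a b\<close> unfolding mk by simp
    then have k1: "\<bar>k\<bar> = 1 / dist a b" using ab by (simp add: field_simps)
    have "k * ?D \<ge> 0" using mw rw unfolding mk by simp
    then have "k = sgn ?D / dist a b"
      using k1 nz by (cases "?D > 0") (auto simp: zero_le_mult_iff sgn_if abs_if split: if_splits)
    then show "m = n" unfolding mk n_def by simp
  qed
  ultimately have "outward_normal (convex hull {a, b, c}) (closed_segment a b) = n"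
    unfolding outward_normal_def by (rule the_equality)
  then show ?thesis using ab unfolding n_def by simp
qed

section \<open>Triangulations of a convex domain\<close>

locale triangulated_domain =
  fixes \<Omega> :: "plane set" and M :: mesh
  assumes dom: "convex_polygonal_domain \<Omega>" and mesh: "mesh_of \<Omega> M"
begin

lemma domain: "open \<Omega>" "\<Omega> \<noteq> {}" "bounded \<Omega>" "convex \<Omega>"
  using dom by (auto simp: convex_polygonal_domain_def)

lemma domain_measurable: "\<Omega> \<in> lmeasurable" "\<Omega> \<in> sets lebesgue"
  using lmeasurable_open[OF domain(3,1)] by auto

lemma interior_closure_domain: "interior (closure \<Omega>) = \<Omega>"
  using domain convex_interior_closure interior_open by metis

lemma finite_mesh: "finite M"
  and simplex: "T \<in> M \<Longrightarrow> 2 simplex T"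
  and Union_mesh: "\<Union>M = closure \<Omega>"
  using mesh by (auto simp: mesh_of_def triangulation_def)

lemma conforming: "T \<in> M \<Longrightarrow> T' \<in> M \<Longrightarrow> T \<inter> T' face_of T" "T \<in> M \<Longrightarrow> T' \<in> M \<Longrightarrow> T \<inter> T' face_of T'"
  using mesh unfolding mesh_of_def triangulation_def by (blast, metis Int_commute)

lemma triangle_topology:
  assumes "T \<in> M"
  shows "compact T" "convex T" "closed T" "T \<in> lmeasurable" "T \<in> sets lebesgue" "T \<subseteq> closure \<Omega>" "\<not> negligible T" "T \<noteq> {}"
proof -
  obtain a b c where T: "T = convex hull {a, b, c}" and nz: "cross (b - a) (c - a) \<noteq> 0"
    using simplex[OF assms] unfolding simplex_2_iff by blast
  show 1: "compact T" "convex T" "T \<noteq> {}" unfolding T using compact_triangle by auto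
  then show 2: "closed T" "T \<in> lmeasurable" using compact_imp_closed lmeasurable_compact by auto
  then show "T \<in> sets lebesgue" by auto
  show "T \<subseteq> closure \<Omega>" using assms Union_mesh by blast
  show "\<not> negligible T"
    using nz measure_triangle[of a b c] negligible_imp_measure0[of T] unfolding T by auto
qed

lemma negligible_outside: "T \<in> M \<Longrightarrow> negligible (T - \<Omega>)"
  using triangle_topology(6) negligible_subset[OF negligible_convex_frontier[OF domain(4)]] domain(1)
  by (metis Diff_mono frontier_def interior_open order_refl)

lemma negligible_Union_outside: "negligible (\<Union>M - \<Omega>)" "negligible (\<Omega> - \<Union>M)"
proof -
  show "negligible (\<Union>M - \<Omega>)"
    unfolding Union_mesh using negligible_convex_frontier[OF domain(4)] domain(1)
    by (simp add: frontier_def interior_open)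
  have "\<Omega> - \<Union>M = {}" unfolding Union_mesh using closure_subset by blast
  then show "negligible (\<Omega> - \<Union>M)" by simp
qed

lemma negligible_overlap: "T \<in> M \<Longrightarrow> T' \<in> M \<Longrightarrow> T \<noteq> T' \<Longrightarrow> negligible (T \<inter> T')"
  using conforming_triangles_negligible simplex conforming by blast

lemma sum_LINT_mesh:
  fixes h :: "plane \<Rightarrow> real"
  assumes "integrable (lebesgue_on \<Omega>) h"
  shows "(\<Sum>T\<in>M. LINT x|lebesgue_on T. h x) = (LINT x|lebesgue_on \<Omega>. h x)"
  by (rule sum_LINT_partition[OF finite_mesh domain_measurable(2) triangle_topology(5) negligible_overlap
        negligible_Union_outside assms])

lemma open_triangle_subset_domain:
  assumes "convex hull {a, b, c} \<in> M" "cross (b - a) (c - a) \<noteq> 0"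
  shows "open_triangle a b c \<subseteq> \<Omega>"
proof -
  have "open_triangle a b c \<subseteq> closure \<Omega>"
    using triangle_topology(6)[OF assms(1)] unfolding triangle_eq_bary[OF assms(2)] by auto
  then show ?thesis
    using interior_maximal[OF _ open_triangle_open] interior_closure_domain by blast
qed

lemma weak_grad_mean_unique:
  assumes "T \<in> M" "has_weak_grad \<Omega> v g" "has_weak_grad \<Omega> v h"
  shows "(LINT x|lebesgue_on T. g x $ i) = (LINT x|lebesgue_on T. h x $ i)"
proof -
  obtain a b c where T: "T = convex hull {a, b, c}" and nz: "cross (b - a) (c - a) \<noteq> 0"
    using simplex[OF assms(1)] unfolding simplex_2_iff by blast
  show ?thesis
    unfolding T
    by (rule weak_grad_integral_unique[OF assms(2,3) domain_measurable(1) nz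
          open_triangle_subset_domain[OF assms(1)[unfolded T] nz]
          negligible_outside[OF assms(1)[unfolded T]] triangle_boundary_negligible[OF nz]])
qed

lemma adjacent_iff: "T \<in> adjacent M e \<longleftrightarrow> T \<in> M \<and> e edge_of T"
  by (simp add: adjacent_def)

lemma finite_adjacent: "finite (adjacent M e)"
  using finite_mesh by (simp add: adjacent_def)

text \<open>
  Triangles on the same side of their common edge would overlap.
\<close>

lemma adjacent_opposite:
  assumes "convex hull {a, b, c} \<in> M" "convex hull {a, b, d} \<in> M" "convex hull {a, b, c} \<noteq> convex hull {a, b, d}"
    "cross (b - a) (c - a) \<noteq> 0" "cross (b - a) (d - a) \<noteq> 0"
  shows "cross (b - a) (c - a) * cross (b - a) (d - a) < 0"
  using same_side_triangles_overlap[of b a c d] negligible_overlap[OF assms(1-3)] assms(4,5)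
  by (meson linorder_neqE_linordered_idom mult_eq_0_iff)

lemma adjacent_triangle:
  assumes "T \<in> adjacent M (closed_segment a b)"
  obtains c where "T = convex hull {a, b, c}" "cross (b - a) (c - a) \<noteq> 0"
  using triangle_at_edge[of T a b] assms simplex unfolding adjacent_iff by blast

text \<open>
  Three triangles at one edge would lie on pairwise opposite sides of it.
\<close>

lemma card_adjacent:
  assumes "e \<in> edges M"
  shows "card (adjacent M e) = 1 \<or> card (adjacent M e) = 2"
proof -
  obtain T where T: "T \<in> M" "e edge_of T" using assms unfolding edges_def by blast
  obtain a b where e: "e = closed_segment a b" using edge_obtains_segment[OF simplex[OF T(1)] T(2)] by blast
  have "card (adjacent M e) \<le> 2"
  proof (rule ccontr)
    assume "\<not> ?thesis"
    then have "3 \<le> card (adjacent M e)" by simp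
    then obtain S where "S \<subseteq> adjacent M e" "card S = 3"
      by (meson obtain_subset_with_card_n)
    then obtain T1 T2 T3 where "T1 \<in> adjacent M e" "T2 \<in> adjacent M e" "T3 \<in> adjacent M e"
      and ne: "T1 \<noteq> T2" "T2 \<noteq> T3" "T1 \<noteq> T3"
      unfolding card_3_iff by auto
    then obtain c1 c2 c3 where "T1 = convex hull {a, b, c1}" "cross (b - a) (c1 - a) \<noteq> 0"
      "T2 = convex hull {a, b, c2}" "cross (b - a) (c2 - a) \<noteq> 0"
      "T3 = convex hull {a, b, c3}" "cross (b - a) (c3 - a) \<noteq> 0" "T1 \<in> M" "T2 \<in> M" "T3 \<in> M"
      unfolding e by (metis adjacent_triangle adjacent_iff)
    then have "cross (b - a) (c1 - a) * cross (b - a) (c2 - a) < 0"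
      "cross (b - a) (c2 - a) * cross (b - a) (c3 - a) < 0"
      "cross (b - a) (c1 - a) * cross (b - a) (c3 - a) < 0"
      using ne adjacent_opposite by metis+
    then show False by (auto simp: mult_less_0_iff)
  qed
  moreover have "card (adjacent M e) \<noteq> 0"
    using T finite_adjacent adjacent_iff by auto
  ultimately show ?thesis by linarith
qed

lemma interior_or_boundary_edge: "e \<in> edges M \<Longrightarrow> e \<in> interior_edges M \<or> e \<in> boundary_edges M"
  using card_adjacent by (auto simp: interior_edges_def boundary_edges_def)

lemma outward_normals_opposite:
  assumes "T \<in> adjacent M e" "T' \<in> adjacent M e" "T \<noteq> T'"
  shows "outward_normal T e + outward_normal T' e = 0"
proof -
  have "2 simplex T" using assms(1) simplex unfolding adjacent_iff by blast
  then obtain a b where e: "e = closed_segment a b" "a \<noteq> b"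
    using edge_obtains_segment assms(1) unfolding adjacent_iff by metis
  obtain c where c: "T = convex hull {a, b, c}" "cross (b - a) (c - a) \<noteq> 0"
    using assms(1) adjacent_triangle unfolding e by blast
  obtain d where d: "T' = convex hull {a, b, d}" "cross (b - a) (d - a) \<noteq> 0"
    using assms(2) adjacent_triangle unfolding e by blast
  have "cross (b - a) (c - a) * cross (b - a) (d - a) < 0"
    using adjacent_opposite[of a b c d] assms c d unfolding adjacent_iff by blast
  then have s: "sgn (cross (b - a) (c - a)) = - sgn (cross (b - a) (d - a))"
    by (auto simp: mult_less_0_iff)
  have "dist a b *\<^sub>R (outward_normal T e + outward_normal T' e) = 0"
    unfolding e c(1) d(1) scaleR_add_right outward_normal_triangle[OF c(2)] outward_normal_triangle[OF d(2)] s
    by simp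
  then show ?thesis using e(2) by simp
qed

lemma shared_edge_neighbourhood:
  assumes "T \<in> adjacent M (closed_segment a b)" "T' \<in> adjacent M (closed_segment a b)" "T \<noteq> T'" "x \<in> open_segment a b"
  shows "x \<in> interior (T \<union> T')"
proof -
  obtain c where c: "T = convex hull {a, b, c}" "cross (b - a) (c - a) \<noteq> 0"
    using assms(1) adjacent_triangle by blast
  obtain d where d: "T' = convex hull {a, b, d}" "cross (b - a) (d - a) \<noteq> 0"
    using assms(2) adjacent_triangle by blast
  have "cross (b - a) (c - a) * cross (b - a) (d - a) < 0"
    using adjacent_opposite[of a b c d] assms c d unfolding adjacent_iff by blast
  then show ?thesis
    unfolding c(1) d(1) using opposite_triangles_neighbourhood assms(4) by blast
qed

text \<open>
  If a relative interior point \<open>x\<close> of the edge were in the domain, points just across the edge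
  would lie in other triangles, so \<open>x\<close> itself would lie in another triangle \<open>T'\<close>. By conformity
  \<open>T \<inter> T'\<close> is a proper face of \<open>T\<close>, and as it meets the relative interior of \<open>e\<close> it equals \<open>e\<close>;
  so \<open>e\<close> would be an edge of \<open>T'\<close> as well.
\<close>

lemma unshared_edge_in_frontier:
  assumes T: "T \<in> M" "e edge_of T" and alone: "\<And>T'. T' \<in> M \<Longrightarrow> e edge_of T' \<Longrightarrow> T' = T"
  shows "e \<subseteq> frontier \<Omega>"
proof -
  obtain a b where e: "e = closed_segment a b" "a \<noteq> b"
    using edge_obtains_segment[OF simplex[OF T(1)] T(2)] by blast
  obtain c where c: "T = convex hull {a, b, c}" and nz: "cross (b - a) (c - a) \<noteq> 0"
    using triangle_at_edge[OF simplex[OF T(1)] T(2)[unfolded e]] by blast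
  have eT: "e face_of T" "aff_dim e = 1" using T(2) unfolding edge_of_def by auto
  have "open_segment a b \<inter> \<Omega> = {}"
  proof (rule ccontr)
    assume "open_segment a b \<inter> \<Omega> \<noteq> {}"
    then obtain x where x: "x \<in> open_segment a b" "x \<in> \<Omega>" by blast
    obtain \<epsilon> where \<epsilon>: "\<epsilon> > 0" "\<And>y. y \<in> ball x \<epsilon> \<Longrightarrow>
        y \<in> convex hull {a, b, c} \<longleftrightarrow> cross (b - a) (c - a) * cross (b - a) (y - a) \<ge> 0"
      using triangle_locally_half_plane[OF nz x(1)] by blast
    obtain \<delta> where \<delta>: "\<delta> > 0" "ball x \<delta> \<subseteq> \<Omega>"
      using domain(1) x(2) unfolding open_contains_ball by blast
    obtain t where t: "x = (1 - t) *\<^sub>R a + t *\<^sub>R b" using x(1) unfolding in_segment by blast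
    let ?K = "\<Union>(M - {T})"
    have "closed ?K" using finite_mesh triangle_topology(3) by (intro closed_Union) auto
    moreover have "x \<in> closure ?K"
      unfolding closure_approachable
    proof (intro allI impI)
      fix r :: real assume "r > 0"
      define \<rho> where "\<rho> = min r (min \<epsilon> \<delta>)"
      have \<rho>: "\<rho> > 0" using \<open>r > 0\<close> \<epsilon>(1) \<delta>(1) by (simp add: \<rho>_def)
      have "c - a \<noteq> 0" using nz by auto
      define s where "s = \<rho> / (2 * norm (c - a))"
      have s: "s > 0" using \<rho> \<open>c - a \<noteq> 0\<close> unfolding s_def by simp
      \<comment> \<open>A point across the edge from \<open>T\<close>, in all three balls around \<open>x\<close>.\<close>
      define y where "y = x - s *\<^sub>R (c - a)"
      have "dist x y = s * norm (c - a)" using s by (simp add: y_def dist_norm)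
      also have "\<dots> < \<rho>" using \<rho> \<open>c - a \<noteq> 0\<close> unfolding s_def by simp
      finally have d: "dist x y < \<rho>" .
      have "x - a = t *\<^sub>R (b - a)" unfolding t by (simp add: algebra_simps)
      then have "y - a = t *\<^sub>R (b - a) - s *\<^sub>R (c - a)" by (simp add: y_def algebra_simps)
      moreover have "cross u (t *\<^sub>R u - s *\<^sub>R w) = - (s * cross u w)" for u w
        by (simp add: cross_def algebra_simps)
      ultimately have "cross (b - a) (y - a) = - (s * cross (b - a) (c - a))" by (simp only:)
      then have "cross (b - a) (c - a) * cross (b - a) (y - a) = - (s * (cross (b - a) (c - a))\<^sup>2)"
        by (simp add: power2_eq_square)
      moreover have "s * (cross (b - a) (c - a))\<^sup>2 > 0" using nz by (intro mult_pos_pos s) simp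
      ultimately have "\<not> cross (b - a) (c - a) * cross (b - a) (y - a) \<ge> 0" by linarith
      then have "y \<notin> T" using \<epsilon>(2)[of y] d unfolding c \<rho>_def by simp
      moreover have "y \<in> \<Omega>" using \<delta>(2) d unfolding \<rho>_def by auto
      ultimately have "y \<in> ?K" using Union_mesh closure_subset by blast
      moreover have "dist y x < r" using d unfolding \<rho>_def by (simp add: dist_commute)
      ultimately show "\<exists>y\<in>?K. dist y x < r" by blast
    qed
    ultimately have "x \<in> ?K" by simp
    then obtain T' where T': "T' \<in> M" "T' \<noteq> T" "x \<in> T'" by blast
    let ?F = "T \<inter> T'"
    note F = conforming[OF T(1) T'(1)]
    have "x \<in> rel_interior e" using x(1) e by (simp add: rel_interior_closed_segment)
    moreover have "x \<in> T" using x(1) e eT face_of_imp_subset open_closed_segment by blast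
    ultimately have eF: "e \<subseteq> ?F"
      using subset_of_face_of[OF F(1)] eT face_of_imp_subset T'(3) by blast
    have "?F \<noteq> T"
      using negligible_overlap[OF T(1) T'(1)] T'(2) triangle_topology(7)[OF T(1)] by metis
    then have "aff_dim ?F < 2"
      using face_of_aff_dim_lt[OF triangle_topology(2)[OF T(1)] F(1)] aff_dim_triangle[OF simplex[OF T(1)]] by simp
    have eF': "e face_of ?F" using face_of_subset[OF eT(1) eF] by blast
    have "e = ?F"
    proof (rule ccontr)
      assume "e \<noteq> ?F"
      then have "aff_dim e < aff_dim ?F"
        using face_of_aff_dim_lt[OF face_of_imp_convex[OF F(1)] eF'] triangle_topology(2)[OF T(1)] by blast
      then show False using eT(2) \<open>aff_dim ?F < 2\<close> by linarith
    qed
    then have "e edge_of T'" using F(2) eT(2) unfolding edge_of_def by simp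
    then show False using alone T' by blast
  qed
  moreover have "e \<subseteq> closure \<Omega>"
    using eT face_of_imp_subset triangle_topology(6)[OF T(1)] by blast
  ultimately have "open_segment a b \<subseteq> frontier \<Omega>"
    using domain(1) open_closed_segment[of _ a b] unfolding e frontier_def by (auto simp: interior_open)
  then have "closure (open_segment a b) \<subseteq> frontier \<Omega>"
    by (rule closure_minimal) simp
  then show ?thesis using e by simp
qed

lemma boundary_edge_in_frontier:
  assumes "e \<in> boundary_edges M"
  shows "e \<subseteq> frontier \<Omega>"
proof -
  have "card (adjacent M e) = 1" using assms by (simp add: boundary_edges_def)
  then obtain T where T: "adjacent M e = {T}" using card_1_singletonE by blast
  then show ?thesis
    using unshared_edge_in_frontier[of T e] adjacent_iff by (metis insertI1 singletonD)
qed

definition star :: "plane \<Rightarrow> mesh" where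
  "star z = {T \<in> M. z extreme_point_of T}"

text \<open>
  In a small punctured ball around \<open>z\<close> the union of the family is closed, and it is open: a
  point in the interior of a triangle is harmless, and across an edge at \<open>z\<close> the family
  continues by assumption. A punctured disc is connected, so the union fills it. This replaces a
  cyclic enumeration of the triangles around \<open>z\<close>.
\<close>

lemma star_covers_ball:
  assumes C: "\<C> \<subseteq> star z" "\<C> \<noteq> {}"
    and shared: "\<And>T e. T \<in> \<C> \<Longrightarrow> e edge_of T \<Longrightarrow> z \<in> e \<Longrightarrow> \<exists>T'\<in>\<C>. T' \<noteq> T \<and> e edge_of T'"
  obtains \<epsilon> where "\<epsilon> > 0" "ball z \<epsilon> \<subseteq> \<Union>\<C>"
proof -
  have fin: "finite \<C>"
    using C(1) finite_mesh unfolding star_def by (simp add: finite_subset)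
  have CM: "T \<in> M" "z extreme_point_of T" if "T \<in> \<C>" for T
    using C(1) that unfolding star_def by auto
  have "\<exists>\<epsilon>>0. \<exists>b c. T = convex hull {z, b, c} \<and> cross (b - z) (c - z) \<noteq> 0 \<and> ball z \<epsilon> \<subseteq> {y. bary z b c y > 0}"
    if TC: "T \<in> \<C>" for T
  proof -
    obtain b c where T: "T = convex hull {z, b, c}" "cross (b - z) (c - z) \<noteq> 0"
      using triangle_at_vertex[OF simplex[OF CM(1)[OF TC]] CM(2)[OF TC]] by blast
    have "open {y. bary z b c y > 0}"
      by (intro open_Collect_less continuous_on_const continuous_on_bary)
    moreover have "z \<in> {y. bary z b c y > 0}" using bary_at(1)[OF T(2)] by simp
    ultimately show ?thesis using T unfolding open_contains_ball by blast
  qed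
  then obtain r where r: "\<And>T. T \<in> \<C> \<Longrightarrow> r T > 0 \<and>
      (\<exists>b c. T = convex hull {z, b, c} \<and> cross (b - z) (c - z) \<noteq> 0 \<and> ball z (r T) \<subseteq> {y. bary z b c y > 0})"
    by metis
  \<comment> \<open>Within this radius no triangle of the family is left through the edge opposite to \<open>z\<close>.\<close>
  define \<epsilon> where "\<epsilon> = Min (r ` \<C>)"
  have \<epsilon>: "\<epsilon> > 0" using fin C(2) r unfolding \<epsilon>_def by (subst Min_gr_iff) auto
  have \<epsilon>r: "\<epsilon> \<le> r T" if "T \<in> \<C>" for T using fin that unfolding \<epsilon>_def by simp
  let ?S = "ball z \<epsilon> - {z}" and ?U = "\<Union>\<C>"
  have loc: "x \<in> interior ?U" if x: "x \<in> ?S" "x \<in> ?U" for x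
  proof -
    obtain T where T: "T \<in> \<C>" "x \<in> T" using x(2) by blast
    obtain b c where bc: "T = convex hull {z, b, c}" "cross (b - z) (c - z) \<noteq> 0" "ball z (r T) \<subseteq> {y. bary z b c y > 0}"
      using r[OF T(1)] by blast
    have "x \<in> ball z (r T)" using \<epsilon>r[OF T(1)] x(1) by auto
    then have z0: "bary z b c x > 0" using bc(3) by blast
    have ge: "bary b c z x \<ge> 0" "bary c z b x \<ge> 0"
      using T(2) unfolding bc(1) triangle_eq_bary[OF bc(2)] by auto
    have sum: "bary z b c x + bary b c z x + bary c z b x = 1" by (rule bary_sum[OF bc(2)])
    note exp = bary_expansion[OF bc(2), of x]
    have edge: "x \<in> interior ?U" if p: "x \<in> open_segment z p" "closed_segment z p edge_of T" for p
    proof -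
      obtain T' where T': "T' \<in> \<C>" "T' \<noteq> T" "closed_segment z p edge_of T'"
        using shared[OF T(1) p(2)] by auto
      then have "x \<in> interior (T \<union> T')"
        using shared_edge_neighbourhood[of T z p T' x] p T(1) CM(1) unfolding adjacent_iff by blast
      moreover have "T \<union> T' \<subseteq> ?U" using T(1) T'(1) by blast
      ultimately show ?thesis using interior_mono by blast
    qed
    consider "bary b c z x > 0" "bary c z b x > 0" | "bary b c z x = 0" | "bary c z b x = 0"
      using ge by linarith
    then show ?thesis
    proof cases
      case 1
      then have "x \<in> open_triangle z b c" using z0 by simp
      moreover have "open_triangle z b c \<subseteq> T"
        unfolding bc(1) triangle_eq_bary[OF bc(2)] by auto
      then have "open_triangle z b c \<subseteq> ?U"
        using T(1) by blast
      ultimately show ?thesis using interiorI[OF open_triangle_open] by blast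
    next
      case 2
      let ?t = "bary c z b x"
      have s: "bary z b c x = 1 - ?t" using sum 2 by linarith
      note exp
      also have "bary z b c x *\<^sub>R z + bary b c z x *\<^sub>R b + ?t *\<^sub>R c = (1 - ?t) *\<^sub>R z + ?t *\<^sub>R c"
        unfolding s 2 by simp
      finally have xx: "x = (1 - ?t) *\<^sub>R z + ?t *\<^sub>R c" .
      have "?t \<noteq> 0" using xx x(1) by auto
      moreover have "?t < 1" using sum z0 2 by linarith
      moreover have "z \<noteq> c" using bc(2) by auto
      ultimately have "x \<in> open_segment z c"
        using xx ge(2) unfolding in_segment by (intro conjI exI[of _ ?t]) auto
      moreover have "closed_segment z c edge_of T"
        unfolding bc(1) edge_of_triangle[OF bc(2)] by (simp add: closed_segment_commute)
      ultimately show ?thesis by (rule edge)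
    next
      case 3
      let ?t = "bary b c z x"
      have s: "bary z b c x = 1 - ?t" using sum 3 by linarith
      note exp
      also have "bary z b c x *\<^sub>R z + ?t *\<^sub>R b + bary c z b x *\<^sub>R c = (1 - ?t) *\<^sub>R z + ?t *\<^sub>R b"
        unfolding s 3 by simp
      finally have xx: "x = (1 - ?t) *\<^sub>R z + ?t *\<^sub>R b" .
      have "?t \<noteq> 0" using xx x(1) by auto
      moreover have "?t < 1" using sum z0 3 by linarith
      moreover have "z \<noteq> b" using bc(2) by auto
      ultimately have "x \<in> open_segment z b"
        using xx ge(1) unfolding in_segment by (intro conjI exI[of _ ?t]) auto
      moreover have "closed_segment z b edge_of T"
        unfolding bc(1) edge_of_triangle[OF bc(2)] by simp
      ultimately show ?thesis by (rule edge)
    qed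
  qed
  have "closed ?U" using fin CM(1) triangle_topology(3) by (intro closed_Union) auto
  have "connected ?S" by (rule connected_punctured_ball) simp
  have ne: "interior ?U \<inter> ?S \<noteq> {}"
  proof -
    obtain T where T: "T \<in> \<C>" using C(2) by blast
    obtain b c where bc: "T = convex hull {z, b, c}" "cross (b - z) (c - z) \<noteq> 0" using r[OF T] by blast
    have zb: "z \<noteq> b" using bc(2) by auto
    define t where "t = min 1 (\<epsilon> / (2 * dist z b))"
    have t: "0 < t" "t \<le> 1" "t * dist z b < \<epsilon>"
    proof -
      show "0 < t" "t \<le> 1" using \<epsilon> zb by (simp_all add: t_def)
      have "t * dist z b \<le> \<epsilon> / (2 * dist z b) * dist z b"
        by (intro mult_right_mono) (simp_all add: t_def)
      also have "\<dots> < \<epsilon>" using \<epsilon> zb by simp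
      finally show "t * dist z b < \<epsilon>" .
    qed
    define x where "x = (1 - t) *\<^sub>R z + t *\<^sub>R b"
    have xz: "x - z = t *\<^sub>R (b - z)" by (simp add: x_def algebra_simps)
    have "dist z x = t * dist z b"
      using t(1) by (metis xz abs_of_pos dist_commute dist_norm norm_scaleR)
    then have "x \<in> ?S" using t xz zb by auto
    moreover have "closed_segment z b \<subseteq> T"
      unfolding bc(1) segment_convex_hull by (rule hull_mono) auto
    moreover have "x \<in> closed_segment z b"
      unfolding in_segment x_def using t(1,2) by (intro exI[of _ t]) simp
    ultimately show ?thesis using loc T by blast
  qed
  have "?S \<subseteq> interior ?U \<union> - ?U" using loc by blast
  then have "- ?U \<inter> ?S = {}"
    using connectedD[OF \<open>connected ?S\<close>, of "interior ?U" "- ?U"] ne \<open>closed ?U\<close> interior_subset[of ?U] by blast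
  moreover have "z \<in> ?U"
    using C(2) CM(2) unfolding extreme_point_of_def by blast
  ultimately have "ball z \<epsilon> \<subseteq> ?U" by blast
  then show thesis using that \<epsilon> by blast
qed

end

section \<open>Edge means around a vertex\<close>

lemma diameter_closed_segment: "diameter (closed_segment a b) = dist a (b :: plane)"
proof (rule antisym)
  show "diameter (closed_segment a b) \<le> dist a b"
  proof (rule diameter_le)
    fix x y assume "x \<in> closed_segment a b" "y \<in> closed_segment a b"
    then obtain s t where st: "0 \<le> s" "s \<le> 1" "0 \<le> t" "t \<le> 1"
      "x = (1 - s) *\<^sub>R a + s *\<^sub>R b" "y = (1 - t) *\<^sub>R a + t *\<^sub>R b"
      unfolding in_segment by blast
    have "x - y = (t - s) *\<^sub>R (a - b)" unfolding st(5,6) by (simp add: algebra_simps)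
    then have "norm (x - y) = \<bar>t - s\<bar> * dist a b" by (simp add: dist_norm)
    also have "\<dots> \<le> 1 * dist a b" using st by (intro mult_right_mono) auto
    finally show "norm (x - y) \<le> dist a b" by simp
  qed simp
  show "dist a b \<le> diameter (closed_segment a b)"
    by (rule diameter_bounded_bound) (auto intro: bounded_closed_segment)
qed

text \<open>
  The diameter of an edge is its length.
\<close>

definition edge_mean :: "(plane \<Rightarrow> real) \<Rightarrow> plane set \<Rightarrow> real" where
  "edge_mean \<phi> e = edge_integral e \<phi> / diameter e"

lemma edge_mean_segment:
  assumes "continuous_on UNIV \<phi>" "a \<noteq> b"
  shows "edge_mean \<phi> (closed_segment a b) = seg_mean a b \<phi>"
  using assms by (simp add: edge_mean_def edge_integral_closed_segment diameter_closed_segment)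

lemma finite_edges_of_triangle: "2 simplex (T :: plane set) \<Longrightarrow> finite {e. e edge_of T}"
  and card_edges_of_triangle: "2 simplex (T :: plane set) \<Longrightarrow> card {e. e edge_of T} \<le> 3"
proof -
  assume "2 simplex T"
  then obtain a b c where T: "T = convex hull {a, b, c}" and nz: "cross (b - a) (c - a) \<noteq> 0"
    unfolding simplex_2_iff by blast
  have E: "{e. e edge_of T} = {closed_segment a b, closed_segment b c, closed_segment c a}"
    unfolding T edge_of_triangle[OF nz] by blast
  show "finite {e. e edge_of T}" unfolding E by simp
  show "card {e. e edge_of T} \<le> 3" unfolding E by (simp add: card_insert_if)
qed

lemma vertices_of_triangle:
  assumes "cross (b - a) (c - a) \<noteq> 0"
  shows "{z. z extreme_point_of convex hull {a, b, c}} = {a, b, c}" "card {a, b, c} = 3"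
  using extreme_point_of_triangle[OF assms] assms unfolding cross_nonzero_iff by auto

context triangulated_domain
begin

lemma finite_edges: "finite (edges M)"
proof -
  have "edges M = (\<Union>T\<in>M. {e. e edge_of T})" unfolding edges_def by auto
  then show ?thesis using finite_mesh simplex finite_edges_of_triangle by auto
qed

lemma edgeE:
  assumes "e \<in> edges M"
  obtains T a b c where "T \<in> M" "T = convex hull {a, b, c}" "cross (b - a) (c - a) \<noteq> 0" "e = closed_segment a b" "a \<noteq> b"
proof -
  obtain T where T: "T \<in> M" "e edge_of T" using assms unfolding edges_def by blast
  obtain a b where e: "e = closed_segment a b" "a \<noteq> b"
    using edge_obtains_segment[OF simplex[OF T(1)] T(2)] by blast
  obtain c where "T = convex hull {a, b, c}" "cross (b - a) (c - a) \<noteq> 0"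
    using triangle_at_edge[OF simplex[OF T(1)] T(2)[unfolded e(1)]] by blast
  then show thesis using that T(1) e by blast
qed

text \<open>
  Values on edges that change by at most \<open>\<delta> T\<close> within each triangle change by at most the sum of
  the \<open>\<delta> T\<close> around a vertex. Instead of a path through the triangles, the proof looks at a
  threshold \<open>t\<close> strictly between the two values. If no triangle at \<open>z\<close> has edge values on both
  sides of \<open>t\<close>, then the triangles whose values are on the same side as \<open>val e0\<close> are closed
  under passing to a neighbour across an edge at \<open>z\<close>. Either one of them has an unshared edge,
  which lies on the boundary and has the value \<open>0 = V\<close>, or by \<open>star_covers_ball\<close> they surround
  \<open>z\<close> and include every triangle there; both contradict the choice of \<open>t\<close>. So the value ranges
  of the triangles cover the interval between the two values, and their lengths add up.
\<close>

lemma nodal_oscillation: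
  fixes val :: "plane set \<Rightarrow> real"
  assumes osc: "\<And>T e e'. T \<in> M \<Longrightarrow> e edge_of T \<Longrightarrow> e' edge_of T \<Longrightarrow> \<bar>val e - val e'\<bar> \<le> \<delta> T"
    and bd: "\<And>e. e \<in> edges M \<Longrightarrow> e \<subseteq> frontier \<Omega> \<Longrightarrow> val e = 0"
    and e0: "e0 \<in> edges M" "z extreme_point_of e0"
    and Vb: "z \<in> frontier \<Omega> \<Longrightarrow> V = 0"
    and Vi: "z \<in> \<Omega> \<Longrightarrow> \<exists>e\<in>edges M. z extreme_point_of e \<and> V = val e"
  shows "\<bar>val e0 - V\<bar> \<le> (\<Sum>T\<in>star z. \<delta> T)"
proof -
  have fin: "finite (star z)" using finite_mesh by (simp add: star_def)
  define E where "E T = {e. e edge_of T \<and> z \<in> e}" for T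
  have finE: "finite (E T)" if "T \<in> M" for T
    by (rule finite_subset[OF _ finite_edges_of_triangle[OF simplex[OF that]]]) (auto simp: E_def)
  have ext: "z extreme_point_of T" if "e edge_of T" "z extreme_point_of e" for e T
    using that extreme_point_of_face unfolding edge_of_def by blast
  have ext': "z extreme_point_of e" if "T \<in> star z" "e \<in> E T" for T e
    using that extreme_point_of_face unfolding star_def E_def edge_of_def by blast
  have neE: "E T \<noteq> {}" if "T \<in> star z" for T
  proof -
    have T: "T \<in> M" "z extreme_point_of T" using that by (auto simp: star_def)
    obtain b c where bc: "T = convex hull {z, b, c}" "cross (b - z) (c - z) \<noteq> 0"
      using triangle_at_vertex[OF simplex[OF T(1)] T(2)] by blast
    have "closed_segment z b \<in> E T"
      unfolding E_def bc(1) edge_of_triangle[OF bc(2)] by simp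
    then show ?thesis by blast
  qed
  define lo where "lo T = Min (val ` E T)" for T
  define hi where "hi T = Max (val ` E T)" for T
  have lohi: "lo T \<le> val e" "val e \<le> hi T" if "T \<in> star z" "e \<in> E T" for T e
    using finE[of T] that unfolding lo_def hi_def by (auto simp: star_def)
  have width: "hi T - lo T \<le> \<delta> T" and le: "lo T \<le> hi T" if T: "T \<in> star z" for T
  proof -
    have TM: "T \<in> M" using T by (simp add: star_def)
    have "lo T \<in> val ` E T" "hi T \<in> val ` E T"
      unfolding lo_def hi_def using finE[OF TM] neE[OF T] by (auto intro: Min_in Max_in)
    then show "hi T - lo T \<le> \<delta> T"
      using osc[OF TM] unfolding E_def by fastforce
    show "lo T \<le> hi T" using neE[OF T] lohi[OF T] by fastforce
  qed
  define A where "A = min (val e0) V"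
  define B where "B = max (val e0) V"
  have cover: "t \<in> (\<Union>T\<in>star z. {lo T..hi T})" if t: "A < t" "t < B" for t
  proof (rule ccontr)
    assume uncovered: "t \<notin> (\<Union>T\<in>star z. {lo T..hi T})"
    \<comment> \<open>Edges whose value is on the same side of the threshold as that of \<open>e0\<close>.\<close>
    define P where "P e \<longleftrightarrow> (val e < t \<longleftrightarrow> val e0 < t)" for e
    define \<C> where "\<C> = {T \<in> star z. \<forall>e\<in>E T. P e}"
    have same: "T \<in> \<C>" if T: "T \<in> star z" "e \<in> E T" "P e" for T e
    proof -
      have "t < lo T \<or> hi T < t" using uncovered T(1) by force
      then have "\<forall>e'\<in>E T. val e' < t \<longleftrightarrow> val e < t"
        using lohi[OF T(1)] T(2) by (meson le_less_trans less_le_trans not_less_iff_gr_or_eq order_less_imp_le)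
      then show ?thesis using T(1,3) unfolding \<C>_def P_def by blast
    qed
    obtain T0 where T0: "T0 \<in> M" "e0 edge_of T0" using e0(1) unfolding edges_def by blast
    have z0: "z \<in> e0" using e0(2) unfolding extreme_point_of_def by blast
    have "T0 \<in> star z" using T0 ext[OF T0(2) e0(2)] by (simp add: star_def)
    then have T0C: "T0 \<in> \<C>" using same[of T0 e0] T0(2) z0 unfolding P_def E_def by blast
    have zcl: "z \<in> closure \<Omega>"
      using z0 T0 triangle_topology(6)[OF T0(1)] edge_of_imp_subset by blast
    show False
    proof (cases "\<exists>T\<in>\<C>. \<exists>e\<in>E T. \<forall>T'\<in>M. e edge_of T' \<longrightarrow> T' = T")
      case True
      then obtain T e where T: "T \<in> \<C>" "e \<in> E T" "\<And>T'. T' \<in> M \<Longrightarrow> e edge_of T' \<Longrightarrow> T' = T" by blast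
      have TM: "T \<in> M" "e edge_of T" "z \<in> e" using T(1,2) by (auto simp: \<C>_def star_def E_def)
      have fr: "e \<subseteq> frontier \<Omega>" using unshared_edge_in_frontier[OF TM(1,2) T(3)] by blast
      have "e \<in> edges M" using TM unfolding edges_def by blast
      then have "val e = 0" using bd fr by blast
      moreover have "V = 0" using Vb fr TM(3) by blast
      moreover have "P e" using T(1,2) by (simp add: \<C>_def)
      ultimately show False using t unfolding P_def A_def B_def by auto
    next
      case False
      have "\<C> \<subseteq> star z" by (auto simp: \<C>_def)
      moreover have "\<exists>T'\<in>\<C>. T' \<noteq> T \<and> e edge_of T'" if T: "T \<in> \<C>" "e edge_of T" "z \<in> e" for T e
      proof -
        have eE: "e \<in> E T" using T(2,3) by (simp add: E_def)
        obtain T' where T': "T' \<in> M" "e edge_of T'" "T' \<noteq> T" using False T(1) eE by blast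
        have Ts: "T \<in> star z" "P e" using T(1) eE by (auto simp: \<C>_def)
        have "T' \<in> star z" using T'(1) ext[OF T'(2) ext'[OF Ts(1) eE]] by (simp add: star_def)
        then have "T' \<in> \<C>" using same[of T' e] T'(2) T(3) Ts(2) by (simp add: E_def)
        then show ?thesis using T' by blast
      qed
      ultimately obtain \<epsilon> where \<epsilon>: "\<epsilon> > 0" "ball z \<epsilon> \<subseteq> \<Union>\<C>"
        using star_covers_ball[of \<C> z] T0C by blast
      have CM: "T \<in> M" if "T \<in> \<C>" for T using that by (auto simp: \<C>_def star_def)
      have "ball z \<epsilon> \<subseteq> closure \<Omega>" using \<epsilon>(2) CM Union_mesh by blast
      then have "z \<in> interior (closure \<Omega>)" using \<epsilon>(1) mem_interior by blast
      then have "z \<in> \<Omega>" by (simp add: interior_closure_domain)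
      then obtain e1 where e1: "e1 \<in> edges M" "z extreme_point_of e1" "V = val e1" using Vi by blast
      obtain T1 where T1: "T1 \<in> M" "e1 edge_of T1" using e1(1) unfolding edges_def by blast
      have z1: "z extreme_point_of T1" using ext[OF T1(2) e1(2)] .
      obtain b c where bc: "T1 = convex hull {z, b, c}" "cross (b - z) (c - z) \<noteq> 0"
        using triangle_at_vertex[OF simplex[OF T1(1)] z1] by blast
      \<comment> \<open>The family fills a neighbourhood of \<open>z\<close>, and \<open>T1\<close> can overlap it only if it is a
          member.\<close>
      have "T1 \<in> \<C>"
      proof (rule ccontr)
        assume "T1 \<notin> \<C>"
        then have "negligible (\<Union>T\<in>\<C>. T1 \<inter> T)"
          using CM T1(1) finite_mesh finite_subset[of \<C> M]
          by (intro negligible_Union finite_imageI) (auto intro!: negligible_overlap)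
        let ?I = "open_triangle z b c"
        have "open (?I \<inter> ball z \<epsilon>)" using open_triangle_open by blast
        moreover have "?I \<inter> ball z \<epsilon> \<noteq> {}"
        proof -
          define w where "w = (b - z) + (c - z)"
          define s where "s = min (1/4) (\<epsilon> / (2 * (norm w + 1)))"
          have pos: "norm w + 1 > 0" by (simp add: add_nonneg_pos)
          have s: "0 < s" "s \<le> 1/4"
            using \<epsilon>(1) pos unfolding s_def by (simp, intro min.cobounded1)
          have "s * norm w \<le> (\<epsilon> / (2 * (norm w + 1))) * norm w"
            by (intro mult_right_mono) (auto simp: s_def)
          also have "\<dots> < \<epsilon>" using \<epsilon>(1) pos by (simp add: field_simps) (smt (verit) mult_nonneg_nonneg norm_ge_zero)
          finally have sw: "s * norm w < \<epsilon>" .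
          define x where "x = z + s *\<^sub>R w"
          have "x \<in> ball z \<epsilon>" using sw s(1) by (simp add: x_def dist_norm)
          moreover have x: "x = (1 - 2 * s) *\<^sub>R z + s *\<^sub>R b + s *\<^sub>R c"
            by (simp add: x_def w_def vec_eq_iff algebra_simps)
          have "bary z b c x = 1 - 2 * s" using bary_combination[OF bc(2) x] by simp
          moreover have "bary b c z x = s"
          proof (rule bary_combination[OF cross_cyclic(1)[OF bc(2)]])
            show "x = s *\<^sub>R b + s *\<^sub>R c + (1 - 2 * s) *\<^sub>R z" unfolding x by (simp add: add_ac)
          qed simp
          moreover have "bary c z b x = s"
          proof (rule bary_combination[OF cross_cyclic(2)[OF bc(2)]])
            show "x = s *\<^sub>R c + (1 - 2 * s) *\<^sub>R z + s *\<^sub>R b" unfolding x by (simp add: add_ac)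
          qed simp
          ultimately show ?thesis using s by force
        qed
        moreover have "?I \<inter> ball z \<epsilon> \<subseteq> (\<Union>T\<in>\<C>. T1 \<inter> T)"
        proof -
          have "?I \<subseteq> T1" unfolding bc(1) triangle_eq_bary[OF bc(2)] by auto
          then show ?thesis using \<epsilon>(2) by blast
        qed
        ultimately show False
          using \<open>negligible (\<Union>T\<in>\<C>. T1 \<inter> T)\<close> negligible_subset open_not_negligible by blast
      qed
      moreover have "e1 \<in> E T1" using T1(2) e1(2) unfolding E_def extreme_point_of_def by blast
      ultimately have "P e1" by (simp add: \<C>_def)
      then show False using t e1(3) unfolding P_def A_def B_def by auto
    qed
  qed
  have AB: "A \<le> B" by (simp add: A_def B_def)
  have "\<bar>val e0 - V\<bar> = B - A" by (simp add: A_def B_def)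
  also have "\<dots> = measure lebesgue {A<..<B}" using AB by simp
  also have "\<dots> \<le> measure lebesgue (\<Union>T\<in>star z. {lo T..hi T})"
    using cover fin by (intro measure_mono_fmeasurable fmeasurable.finite_UN) auto
  also have "\<dots> \<le> (\<Sum>T\<in>star z. measure lebesgue {lo T..hi T})"
    using fin by (intro measure_UNION_le) auto
  also have "\<dots> \<le> (\<Sum>T\<in>star z. \<delta> T)"
    using width le by (intro sum_mono) auto
  finally show ?thesis .
qed

end

section \<open>Quasi-interpolation on shape-regular meshes\<close>

text \<open>
  Shape regularity with its constant made explicit, as all constants below are functions of \<open>\<kappa>\<close>.
\<close>

locale shape_regular_mesh = triangulated_domain +
  fixes \<kappa> :: real
  assumes \<kappa>_pos: "\<kappa> > 0" and inscribed_ball: "T \<in> M \<Longrightarrow> \<exists>x. ball x (\<kappa> * diameter T) \<subseteq> T"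
begin

lemma dist_le_diameter:
  assumes "T \<in> M" "x \<in> T" "y \<in> T"
  shows "dist x y \<le> diameter T"
  using diameter_bounded_bound compact_imp_bounded triangle_topology(1)[OF assms(1)] assms by blast

lemma diameter_pos: "T \<in> M \<Longrightarrow> diameter T > 0"
proof -
  assume T: "T \<in> M"
  then obtain a b c where abc: "T = convex hull {a, b, c}" "cross (b - a) (c - a) \<noteq> 0"
    using simplex unfolding simplex_2_iff by blast
  have "a \<in> T" "b \<in> T" unfolding abc(1) by (auto intro: hull_inc)
  then have "dist a b \<le> diameter T" by (rule dist_le_diameter[OF T])
  moreover have "a \<noteq> b" using abc(2) by auto
  ultimately show ?thesis by (metis dist_pos_lt less_le_trans)
qed

lemma measure_triangle_ge:
  assumes "T \<in> M"
  shows "pi * \<kappa>\<^sup>2 * (diameter T)\<^sup>2 \<le> measure lebesgue T"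
proof -
  obtain x where x: "ball x (\<kappa> * diameter T) \<subseteq> T" using inscribed_ball[OF assms] by blast
  have "pi * \<kappa>\<^sup>2 * (diameter T)\<^sup>2 = measure lebesgue (ball x (\<kappa> * diameter T))"
    using circle_area[of "\<kappa> * diameter T" x] \<kappa>_pos diameter_pos[OF assms]
    by (simp add: power_mult_distrib)
  also have "\<dots> \<le> measure lebesgue T"
    using x triangle_topology(4)[OF assms] by (intro measure_mono_fmeasurable) auto
  finally show ?thesis .
qed

lemma measure_triangle_le:
  assumes "T \<in> M"
  shows "measure lebesgue T \<le> 4 * (diameter T)\<^sup>2"
proof -
  obtain x where x: "x \<in> T" using triangle_topology(8)[OF assms] by blast
  have "measure lebesgue T \<le> measure lebesgue (cball x (diameter T))"
    using dist_le_diameter[OF assms x] triangle_topology(5)[OF assms] by (intro measure_mono_fmeasurable) auto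
  also have "\<dots> = (diameter T)\<^sup>2 * pi"
    using diameter_pos[OF assms] by (simp add: content_cball unit_ball_vol_2)
  also have "\<dots> \<le> (diameter T)\<^sup>2 * 4"
    using pi_less_4 by (intro mult_left_mono) auto
  finally show ?thesis by simp
qed

lemma finite_star: "finite (star z)"
  using finite_mesh by (simp add: star_def)

text \<open>
  Shrinking each triangle towards \<open>z\<close> to the diameter \<open>r\<close> of the smallest one yields essentially
  disjoint triangles of area at least \<open>pi (\<kappa> r)^2\<close> inside the disc of radius \<open>r\<close>.
\<close>

lemma card_star_le: "real (card (star z)) \<le> 1 / \<kappa>\<^sup>2"
proof (cases "star z = {}")
  case False
  have "\<exists>b c. T = convex hull {z, b, c} \<and> cross (b - z) (c - z) \<noteq> 0" if "T \<in> star z" for T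
    using triangle_at_vertex[of T z] simplex that unfolding star_def by blast
  then obtain b c where bc: "\<And>T. T \<in> star z \<Longrightarrow> T = convex hull {z, b T, c T} \<and> cross (b T - z) (c T - z) \<noteq> 0"
    by metis
  have TM: "T \<in> M" if "T \<in> star z" for T using that by (simp add: star_def)
  define r where "r = Min (diameter ` star z)"
  have r: "r > 0" using finite_star False diameter_pos TM unfolding r_def by (subst Min_gr_iff) auto
  have rd: "r \<le> diameter T" if "T \<in> star z" for T using finite_star that unfolding r_def by simp
  define s where "s T = r / diameter T" for T :: "plane set"
  have s: "0 < s T" "s T \<le> 1" "s T * diameter T = r" if "T \<in> star z" for T
    using r rd[OF that] diameter_pos[OF TM[OF that]] by (auto simp: s_def)
  define T' where "T' T = convex hull {z, z + s T *\<^sub>R (b T - z), z + s T *\<^sub>R (c T - z)}" for T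
  have vert: "z \<in> T" "b T \<in> T" "c T \<in> T" if "T \<in> star z" for T
    using bc[OF that] hull_inc by (metis insertI1 insertI2)+
  have scaled: "z + s T *\<^sub>R (x - z) \<in> T" "z + s T *\<^sub>R (x - z) \<in> cball z r" if T: "T \<in> star z" and x: "x \<in> T" for T x
  proof -
    have "z + s T *\<^sub>R (x - z) = (1 - s T) *\<^sub>R z + s T *\<^sub>R x" by (simp add: algebra_simps)
    then show "z + s T *\<^sub>R (x - z) \<in> T"
      using s[OF T] vert(1)[OF T] x triangle_topology(2)[OF TM[OF T]] unfolding convex_alt by auto
    have "s T * dist z x \<le> s T * diameter T"
      using s(1)[OF T] dist_le_diameter[OF TM[OF T] vert(1)[OF T] x] by (intro mult_left_mono) auto
    then show "z + s T *\<^sub>R (x - z) \<in> cball z r"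
      using s[OF T] by (simp add: dist_norm norm_minus_commute)
  qed
  have sub: "T' T \<subseteq> T" "T' T \<subseteq> cball z r" if T: "T \<in> star z" for T
  proof -
    have "{z, z + s T *\<^sub>R (b T - z), z + s T *\<^sub>R (c T - z)} \<subseteq> T \<inter> cball z r"
      using scaled[OF T vert(2)[OF T]] scaled[OF T vert(3)[OF T]] vert(1)[OF T] r by simp
    moreover have "convex (T \<inter> cball z r)"
      by (intro convex_Int convex_cball triangle_topology(2) TM T)
    ultimately have "T' T \<subseteq> T \<inter> cball z r"
      unfolding T'_def by (rule hull_minimal)
    then show "T' T \<subseteq> T" "T' T \<subseteq> cball z r" by blast+
  qed
  have comp: "compact (T' T)" for T unfolding T'_def by (rule compact_triangle)
  have Tm: "T' T \<in> sets lebesgue" for T 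
    by (rule fmeasurableD[OF lmeasurable_compact[OF comp]])
  have meas: "measure lebesgue (T' T) \<ge> pi * \<kappa>\<^sup>2 * r\<^sup>2" if T: "T \<in> star z" for T
  proof -
    have "cross (s T *\<^sub>R (b T - z)) (s T *\<^sub>R (c T - z)) = (s T)\<^sup>2 * cross (b T - z) (c T - z)"
      by (simp add: cross_def power2_eq_square algebra_simps)
    then have "measure lebesgue (T' T) = (s T)\<^sup>2 * measure lebesgue (convex hull {z, b T, c T})"
      unfolding T'_def measure_triangle by (simp add: abs_mult)
    also have "convex hull {z, b T, c T} = T" using bc[OF T] by simp
    also have "(s T)\<^sup>2 * measure lebesgue T \<ge> (s T)\<^sup>2 * (pi * \<kappa>\<^sup>2 * (diameter T)\<^sup>2)"
      using measure_triangle_ge[OF TM[OF T]] by (intro mult_left_mono) auto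
    moreover have "(s T)\<^sup>2 * (pi * \<kappa>\<^sup>2 * (diameter T)\<^sup>2) = pi * \<kappa>\<^sup>2 * r\<^sup>2"
      unfolding s(3)[OF T, symmetric] by (simp add: power_mult_distrib)
    ultimately show ?thesis by simp
  qed
  have "real (card (star z)) * (pi * \<kappa>\<^sup>2 * r\<^sup>2) \<le> (\<Sum>T\<in>star z. measure lebesgue (T' T))"
    using sum_mono[of "star z" "\<lambda>T. pi * \<kappa>\<^sup>2 * r\<^sup>2" "\<lambda>T. measure lebesgue (T' T)"] meas by simp
  also have "\<dots> = measure lebesgue (\<Union>(T' ` star z))"
  proof (rule measure_negligible_finite_Union_image[symmetric])
    show "pairwise (\<lambda>x y. negligible (T' x \<inter> T' y)) (star z)"
      unfolding pairwise_def
    proof (intro ballI impI)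
      fix T U assume TU: "T \<in> star z" "U \<in> star z" "T \<noteq> U"
      show "negligible (T' T \<inter> T' U)"
        by (rule negligible_subset[OF negligible_overlap[OF TM[OF TU(1)] TM[OF TU(2)] TU(3)]])
           (use sub(1)[OF TU(1)] sub(1)[OF TU(2)] in blast)
    qed
    show "T' T \<in> lmeasurable" for T by (rule lmeasurable_compact[OF comp])
  qed (rule finite_star)
  also have "\<dots> \<le> measure lebesgue (cball z r)"
  proof (rule measure_mono_fmeasurable)
    show "\<Union> (T' ` star z) \<subseteq> cball z r" using sub(2) by blast
    show "\<Union> (T' ` star z) \<in> sets lebesgue" by (rule sets.finite_UN[OF finite_star Tm])
  qed simp
  also have "\<dots> = r\<^sup>2 * pi" using r by (simp add: content_cball unit_ball_vol_2)
  finally have "(real (card (star z)) * \<kappa>\<^sup>2) * (pi * r\<^sup>2) \<le> 1 * (pi * r\<^sup>2)" by (simp add: algebra_simps)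
  moreover have "pi * r\<^sup>2 > 0" using r by simp
  ultimately have "real (card (star z)) * \<kappa>\<^sup>2 \<le> 1" by (rule mult_right_le_imp_le)
  then show ?thesis using \<kappa>_pos by (simp add: field_simps)
qed simp

end

context triangulated_domain
begin

text \<open>
  The affine function on \<open>T\<close> with the values \<open>V\<close> at the vertices. Chosen separately on each
  triangle, these functions agree on common edges, where two values determine them.
\<close>

definition interpolant :: "(plane \<Rightarrow> real) \<Rightarrow> piecewise" where
  "interpolant V T = (SOME l. (\<exists>c p. \<forall>x. l x = c + p \<bullet> x) \<and> (\<forall>z. z extreme_point_of T \<longrightarrow> l z = V z))"

lemma interpolant:
  assumes "T \<in> M"
  shows "\<exists>c p. \<forall>x. interpolant V T x = c + p \<bullet> x" "z extreme_point_of T \<Longrightarrow> interpolant V T z = V z"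
proof -
  obtain a b c where abc: "T = convex hull {a, b, c}" "cross (b - a) (c - a) \<noteq> 0"
    using simplex[OF assms] unfolding simplex_2_iff by blast
  obtain qa da where a: "\<And>x. bary a b c x = qa \<bullet> x + da" using bary_affine by blast
  obtain qb db where b: "\<And>x. bary b c a x = qb \<bullet> x + db" using bary_affine by blast
  obtain qc dc where c: "\<And>x. bary c a b x = qc \<bullet> x + dc" using bary_affine by blast
  let ?l = "\<lambda>x. V a * bary a b c x + V b * bary b c a x + V c * bary c a b x"
  have "?l x = (V a * da + V b * db + V c * dc) + (V a *\<^sub>R qa + V b *\<^sub>R qb + V c *\<^sub>R qc) \<bullet> x" for x
    unfolding a b c by (simp add: inner_add_left algebra_simps)
  then have 1: "\<exists>c p. \<forall>x. ?l x = c + p \<bullet> x" by blast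
  have 2: "?l z = V z" if "z extreme_point_of T" for z
    using that bary_at[OF abc(2)] bary_at[OF cross_cyclic(1)[OF abc(2)]] bary_at[OF cross_cyclic(2)[OF abc(2)]]
    unfolding abc(1) extreme_point_of_triangle[OF abc(2)] by auto
  from someI[of "\<lambda>l. (\<exists>c p. \<forall>x. l x = c + p \<bullet> x) \<and> (\<forall>z. z extreme_point_of T \<longrightarrow> l z = V z)" ?l] 1 2
  show "\<exists>c p. \<forall>x. interpolant V T x = c + p \<bullet> x" "z extreme_point_of T \<Longrightarrow> interpolant V T z = V z"
    unfolding interpolant_def by auto
qed

lemma interpolant_continuous: "T \<in> M \<Longrightarrow> continuous_on UNIV (interpolant V T)"
proof -
  assume "T \<in> M"
  then obtain c p where "\<And>x. interpolant V T x = c + p \<bullet> x" using interpolant(1) by blast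
  then have "interpolant V T = (\<lambda>x. c + p \<bullet> x)" by auto
  then show ?thesis by (auto intro!: continuous_intros)
qed

lemma interpolant_combination:
  assumes "T \<in> M" "x = s *\<^sub>R a + t *\<^sub>R b + r *\<^sub>R d" "s + t + r = 1"
  shows "interpolant V T x = s * interpolant V T a + t * interpolant V T b + r * interpolant V T d"
proof -
  obtain c p where l: "\<And>x. interpolant V T x = c + p \<bullet> x" using interpolant(1)[OF assms(1)] by blast
  have "interpolant V T x = (s + t + r) * c + p \<bullet> x" unfolding l assms(3) by simp
  then show ?thesis unfolding assms(2) l by (simp add: inner_add_right algebra_simps)
qed

lemma interpolant_on_edge:
  assumes "T \<in> M" "closed_segment a b edge_of T"
  shows "interpolant V T ((1 - t) *\<^sub>R a + t *\<^sub>R b) = (1 - t) * V a + t * V b"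
proof -
  obtain c where T: "T = convex hull {a, b, c}" "cross (b - a) (c - a) \<noteq> 0"
    using triangle_at_edge[OF simplex[OF assms(1)] assms(2)] by blast
  have "interpolant V T a = V a" "interpolant V T b = V b"
    using interpolant(2)[OF assms(1)] unfolding T(1) extreme_point_of_triangle[OF T(2)] by auto
  then show ?thesis
    using interpolant_combination[OF assms(1), of "(1 - t) *\<^sub>R a + t *\<^sub>R b" "1 - t" a t b 0 0 V] by simp
qed

lemma sum_vertices_swap:
  "\<exists>Z. finite Z \<and> (\<forall>g. (\<Sum>T\<in>M. \<Sum>z | z extreme_point_of T. g T z) = (\<Sum>z\<in>Z. \<Sum>T\<in>star z. (g T z :: real)))"
proof -
  define Z where "Z = (\<Union>T\<in>M. {z. z extreme_point_of T})"
  have fin: "finite {z. z extreme_point_of T}" if "T \<in> M" for T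
    using simplex[OF that] vertices_of_triangle(1) unfolding simplex_2_iff by auto
  then have Z: "finite Z" unfolding Z_def using finite_mesh by blast
  have "(\<Sum>T\<in>M. \<Sum>z | z extreme_point_of T. g T z) = (\<Sum>z\<in>Z. \<Sum>T\<in>star z. g T z)" for g :: "plane set \<Rightarrow> plane \<Rightarrow> real"
  proof -
    have "(\<Sum>T\<in>M. \<Sum>z | z extreme_point_of T. g T z) = (\<Sum>T\<in>M. \<Sum>z | z \<in> Z \<and> z extreme_point_of T. g T z)"
      by (intro sum.cong refl) (auto simp: Z_def)
    also have "\<dots> = (\<Sum>z\<in>Z. \<Sum>T | T \<in> M \<and> z extreme_point_of T. g T z)"
      by (rule sum.swap_restrict[OF finite_mesh Z])
    finally show ?thesis by (simp add: star_def)
  qed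
  with Z show ?thesis by blast
qed

end

context shape_regular_mesh
begin

text \<open>
  The nodal values of the Scott--Zhang quasi-interpolant: point values would not be bounded by
  the \<open>H1\<close> norm, and the value zero on the boundary preserves the boundary condition.
\<close>

definition node_value :: "(plane \<Rightarrow> real) \<Rightarrow> plane \<Rightarrow> real" where
  "node_value \<phi> z = (if z \<in> frontier \<Omega> then 0 else edge_mean \<phi> (SOME e. e \<in> edges M \<and> z extreme_point_of e))"

text \<open>
  The factor in \<open>seg_mean_diff_le\<close> is bounded because the area of \<open>T\<close> is comparable to the
  square of its diameter.
\<close>

lemma edge_mean_oscillation:
  assumes \<phi>: "C_k 1 \<phi>" and T: "T \<in> M" and e: "e edge_of T" "e' edge_of T"
  shows "\<bar>edge_mean \<phi> e - edge_mean \<phi> e'\<bar> \<le> sqrt (energy \<phi> T) / \<kappa>"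
proof -
  note cont = C_k_1_classical_grad(3)[OF \<phi>]
  have main: "\<bar>seg_mean b c \<phi> - seg_mean a c \<phi>\<bar> \<le> sqrt (energy \<phi> T) / \<kappa>"
    if abc: "T = convex hull {a, b, c}" "cross (b - a) (c - a) \<noteq> 0" for a b c
  proof -
    let ?D = "\<bar>cross (b - a) (c - a)\<bar>"
    have D: "?D > 0" using abc(2) by simp
    have "dist a b \<le> diameter T"
      by (rule dist_le_diameter[OF T]) (auto simp: abc(1) intro: hull_inc)
    then have "\<kappa>\<^sup>2 * (dist a b)\<^sup>2 \<le> \<kappa>\<^sup>2 * (diameter T)\<^sup>2"
      by (intro mult_left_mono power_mono) auto
    also have "\<dots> \<le> pi * (\<kappa>\<^sup>2 * (diameter T)\<^sup>2)"
      using pi_ge_two by (intro mult_right_mono[of 1 pi, simplified]) auto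
    also have "\<dots> \<le> ?D / 2"
      using measure_triangle_ge[OF T] unfolding abc(1) measure_triangle by (simp add: mult.assoc)
    finally have "\<kappa>\<^sup>2 * (dist a b)\<^sup>2 \<le> 2 * ?D" using D by linarith
    then have ratio: "(dist a b)\<^sup>2 / (2 * ?D) \<le> 1 / \<kappa>\<^sup>2"
      using D \<kappa>_pos by (simp add: field_simps)
    have "(seg_mean b c \<phi> - seg_mean a c \<phi>)\<^sup>2 \<le> (dist a b)\<^sup>2 / (2 * ?D) * energy \<phi> T"
      using seg_mean_diff_le[OF \<phi> abc(2)] unfolding energy_def abc(1) .
    also have "\<dots> \<le> 1 / \<kappa>\<^sup>2 * energy \<phi> T"
      by (rule mult_right_mono[OF ratio energy_nonneg])
    also have "\<dots> = (sqrt (energy \<phi> T) / \<kappa>)\<^sup>2"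
      using energy_nonneg by (simp add: power_divide)
    finally show ?thesis
      using energy_nonneg \<kappa>_pos by (simp add: abs_le_square_iff[symmetric])
  qed
  obtain a b c where abc: "T = convex hull {a, b, c}" "cross (b - a) (c - a) \<noteq> 0"
    using simplex[OF T] unfolding simplex_2_iff by blast
  have ne: "a \<noteq> b" "b \<noteq> c" "c \<noteq> a" using abc(2) unfolding cross_nonzero_iff by auto
  note em = edge_mean_segment[OF cont]
  have "\<bar>seg_mean b c \<phi> - seg_mean c a \<phi>\<bar> \<le> sqrt (energy \<phi> T) / \<kappa>"
    using main[OF abc] seg_mean_commute[of c a] by simp
  moreover have "\<bar>seg_mean c a \<phi> - seg_mean a b \<phi>\<bar> \<le> sqrt (energy \<phi> T) / \<kappa>"
    using main[of b c a] abc cross_cyclic[OF abc(2)] seg_mean_commute[of b a] by (simp add: triangle_rotate)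
  moreover have "\<bar>seg_mean a b \<phi> - seg_mean b c \<phi>\<bar> \<le> sqrt (energy \<phi> T) / \<kappa>"
    using main[of c a b] abc cross_cyclic[OF abc(2)] seg_mean_commute[of c b] by (simp add: triangle_rotate)
  moreover have "0 \<le> sqrt (energy \<phi> T) / \<kappa>" using energy_nonneg \<kappa>_pos by simp
  ultimately show ?thesis
    using e unfolding abc(1) edge_of_triangle[OF abc(2)]
    by (elim disjE) (simp_all only: em[OF ne(1)] em[OF ne(2)] em[OF ne(3)] abs_minus_commute diff_self abs_zero abc(1)[symmetric])
qed

text \<open>
  The divisor \<open>\<kappa> ^ 4\<close> combines \<open>\<kappa>\<^sup>2\<close> from the comparison of edge means in one triangle and \<open>\<kappa>\<^sup>2\<close>
  from the number of triangles at \<open>z\<close>.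
\<close>

definition patch_energy :: "(plane \<Rightarrow> real) \<Rightarrow> plane \<Rightarrow> real" where
  "patch_energy \<phi> z = (\<Sum>T\<in>star z. energy \<phi> T) / \<kappa> ^ 4"

lemma patch_energy_nonneg: "patch_energy \<phi> z \<ge> 0"
  unfolding patch_energy_def by (intro divide_nonneg_nonneg sum_nonneg energy_nonneg) auto

text \<open>
  Edge means are values to which \<open>nodal_oscillation\<close> applies; means over boundary edges vanish
  with \<open>\<phi>\<close>.
\<close>

lemma node_value_close:
  assumes \<phi>: "C_k 1 \<phi>" and zero: "\<And>x. x \<in> frontier \<Omega> \<Longrightarrow> \<phi> x = 0"
    and e: "e \<in> edges M" "z extreme_point_of e"
  shows "(edge_mean \<phi> e - node_value \<phi> z)\<^sup>2 \<le> patch_energy \<phi> z"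
proof -
  note cont = C_k_1_classical_grad(3)[OF \<phi>]
  let ?\<delta> = "\<lambda>T. sqrt (energy \<phi> T) / \<kappa>"
  have "\<bar>edge_mean \<phi> e - node_value \<phi> z\<bar> \<le> (\<Sum>T\<in>star z. ?\<delta> T)"
  proof (rule nodal_oscillation[OF edge_mean_oscillation[OF \<phi>] _ e])
    show "edge_mean \<phi> e = 0" if e: "e \<in> edges M" "e \<subseteq> frontier \<Omega>" for e
    proof -
      obtain a b where ab: "e = closed_segment a b" "a \<noteq> b" using edgeE[OF e(1)] by blast
      have "seg_mean a b \<phi> = integral {0..1} (\<lambda>t::real. 0)"
        unfolding seg_mean_def
      proof (rule Henstock_Kurzweil_Integration.integral_cong)
        fix t :: real assume "t \<in> {0..1}"
        then have "(1 - t) *\<^sub>R a + t *\<^sub>R b \<in> e" unfolding ab(1) in_segment by auto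
        then show "\<phi> ((1 - t) *\<^sub>R a + t *\<^sub>R b) = 0" using zero e(2) by blast
      qed
      then show ?thesis using edge_mean_segment[OF cont ab(2)] ab(1) by simp
    qed
    show "node_value \<phi> z = 0" if "z \<in> frontier \<Omega>" using that by (simp add: node_value_def)
    show "\<exists>e\<in>edges M. z extreme_point_of e \<and> node_value \<phi> z = edge_mean \<phi> e" if "z \<in> \<Omega>"
    proof -
      have "z \<notin> frontier \<Omega>" using that domain(1) by (simp add: frontier_def interior_open)
      then show ?thesis
        using someI[of "\<lambda>e. e \<in> edges M \<and> z extreme_point_of e" e] e unfolding node_value_def by auto
    qed
  qed
  then have "(edge_mean \<phi> e - node_value \<phi> z)\<^sup>2 \<le> (\<Sum>T\<in>star z. ?\<delta> T)\<^sup>2"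
    by (metis abs_ge_zero power2_abs power_mono)
  also have "\<dots> \<le> real (card (star z)) * (\<Sum>T\<in>star z. (?\<delta> T)\<^sup>2)"
    using Cauchy_Schwarz_ineq_sum[of "\<lambda>_. 1" ?\<delta> "star z"] by simp
  also have "\<dots> \<le> (1 / \<kappa>\<^sup>2) * (\<Sum>T\<in>star z. (?\<delta> T)\<^sup>2)"
    by (intro mult_right_mono card_star_le sum_nonneg) auto
  also have "\<dots> = patch_energy \<phi> z"
    using \<kappa>_pos energy_nonneg
    by (simp add: patch_energy_def power_divide sum_divide_distrib[symmetric] power4_eq_xxxx power2_eq_square)
  finally show ?thesis .
qed

abbreviation vertex_energy :: "(plane \<Rightarrow> real) \<Rightarrow> plane set \<Rightarrow> real" where
  "vertex_energy \<phi> T \<equiv> (\<Sum>z | z extreme_point_of T. patch_energy \<phi> z)"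

text \<open>
  The energy of a triangle is counted once for each of its three vertices and each triangle at
  that vertex.
\<close>

lemma sum_vertex_energy_le: "(\<Sum>T\<in>M. vertex_energy \<phi> T) \<le> 3 / \<kappa> ^ 6 * (\<Sum>T\<in>M. energy \<phi> T)"
proof -
  obtain Z where Z: "finite Z"
    "\<And>g. (\<Sum>T\<in>M. \<Sum>z | z extreme_point_of T. g T z) = (\<Sum>z\<in>Z. \<Sum>T\<in>star z. (g T z :: real))"
    using sum_vertices_swap by blast
  have "(\<Sum>T\<in>M. vertex_energy \<phi> T) = (\<Sum>z\<in>Z. real (card (star z)) * patch_energy \<phi> z)"
    unfolding Z(2) by simp
  also have "\<dots> \<le> (\<Sum>z\<in>Z. (1 / \<kappa>\<^sup>2) * patch_energy \<phi> z)"
    by (intro sum_mono mult_right_mono card_star_le patch_energy_nonneg)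
  also have "\<dots> = (1 / \<kappa> ^ 6) * (\<Sum>z\<in>Z. \<Sum>T\<in>star z. energy \<phi> T)"
    by (simp add: patch_energy_def sum_distrib_left sum_divide_distrib power_add[symmetric])
  also have "\<dots> = (1 / \<kappa> ^ 6) * (\<Sum>T\<in>M. \<Sum>z | z extreme_point_of T. energy \<phi> T)"
    unfolding Z(2) ..
  also have "(\<Sum>T\<in>M. \<Sum>z | z extreme_point_of T. energy \<phi> T) = (\<Sum>T\<in>M. 3 * energy \<phi> T)"
  proof (rule sum.cong)
    fix T assume "T \<in> M"
    then obtain a b c where abc: "T = convex hull {a, b, c}" "cross (b - a) (c - a) \<noteq> 0"
      using simplex unfolding simplex_2_iff by blast
    show "(\<Sum>z | z extreme_point_of T. energy \<phi> T) = 3 * energy \<phi> T"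
      using vertices_of_triangle[OF abc(2)] unfolding abc(1) by simp
  qed simp
  finally show ?thesis by (simp add: sum_distrib_left)
qed

text \<open>
  Both \<open>\<phi>\<close> and its interpolant are compared with the mean of \<open>\<phi>\<close> over one edge: \<open>\<phi>\<close> by the
  Poincare inequality, the interpolant because its three nodal values are close to that mean.
\<close>

lemma interpolation_error:
  assumes \<phi>: "C_k 1 \<phi>" and zero: "\<And>x. x \<in> frontier \<Omega> \<Longrightarrow> \<phi> x = 0" and T: "T \<in> M"
  shows "(LINT x|lebesgue_on T. (\<phi> x - interpolant (node_value \<phi>) T x)\<^sup>2)
    \<le> (diameter T)\<^sup>2 * ((16 + 16 / \<kappa>\<^sup>2) * energy \<phi> T + 16 * vertex_energy \<phi> T)"
proof -
  note cont = C_k_1_classical_grad(3)[OF \<phi>]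
  let ?V = "node_value \<phi>" and ?l = "interpolant (node_value \<phi>) T" and ?d = "diameter T"
  let ?S = "energy \<phi> T" and ?R = "patch_energy \<phi>"
  obtain a b c where abc: "T = convex hull {a, b, c}" "cross (b - a) (c - a) \<noteq> 0"
    using simplex[OF T] unfolding simplex_2_iff by blast
  have ne: "a \<noteq> b" "b \<noteq> c" "c \<noteq> a" using abc(2) unfolding cross_nonzero_iff by auto
  have vert: "vertex_energy \<phi> T = ?R a + ?R b + ?R c"
    unfolding abc(1) vertices_of_triangle[OF abc(2)] using ne by simp
  have edge: "closed_segment a b edge_of T" "closed_segment b c edge_of T"
    unfolding abc(1) edge_of_triangle[OF abc(2)] by auto
  have inE: "closed_segment a b \<in> edges M" "closed_segment b c \<in> edges M"
    using edge T unfolding edges_def by auto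
  have ext: "a extreme_point_of closed_segment a b" "b extreme_point_of closed_segment b c" "c extreme_point_of closed_segment b c"
    by (simp_all add: extreme_point_of_segment)
  let ?m = "seg_mean b c \<phi>"
  have m: "edge_mean \<phi> (closed_segment b c) = ?m" "edge_mean \<phi> (closed_segment a b) = seg_mean a b \<phi>"
    using edge_mean_segment[OF cont] ne by auto
  have sq2: "(p + q)\<^sup>2 \<le> 2 * p\<^sup>2 + 2 * q\<^sup>2" for p q :: real
    using zero_le_power2[of "p - q"] by (simp add: power2_eq_square algebra_simps)
  have b: "(?V b - ?m)\<^sup>2 \<le> ?R b" and c: "(?V c - ?m)\<^sup>2 \<le> ?R c"
    using node_value_close[OF \<phi> zero inE(2) ext(2)] node_value_close[OF \<phi> zero inE(2) ext(3)]
    unfolding m by (simp_all add: power2_commute)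
  have "(seg_mean a b \<phi> - ?m)\<^sup>2 \<le> (sqrt ?S / \<kappa>)\<^sup>2"
    using edge_mean_oscillation[OF \<phi> T edge] unfolding m by (metis abs_ge_zero power2_abs power_mono)
  then have osc: "(seg_mean a b \<phi> - ?m)\<^sup>2 \<le> ?S / \<kappa>\<^sup>2"
    using energy_nonneg by (simp add: power_divide)
  have "(?V a - seg_mean a b \<phi>)\<^sup>2 \<le> ?R a"
    using node_value_close[OF \<phi> zero inE(1) ext(1)] unfolding m by (simp add: power2_commute)
  then have a: "(?V a - ?m)\<^sup>2 \<le> 2 * ?R a + 2 * (?S / \<kappa>\<^sup>2)"
    using sq2[of "?V a - seg_mean a b \<phi>" "seg_mean a b \<phi> - ?m"] osc by simp
  let ?K = "2 * (?S / \<kappa>\<^sup>2) + 2 * vertex_energy \<phi> T"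
  have lm: "(?l x - ?m)\<^sup>2 \<le> ?K" if x: "x \<in> T" for x
  proof -
    obtain s t r where str: "0 \<le> s" "0 \<le> t" "0 \<le> r" "s + t + r = 1" "x = s *\<^sub>R a + t *\<^sub>R b + r *\<^sub>R c"
      using x unfolding abc(1) convex_hull_3 by blast
    have "?l a = ?V a" "?l b = ?V b" "?l c = ?V c"
      using interpolant(2)[OF T] unfolding abc(1) extreme_point_of_triangle[OF abc(2)] by auto
    then have "?l x = s * ?V a + t * ?V b + r * ?V c"
      using interpolant_combination[OF T str(5,4)] by simp
    also have "\<dots> - ?m = s * (?V a - ?m) + t * (?V b - ?m) + r * (?V c - ?m)"
      using str(4) by (simp add: algebra_simps) (metis distrib_right mult_1)
    also have "\<dots>\<^sup>2 \<le> s * (?V a - ?m)\<^sup>2 + t * (?V b - ?m)\<^sup>2 + r * (?V c - ?m)\<^sup>2"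
    proof -
      have "(s * p + t * q + r * w)\<^sup>2 \<le> s * p\<^sup>2 + t * q\<^sup>2 + r * w\<^sup>2" for p q w :: real
      proof -
        have s: "s = 1 - t - r" using str(4) by simp
        have "s * p\<^sup>2 + t * q\<^sup>2 + r * w\<^sup>2 - (s * p + t * q + r * w)\<^sup>2
            = s * t * (p - q)\<^sup>2 + s * r * (p - w)\<^sup>2 + t * r * (q - w)\<^sup>2"
          unfolding s by (simp add: power2_eq_square algebra_simps)
        moreover have "\<dots> \<ge> 0" using str by (intro add_nonneg_nonneg mult_nonneg_nonneg) auto
        ultimately show ?thesis by linarith
      qed
      then show ?thesis .
    qed
    also have "\<dots> \<le> 1 * (?V a - ?m)\<^sup>2 + 1 * (?V b - ?m)\<^sup>2 + 1 * (?V c - ?m)\<^sup>2"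
      using str by (intro add_mono mult_right_mono) auto
    also have "\<dots> \<le> ?K"
      using a b c patch_energy_nonneg[of \<phi> b] patch_energy_nonneg[of \<phi> c] unfolding vert by simp
    finally show ?thesis .
  qed
  have lc: "continuous_on UNIV ?l" by (rule interpolant_continuous[OF T])
  have comp: "compact T" by (rule triangle_topology(1)[OF T])
  have int: "integrable (lebesgue_on T) (\<lambda>x. g x)" if "continuous_on UNIV g" for g :: "plane \<Rightarrow> real"
    by (rule LINT_compact(1)[OF comp continuous_on_subset[OF that]]) simp
  have "(LINT x|lebesgue_on T. (\<phi> x - ?l x)\<^sup>2) \<le> (LINT x|lebesgue_on T. 2 * (\<phi> x - ?m)\<^sup>2 + 2 * ?K)"
  proof (rule Bochner_Integration.integral_mono)
    show "integrable (lebesgue_on T) (\<lambda>x. (\<phi> x - ?l x)\<^sup>2)" "integrable (lebesgue_on T) (\<lambda>x. 2 * (\<phi> x - ?m)\<^sup>2 + 2 * ?K)"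
      by (intro int continuous_intros cont lc)+
    fix x assume "x \<in> space (lebesgue_on T)"
    then have "x \<in> T" by simp
    then show "(\<phi> x - ?l x)\<^sup>2 \<le> 2 * (\<phi> x - ?m)\<^sup>2 + 2 * ?K"
      using sq2[of "\<phi> x - ?m" "?m - ?l x"] lm[of x] by (simp add: power2_commute[of ?m])
  qed
  also have "\<dots> = 2 * (LINT x|lebesgue_on T. (\<phi> x - ?m)\<^sup>2) + 2 * ?K * measure lebesgue T"
  proof -
    have "integrable (lebesgue_on T) (\<lambda>x. (\<phi> x - ?m)\<^sup>2)" "integrable (lebesgue_on T) (\<lambda>x. 2 * ?K)"
      by (intro int continuous_intros cont)+
    then show ?thesis
      using triangle_topology(5)[OF T] by (simp add: measure_restrict_space)
  qed
  also have "\<dots> \<le> 2 * (8 * ?d\<^sup>2 * ?S) + 2 * ?K * (4 * ?d\<^sup>2)"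
  proof (intro add_mono mult_left_mono measure_triangle_le[OF T])
    have "dist a b \<le> ?d" "dist a c \<le> ?d"
      by (rule dist_le_diameter[OF T]; auto simp: abc(1) intro: hull_inc)+
    then have "(dist a b)\<^sup>2 + (dist a c)\<^sup>2 \<le> ?d\<^sup>2 + ?d\<^sup>2"
      by (intro add_mono power_mono) auto
    then have "4 * ((dist a b)\<^sup>2 + (dist a c)\<^sup>2) \<le> 8 * ?d\<^sup>2" by simp
    then have "4 * ((dist a b)\<^sup>2 + (dist a c)\<^sup>2) * ?S \<le> 8 * ?d\<^sup>2 * ?S"
      by (rule mult_right_mono[OF _ energy_nonneg])
    then show "(LINT x|lebesgue_on T. (\<phi> x - ?m)\<^sup>2) \<le> 8 * ?d\<^sup>2 * ?S"
      using triangle_Poincare[OF \<phi>, of a b c] unfolding energy_def abc(1) by linarith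
    show "0 \<le> 2 * ?K"
      using energy_nonneg patch_energy_nonneg by (auto intro!: add_nonneg_nonneg sum_nonneg)
  qed simp
  also have "\<dots> = ?d\<^sup>2 * ((16 + 16 / \<kappa>\<^sup>2) * ?S + 16 * vertex_energy \<phi> T)"
    by (simp add: algebra_simps)
  finally show ?thesis .
qed

text \<open>
  The mean of an affine function over an edge is the average of its values at the endpoints.
\<close>

lemma edge_interpolation_error:
  assumes \<phi>: "C_k 1 \<phi>" and zero: "\<And>x. x \<in> frontier \<Omega> \<Longrightarrow> \<phi> x = 0"
    and e: "closed_segment a b \<in> edges M" "a \<noteq> b" and T: "T \<in> adjacent M (closed_segment a b)"
  shows "(seg_mean a b \<phi> - (node_value \<phi> a + node_value \<phi> b) / 2)\<^sup>2 \<le> vertex_energy \<phi> T"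
proof -
  obtain c where c: "T = convex hull {a, b, c}" "cross (b - a) (c - a) \<noteq> 0" using adjacent_triangle[OF T] by blast
  let ?V = "node_value \<phi>" and ?m = "seg_mean a b \<phi>"
  have m: "edge_mean \<phi> (closed_segment a b) = ?m"
    using edge_mean_segment[OF C_k_1_classical_grad(3)[OF \<phi>] e(2)] .
  have a: "(?m - ?V a)\<^sup>2 \<le> patch_energy \<phi> a" and b: "(?m - ?V b)\<^sup>2 \<le> patch_energy \<phi> b"
    using node_value_close[OF \<phi> zero e(1), of a] node_value_close[OF \<phi> zero e(1), of b]
    unfolding m by (simp_all add: extreme_point_of_segment)
  have "(?m - (?V a + ?V b) / 2)\<^sup>2 = ((?m - ?V a)\<^sup>2 + (?m - ?V b)\<^sup>2) / 2 - ((?V a - ?V b) / 2)\<^sup>2"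
    by (simp add: power2_eq_square field_simps)
  also have "\<dots> \<le> ((?m - ?V a)\<^sup>2 + (?m - ?V b)\<^sup>2) / 2"
    by (rule order_trans[OF diff_left_mono[OF zero_le_power2]]) simp
  also have "\<dots> \<le> patch_energy \<phi> a + patch_energy \<phi> b + patch_energy \<phi> c"
    using a b patch_energy_nonneg[of \<phi> a] patch_energy_nonneg[of \<phi> b] patch_energy_nonneg[of \<phi> c] by simp
  also have "\<dots> = vertex_energy \<phi> T"
    unfolding c(1) vertices_of_triangle[OF c(2)] using c(2) unfolding cross_nonzero_iff by simp
  finally show ?thesis .
qed

lemma sum_edges_le:
  assumes "\<And>e T. e \<in> edges M \<Longrightarrow> T \<in> adjacent M e \<Longrightarrow> g e \<le> \<rho> T" and "\<And>T. T \<in> M \<Longrightarrow> 0 \<le> (\<rho> T :: real)"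
  shows "(\<Sum>e\<in>edges M. g e) \<le> 3 * (\<Sum>T\<in>M. \<rho> T)"
proof -
  have "(\<Sum>e\<in>edges M. g e) \<le> (\<Sum>e\<in>edges M. \<Sum>T | T \<in> M \<and> e edge_of T. \<rho> T)"
  proof (rule sum_mono)
    fix e assume e: "e \<in> edges M"
    then obtain T where T: "T \<in> M" "e edge_of T" unfolding edges_def by blast
    have "g e \<le> \<rho> T" using assms(1)[OF e] T unfolding adjacent_iff by blast
    also have "\<dots> \<le> (\<Sum>T | T \<in> M \<and> e edge_of T. \<rho> T)"
      using T finite_mesh assms(2) by (intro member_le_sum) auto
    finally show "g e \<le> (\<Sum>T | T \<in> M \<and> e edge_of T. \<rho> T)" .
  qed
  also have "\<dots> = (\<Sum>T\<in>M. \<Sum>e | e \<in> edges M \<and> e edge_of T. \<rho> T)"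
    by (rule sum.swap_restrict[OF finite_edges finite_mesh])
  also have "\<dots> \<le> (\<Sum>T\<in>M. 3 * \<rho> T)"
  proof (rule sum_mono)
    fix T assume T: "T \<in> M"
    have "card {e. e \<in> edges M \<and> e edge_of T} \<le> card {e. e edge_of T}"
      by (intro card_mono finite_edges_of_triangle simplex T) auto
    then have "real (card {e. e \<in> edges M \<and> e edge_of T}) \<le> 3"
      using card_edges_of_triangle[OF simplex[OF T]] by linarith
    then show "(\<Sum>e | e \<in> edges M \<and> e edge_of T. \<rho> T) \<le> 3 * \<rho> T"
      using assms(2)[OF T] by (simp add: mult_right_mono)
  qed
  finally show ?thesis by (simp add: sum_distrib_left)
qed

end

section \<open>Galerkin orthogonality\<close>

lemma edge_integral_mult_right: "edge_integral e (\<lambda>x. g x * k) = edge_integral e g * k"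
  unfolding edge_integral_def by (simp add: split_beta Let_def)

lemma edge_integral_uminus: "edge_integral e (\<lambda>x. - g x) = - edge_integral e g"
  using edge_integral_mult_right[of e g "-1"] by simp

lemma edge_integral_zero: "edge_integral e (\<lambda>x. 0) = 0"
  using edge_integral_mult_right[of e "\<lambda>x. 0" 0] by simp

lemma edge_integral_cong:
  assumes "e = closed_segment a b" "\<And>x. x \<in> e \<Longrightarrow> g x = h x"
  shows "edge_integral e g = edge_integral e h"
proof -
  define P where "P = (\<lambda>(p, q). e = closed_segment p (q::plane))"
  have "P (a, b)" using assms(1) by (simp add: P_def)
  then have "P (Eps P)" by (rule someI)
  moreover obtain p q where pq: "Eps P = (p, q)" by fastforce
  ultimately have e: "e = closed_segment p q" by (simp add: P_def)
  have "(LINT t|lebesgue_on {0..1}. g ((1 - t) *\<^sub>R p + t *\<^sub>R q)) = (LINT t|lebesgue_on {0..1}. h ((1 - t) *\<^sub>R p + t *\<^sub>R q))"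
  proof (rule Bochner_Integration.integral_cong)
    fix t :: real assume "t \<in> space (lebesgue_on {0..1})"
    then have "(1 - t) *\<^sub>R p + t *\<^sub>R q \<in> e" unfolding e in_segment by auto
    then show "g ((1 - t) *\<^sub>R p + t *\<^sub>R q) = h ((1 - t) *\<^sub>R p + t *\<^sub>R q)" by (rule assms(2))
  qed simp
  then show ?thesis
    unfolding edge_integral_def P_def[symmetric] pq by simp
qed

lemma edge_integral_linear:
  assumes "e = closed_segment a b" "continuous_on UNIV f" "continuous_on UNIV g"
  shows "edge_integral e (\<lambda>x. f x + s * g x) = edge_integral e f + s * edge_integral e g"
proof -
  have "continuous_on UNIV (\<lambda>x. f x + s * g x)" by (intro continuous_intros assms)
  moreover have "seg_mean a b (\<lambda>x. f x + s * g x) = seg_mean a b f + s * seg_mean a b g"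
    unfolding seg_mean_def
    by (subst Henstock_Kurzweil_Integration.integral_add)
       (auto intro!: integrable_continuous_real continuous_intros continuous_on_segment_param assms)
  ultimately show ?thesis
    unfolding assms(1) using assms by (simp add: edge_integral_closed_segment algebra_simps)
qed

lemma edge_integral_const: "edge_integral (closed_segment a b) (\<lambda>x. k) = dist a b * k"
  by (simp add: edge_integral_closed_segment seg_mean_def)

text \<open>
  Both sides are linear in \<open>q\<close>, so it suffices to take the two sides at \<open>a\<close> for \<open>q\<close>, where the
  left-hand side is given by \<open>LINT_grad_along_side\<close>.
\<close>

lemma triangle_divergence_theorem:
  assumes \<phi>: "C_k 1 \<phi>" and nz: "cross (b - a) (c - a) \<noteq> 0"
  shows "(LINT x|lebesgue_on (convex hull {a, b, c}). q \<bullet> classical_grad \<phi> x) =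
    (\<Sum>e | e edge_of convex hull {a, b, c}. edge_integral e \<phi> * (q \<bullet> outward_normal (convex hull {a, b, c}) e))"
proof -
  let ?T = "convex hull {a, b, c}" and ?D = "cross (b - a) (c - a)"
  let ?u = "b - a" and ?w = "c - a" and ?s = "sgn (cross (b - a) (c - a))"
  note cont = C_k_1_classical_grad[OF \<phi>]
  have ne: "a \<noteq> b" "b \<noteq> c" "c \<noteq> a" and distinct: "{a, b} \<noteq> {b, c}" "{b, c} \<noteq> {c, a}" "{a, b} \<noteq> {c, a}"
    using nz unfolding cross_nonzero_iff by (auto simp: doubleton_eq_iff)
  have E: "{e. e edge_of ?T} = {closed_segment a b, closed_segment b c, closed_segment c a}"
    unfolding edge_of_triangle[OF nz] by blast
  have D: "cross (c - b) (a - b) = ?D" "cross (a - c) (b - c) = ?D"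
    by (simp_all add: cross_def algebra_simps)
  have rot: "x \<bullet> vector [y $ 2, - y $ 1] = cross x y" for x y :: plane
    by (simp add: inner_plane vector_2 cross_def)
  have n: "edge_integral (closed_segment a b) \<phi> * (x \<bullet> outward_normal ?T (closed_segment a b)) = seg_mean a b \<phi> * (?s * cross x (b - a))"
    "edge_integral (closed_segment b c) \<phi> * (x \<bullet> outward_normal ?T (closed_segment b c)) = seg_mean b c \<phi> * (?s * cross x (c - b))"
    "edge_integral (closed_segment c a) \<phi> * (x \<bullet> outward_normal ?T (closed_segment c a)) = seg_mean c a \<phi> * (?s * cross x (a - c))" for x
  proof -
    have gen: "edge_integral (closed_segment p r) \<phi> * (x \<bullet> outward_normal ?T (closed_segment p r)) = seg_mean p r \<phi> * (?s * cross x (r - p))"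
      if "convex hull {p, r, d} = ?T" "cross (r - p) (d - p) = ?D" for p r d
    proof -
      have "x \<bullet> (dist p r *\<^sub>R outward_normal ?T (closed_segment p r)) = ?s * cross x (r - p)"
        using outward_normal_triangle[of r p d] nz unfolding that by (simp add: rot del: vector_minus_component)
      then show ?thesis by (simp add: edge_integral_closed_segment[OF cont(3)] algebra_simps)
    qed
    show "edge_integral (closed_segment a b) \<phi> * (x \<bullet> outward_normal ?T (closed_segment a b)) = seg_mean a b \<phi> * (?s * cross x (b - a))"
      by (rule gen[of a b c]) auto
    show "edge_integral (closed_segment b c) \<phi> * (x \<bullet> outward_normal ?T (closed_segment b c)) = seg_mean b c \<phi> * (?s * cross x (c - b))"
      by (rule gen[of b c a]) (simp_all add: triangle_rotate D)
    show "edge_integral (closed_segment c a) \<phi> * (x \<bullet> outward_normal ?T (closed_segment c a)) = seg_mean c a \<phi> * (?s * cross x (a - c))"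
      by (rule gen[of c a b]) (simp_all add: triangle_rotate D)
  qed
  have rhs: "(\<Sum>e | e edge_of ?T. edge_integral e \<phi> * (x \<bullet> outward_normal ?T e)) =
     ?s * (seg_mean a b \<phi> * cross x (b - a) + seg_mean b c \<phi> * cross x (c - b) + seg_mean c a \<phi> * cross x (a - c))" for x
    unfolding E using distinct by (simp add: n algebra_simps)
  have lhs: "(LINT y|lebesgue_on ?T. (s *\<^sub>R x + t *\<^sub>R z) \<bullet> classical_grad \<phi> y) =
     s * (LINT y|lebesgue_on ?T. classical_grad \<phi> y \<bullet> x) + t * (LINT y|lebesgue_on ?T. classical_grad \<phi> y \<bullet> z)" for x z s t
  proof -
    have "integrable (lebesgue_on ?T) (\<lambda>y. classical_grad \<phi> y \<bullet> x)" for x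
      by (intro LINT_compact(1) compact_triangle continuous_intros continuous_on_subset[OF cont(2)]) auto
    moreover have "(s *\<^sub>R x + t *\<^sub>R z) \<bullet> classical_grad \<phi> y =
        s * (classical_grad \<phi> y \<bullet> x) + t * (classical_grad \<phi> y \<bullet> z)" for y
      unfolding inner_add_left inner_scaleR_left by (simp add: inner_commute[of "classical_grad \<phi> y"])
    ultimately show ?thesis by simp
  qed
  have q: "q = (cross q ?w / ?D) *\<^sub>R ?u + (cross ?u q / ?D) *\<^sub>R ?w"
  proof -
    have "?D *\<^sub>R q = cross q ?w *\<^sub>R ?u + cross ?u q *\<^sub>R ?w"
      by (simp add: vec_eq_iff forall_2 cross_def algebra_simps)
    then have "(1 / ?D) *\<^sub>R ?D *\<^sub>R q = (1 / ?D) *\<^sub>R (cross q ?w *\<^sub>R ?u + cross ?u q *\<^sub>R ?w)" by simp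
    then show ?thesis using nz by (simp add: scaleR_add_right)
  qed
  have u: "(LINT y|lebesgue_on ?T. classical_grad \<phi> y \<bullet> ?u) = \<bar>?D\<bar> * (seg_mean b c \<phi> - seg_mean c a \<phi>)"
    using LINT_grad_along_side[OF \<phi>, of a b c] seg_mean_commute[of c a] by simp
  have w: "(LINT y|lebesgue_on ?T. classical_grad \<phi> y \<bullet> ?w) = \<bar>?D\<bar> * (seg_mean b c \<phi> - seg_mean a b \<phi>)"
    using LINT_grad_along_side[OF \<phi>, of a c b] seg_mean_commute[of c b] cross_commute[of ?w ?u]
    by (simp add: triangle_rotate)
  have sD: "\<bar>?D\<bar> = ?s * ?D" by (simp add: abs_sgn mult.commute)
  have "(LINT x|lebesgue_on ?T. q \<bullet> classical_grad \<phi> x) =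
    (cross q ?w / ?D) * (\<bar>?D\<bar> * (seg_mean b c \<phi> - seg_mean c a \<phi>)) + (cross ?u q / ?D) * (\<bar>?D\<bar> * (seg_mean b c \<phi> - seg_mean a b \<phi>))"
    unfolding u[symmetric] w[symmetric] lhs[symmetric] q[symmetric] ..
  also have "\<dots> = ?s * (cross q ?w * (seg_mean b c \<phi> - seg_mean c a \<phi>) + cross ?u q * (seg_mean b c \<phi> - seg_mean a b \<phi>))"
    unfolding sD using nz by (simp add: field_simps)
  also have "\<dots> = ?s * (seg_mean a b \<phi> * cross q (b - a) + seg_mean b c \<phi> * cross q (c - b) + seg_mean c a \<phi> * cross q (a - c))"
    by (rule arg_cong[where f = "\<lambda>x. ?s * x"]) (simp add: cross_def algebra_simps)
  finally show ?thesis unfolding rhs .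
qed

context triangulated_domain
begin

lemma measure_pos:
  assumes "T \<in> M"
  shows "measure lebesgue T > 0"
proof -
  have "measure lebesgue T \<noteq> 0"
    using triangle_topology(4,7)[OF assms] unfolding negligible_iff_measure by blast
  then show ?thesis
    using measure_nonneg[of lebesgue T] by (simp only: less_le) simp
qed

lemma LINT_const: "T \<in> M \<Longrightarrow> (LINT x|lebesgue_on T. (k::real)) = measure lebesgue T * k"
  using triangle_topology(5) by (simp add: measure_restrict_space)

lemma edge_segment: "e \<in> edges M \<Longrightarrow> \<exists>a b. e = closed_segment a b \<and> a \<noteq> b"
  by (erule edgeE) blast

lemma edge_of_in_edges: "T \<in> M \<Longrightarrow> e edge_of T \<Longrightarrow> e \<in> edges M"
  unfolding edges_def by blast

lemma weak_grad_eq: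
  assumes T: "T \<in> M"
  shows "weak_grad M v T = (1 / measure lebesgue T) *\<^sub>R
    (\<Sum>e | e edge_of T. edge_integral e (avg M (fst v) e) *\<^sub>R outward_normal T e)" (is "_ = _ *\<^sub>R ?G")
proof -
  have m: "measure lebesgue T > 0" by (rule measure_pos[OF T])
  have R: "(\<Sum>e\<in>{e. e edge_of T}. edge_integral e (\<lambda>x. avg M (fst v) e x * (q \<bullet> outward_normal T e))) = ?G \<bullet> q" for q
    unfolding edge_integral_mult_right inner_sum_left by (simp add: inner_commute[of q])
  show ?thesis
    unfolding weak_grad_def R LINT_const[OF T]
  proof (rule the_equality)
    show "\<forall>q. measure lebesgue T * ((1 / measure lebesgue T) *\<^sub>R ?G \<bullet> q) = ?G \<bullet> q" using m by simp
    fix g assume "\<forall>q. measure lebesgue T * (g \<bullet> q) = ?G \<bullet> q"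
    then have "\<forall>q. (measure lebesgue T *\<^sub>R g) \<bullet> q = ?G \<bullet> q" by simp
    then have "measure lebesgue T *\<^sub>R g = ?G" by (rule vector_eq_rdot[THEN iffD1])
    then have "(1 / measure lebesgue T) *\<^sub>R measure lebesgue T *\<^sub>R g = (1 / measure lebesgue T) *\<^sub>R ?G" by simp
    then show "g = (1 / measure lebesgue T) *\<^sub>R ?G" using m by simp
  qed
qed

definition piecewise_affine :: "piecewise set" where
  "piecewise_affine = {w. \<forall>T\<in>M. \<exists>c p. \<forall>x. w T x = c + p \<bullet> x}"

lemma piecewise_affine_continuous:
  assumes "w \<in> piecewise_affine" "T \<in> M"
  shows "continuous_on UNIV (w T)"
proof -
  obtain c p where "\<And>x. w T x = c + p \<bullet> x" using assms unfolding piecewise_affine_def by blast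
  then have "w T = (\<lambda>x. c + p \<bullet> x)" by auto
  then show ?thesis by (auto intro!: continuous_intros)
qed

lemma piecewise_affine_linear:
  assumes "w \<in> piecewise_affine" "z \<in> piecewise_affine"
  shows "(\<lambda>T x. w T x + s * z T x) \<in> piecewise_affine"
  unfolding piecewise_affine_def
proof (intro CollectI ballI)
  fix T assume T: "T \<in> M"
  obtain c p where w: "\<And>x. w T x = c + p \<bullet> x" using assms(1) T unfolding piecewise_affine_def by blast
  obtain d q where z: "\<And>x. z T x = d + q \<bullet> x" using assms(2) T unfolding piecewise_affine_def by blast
  have "w T x + s * z T x = (c + s * d) + (p + s *\<^sub>R q) \<bullet> x" for x
    unfolding w z by (simp add: inner_add_left algebra_simps)
  then show "\<exists>c p. \<forall>x. w T x + s * z T x = c + p \<bullet> x" by blast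
qed

lemma piecewise_affine_integrable:
  assumes "w \<in> piecewise_affine" "T \<in> M"
  shows "integrable (lebesgue_on T) (w T)" "w T \<in> L2 T"
proof -
  note c = piecewise_affine_continuous[OF assms]
  have "continuous_on UNIV (\<lambda>x. (w T x)\<^sup>2)" by (intro continuous_intros c)
  note int = LINT_compact(1)[OF triangle_topology(1)[OF assms(2)] continuous_on_subset[OF _ subset_UNIV]]
  show "integrable (lebesgue_on T) (w T)" by (rule int[OF c])
  show "w T \<in> L2 T"
    using int[OF \<open>continuous_on UNIV (\<lambda>x. (w T x)\<^sup>2)\<close>] continuous_imp_measurable_on[OF c] by (simp add: L2_def)
qed

lemma avg_continuous:
  assumes "w \<in> piecewise_affine"
  shows "continuous_on UNIV (avg M w e)"
proof -
  have "avg M w e = (\<lambda>x. (\<Sum>T\<in>adjacent M e. w T x) * inverse (real (card (adjacent M e))))"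
    by (rule ext) (simp add: avg_def divide_inverse)
  moreover have "continuous_on UNIV (\<lambda>x. \<Sum>T\<in>adjacent M e. w T x)"
    by (rule continuous_on_sum) (simp add: adjacent_iff piecewise_affine_continuous[OF assms])
  ultimately show ?thesis by (simp add: continuous_on_mult_right)
qed

lemma jump_continuous:
  assumes "w \<in> piecewise_affine"
  shows "continuous_on UNIV (jump M w e)"
proof -
  have "jump M w e = (\<lambda>x. \<Sum>T\<in>adjacent M e. w T x *\<^sub>R outward_normal T e)"
    by (rule ext) (simp add: jump_def)
  moreover have "continuous_on UNIV (\<lambda>x. \<Sum>T\<in>adjacent M e. w T x *\<^sub>R outward_normal T e)"
    by (rule continuous_on_sum, rule continuous_on_scaleR)
       (simp_all add: adjacent_iff piecewise_affine_continuous[OF assms])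
  ultimately show ?thesis by simp
qed

lemma avg_linear: "avg M (\<lambda>T x. w T x + s * z T x) e = (\<lambda>x. avg M w e x + s * avg M z e x)"
  by (rule ext) (simp only: avg_def sum.distrib sum_distrib_left[symmetric] add_divide_distrib times_divide_eq_right)

lemma jump_linear: "jump M (\<lambda>T x. w T x + s * z T x) e x = jump M w e x + s *\<^sub>R jump M z e x"
  by (simp add: jump_def sum.distrib scaleR_add_left scaleR_sum_right)

lemma fst_pi_inv [simp]: "fst (pi_inv M w) = w"
  by (simp add: pi_inv_def)

lemma weak_grad_linear:
  assumes "w \<in> piecewise_affine" "z \<in> piecewise_affine" "T \<in> M"
  shows "weak_grad M (pi_inv M (\<lambda>T x. w T x + s * z T x)) T =
    weak_grad M (pi_inv M w) T + s *\<^sub>R weak_grad M (pi_inv M z) T"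
proof -
  have "edge_integral e (avg M (\<lambda>T x. w T x + s * z T x) e) = edge_integral e (avg M w e) + s * edge_integral e (avg M z e)"
    if e: "e edge_of T" for e
  proof -
    obtain a b where ab: "e = closed_segment a b"
      using edge_segment[OF edge_of_in_edges[OF assms(3) e]] by blast
    show ?thesis
      unfolding avg_linear by (rule edge_integral_linear[OF ab avg_continuous[OF assms(1)] avg_continuous[OF assms(2)]])
  qed
  then have "(\<Sum>e | e edge_of T. edge_integral e (avg M (\<lambda>T x. w T x + s * z T x) e) *\<^sub>R outward_normal T e) =
      (\<Sum>e | e edge_of T. edge_integral e (avg M w e) *\<^sub>R outward_normal T e)
      + s *\<^sub>R (\<Sum>e | e edge_of T. edge_integral e (avg M z e) *\<^sub>R outward_normal T e)"
    unfolding scaleR_sum_right sum.distrib[symmetric]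
    by (intro sum.cong) (simp_all add: scaleR_add_left)
  then show ?thesis
    unfolding weak_grad_eq[OF assms(3)] fst_pi_inv
    by (simp only: scaleR_add_right scaleR_left_commute)
qed

lemma a_h_linear:
  assumes "fst u \<in> piecewise_affine" "w \<in> piecewise_affine" "z \<in> piecewise_affine"
  shows "a_h M u (pi_inv M (\<lambda>T x. w T x + s * z T x)) = a_h M u (pi_inv M w) + s * a_h M u (pi_inv M z)"
proof -
  have 1: "(\<Sum>T\<in>M. LINT x|lebesgue_on T. weak_grad M u T \<bullet> weak_grad M (pi_inv M (\<lambda>T x. w T x + s * z T x)) T) =
     (\<Sum>T\<in>M. LINT x|lebesgue_on T. weak_grad M u T \<bullet> weak_grad M (pi_inv M w) T)
     + s * (\<Sum>T\<in>M. LINT x|lebesgue_on T. weak_grad M u T \<bullet> weak_grad M (pi_inv M z) T)"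
    unfolding sum_distrib_left sum.distrib[symmetric]
  proof (rule sum.cong[OF refl])
    fix T assume T: "T \<in> M"
    show "(LINT x|lebesgue_on T. weak_grad M u T \<bullet> weak_grad M (pi_inv M (\<lambda>T x. w T x + s * z T x)) T) =
        (LINT x|lebesgue_on T. weak_grad M u T \<bullet> weak_grad M (pi_inv M w) T)
        + s * (LINT x|lebesgue_on T. weak_grad M u T \<bullet> weak_grad M (pi_inv M z) T)"
    proof -
      have "m * (g \<bullet> (p + s *\<^sub>R q)) = m * (g \<bullet> p) + s * (m * (g \<bullet> q))" for m :: real and g p q :: plane
        by (simp add: inner_add_right algebra_simps)
      then show ?thesis
        unfolding LINT_const[OF T] weak_grad_linear[OF assms(2,3) T, of s] .
    qed
  qed
  have 2: "1 / diameter e * edge_integral e (\<lambda>x. jump M (fst u) e x \<bullet> jump M (\<lambda>T x. w T x + s * z T x) e x)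
      = 1 / diameter e * edge_integral e (\<lambda>x. jump M (fst u) e x \<bullet> jump M w e x)
      + s * (1 / diameter e * edge_integral e (\<lambda>x. jump M (fst u) e x \<bullet> jump M z e x))" if e: "e \<in> edges M" for e
  proof -
    obtain a b where ab: "e = closed_segment a b" using edge_segment[OF e] by blast
    have c: "continuous_on UNIV (\<lambda>x. jump M (fst u) e x \<bullet> jump M v e x)" if "v \<in> piecewise_affine" for v
      by (intro continuous_on_inner jump_continuous assms(1) that)
    have "edge_integral e (\<lambda>x. jump M (fst u) e x \<bullet> jump M (\<lambda>T x. w T x + s * z T x) e x)
        = edge_integral e (\<lambda>x. jump M (fst u) e x \<bullet> jump M w e x) + s * edge_integral e (\<lambda>x. jump M (fst u) e x \<bullet> jump M z e x)"
      unfolding jump_linear inner_add_right inner_scaleR_right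
      by (rule edge_integral_linear[OF ab c[OF assms(2)] c[OF assms(3)]])
    then show ?thesis by (simp add: algebra_simps)
  qed
  have 3: "(\<Sum>e\<in>edges M. 1 / diameter e * edge_integral e (\<lambda>x. jump M (fst u) e x \<bullet> jump M (\<lambda>T x. w T x + s * z T x) e x))
      = (\<Sum>e\<in>edges M. 1 / diameter e * edge_integral e (\<lambda>x. jump M (fst u) e x \<bullet> jump M w e x))
      + s * (\<Sum>e\<in>edges M. 1 / diameter e * edge_integral e (\<lambda>x. jump M (fst u) e x \<bullet> jump M z e x))"
    unfolding sum_distrib_left sum.distrib[symmetric] by (rule sum.cong[OF refl 2])
  show ?thesis
    unfolding a_h_def fst_pi_inv 1 3 by (simp only: distrib_left add_ac)
qed

lemma V_h_piecewise_affine: "v \<in> V_h M \<Longrightarrow> fst v \<in> piecewise_affine"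
  by (auto simp: V_h_def piecewise_affine_def)

lemma L_h_linear:
  assumes f: "f \<in> L2 \<Omega>" and w: "w \<in> piecewise_affine" "z \<in> piecewise_affine"
  shows "L_h M f (pi_inv M (\<lambda>T x. w T x + s * z T x)) = L_h M f (pi_inv M w) + s * L_h M f (pi_inv M z)"
proof -
  have "(LINT x|lebesgue_on T. f x * (w T x + s * z T x)) = (LINT x|lebesgue_on T. f x * w T x) + s * (LINT x|lebesgue_on T. f x * z T x)"
    if T: "T \<in> M" for T
  proof -
    have fT: "f \<in> L2 T"
      by (rule L2_almost_subset[OF domain_measurable(1) triangle_topology(5)[OF T] negligible_outside[OF T] f])
    have "integrable (lebesgue_on T) (\<lambda>x. f x * w T x)" "integrable (lebesgue_on T) (\<lambda>x. f x * z T x)"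
      by (rule L2_mult_integrable(1)[OF fT piecewise_affine_integrable(2)[OF w(1) T]]
          L2_mult_integrable(1)[OF fT piecewise_affine_integrable(2)[OF w(2) T]])+
    moreover have "f x * (w T x + s * z T x) = f x * w T x + s * (f x * z T x)" for x
      by (simp add: algebra_simps)
    ultimately show ?thesis by simp
  qed
  then show ?thesis
    unfolding L_h_def fst_pi_inv sum_distrib_left sum.distrib[symmetric] by (rule sum.cong[OF refl])
qed

lemma zero_piecewise_affine: "(\<lambda>T x. 0) \<in> piecewise_affine"
proof -
  have "\<exists>c p. \<forall>x. (0::real) = c + p \<bullet> (x::plane)" by (intro exI[of _ 0]) simp
  then show ?thesis unfolding piecewise_affine_def by simp
qed

text \<open>
  Adding a multiple \<open>s z\<close> to \<open>u\<^sub>h\<close> leaves the means over triangles unchanged and hence gives an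
  element of \<open>K_h\<close>; the variational inequality for \<open>s = 1\<close> and \<open>s = -1\<close> is an equality.
\<close>

lemma mean_zero_variation:
  assumes f: "f \<in> L2 \<Omega>" and u: "discrete_solution M f \<psi> u\<^sub>h" and z: "z \<in> piecewise_affine"
    and mean: "\<And>T. T \<in> M \<Longrightarrow> (LINT x|lebesgue_on T. z T x) = 0"
  shows "a_h M u\<^sub>h (pi_inv M z) = L_h M f (pi_inv M z)"
proof -
  have uK: "u\<^sub>h \<in> K_h M \<psi>" using u by (simp add: discrete_solution_def)
  then have uV: "u\<^sub>h \<in> V_h M" by (simp add: K_h_def)
  note upa = V_h_piecewise_affine[OF uV]
  have ge: "s * a_h M u\<^sub>h (pi_inv M z) \<ge> s * L_h M f (pi_inv M z)" for s
  proof -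
    let ?z = "\<lambda>T x. 0 + s * z T x"
    define v0 where "v0 = (\<lambda>T x. fst u\<^sub>h T x + s * z T x)"
    define vb where "vb = (\<lambda>e x. snd u\<^sub>h e x + snd (pi_inv M ?z) e x)"
    define v where "v = (v0, vb)"
    have diff: "v - u\<^sub>h = pi_inv M ?z"
    proof (rule prod_eqI)
      show "fst (v - u\<^sub>h) = fst (pi_inv M ?z)"
        by (intro ext) (simp add: v_def v0_def)
      show "snd (v - u\<^sub>h) = snd (pi_inv M ?z)"
        by (intro ext) (simp add: v_def vb_def)
    qed
    have u_int: "snd u\<^sub>h e x = avg M (fst u\<^sub>h) e x" if "e \<in> interior_edges M" "x \<in> e" for e x
      using uV that unfolding V_h_def by (simp add: split_beta)
    have u_bd: "snd u\<^sub>h e x = 0" if "e \<in> boundary_edges M" "x \<in> e" for e x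
      using uV that unfolding V_h_def by (simp add: split_beta)
    have "v \<in> V_h M"
    proof -
      have "v0 \<in> piecewise_affine" unfolding v0_def by (rule piecewise_affine_linear[OF upa z])
      moreover have "vb e x = avg M v0 e x" if e: "e \<in> interior_edges M" "x \<in> e" for e x
      proof -
        have "avg M v0 e x = avg M (fst u\<^sub>h) e x + s * avg M z e x"
          unfolding v0_def avg_linear ..
        moreover have "snd (pi_inv M ?z) e x = avg M (\<lambda>T x. 0) e x + s * avg M z e x"
          unfolding pi_inv_def using e(1) by (simp add: avg_linear[of "\<lambda>T x. 0" s z e, simplified])
        moreover have "avg M (\<lambda>T x. 0) e x = 0" by (simp add: avg_def)
        ultimately show ?thesis unfolding vb_def u_int[OF e] by simp
      qed
      moreover have "vb e x = 0" if e: "e \<in> boundary_edges M" "x \<in> e" for e x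
      proof -
        have "e \<notin> interior_edges M" using e by (simp add: interior_edges_def boundary_edges_def)
        then show ?thesis unfolding vb_def u_bd[OF e] pi_inv_def by simp
      qed
      ultimately show ?thesis
        unfolding V_h_def piecewise_affine_def v_def by simp
    qed
    moreover have "(LINT x|lebesgue_on T. fst v T x) \<ge> (LINT x|lebesgue_on T. \<psi> x)" if T: "T \<in> M" for T
    proof -
      have "(LINT x|lebesgue_on T. fst v T x) = (LINT x|lebesgue_on T. fst u\<^sub>h T x)"
        using piecewise_affine_integrable(1)[OF upa T] piecewise_affine_integrable(1)[OF z T] mean[OF T]
        by (simp add: v_def v0_def)
      then show ?thesis using uK T by (simp add: K_h_def)
    qed
    ultimately have "v \<in> K_h M \<psi>" by (simp add: K_h_def)
    then have "a_h M u\<^sub>h (pi_inv M ?z) \<ge> L_h M f (pi_inv M ?z)"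
      using u diff unfolding discrete_solution_def by metis
    moreover have "a_h M u\<^sub>h (pi_inv M ?z) = a_h M u\<^sub>h (pi_inv M (\<lambda>T x. 0)) + s * a_h M u\<^sub>h (pi_inv M z)"
      by (rule a_h_linear[OF upa zero_piecewise_affine z])
    moreover have "L_h M f (pi_inv M ?z) = L_h M f (pi_inv M (\<lambda>T x. 0)) + s * L_h M f (pi_inv M z)"
      by (rule L_h_linear[OF f zero_piecewise_affine z])
    moreover have "L_h M f (pi_inv M (\<lambda>T x. 0)) = 0" by (simp add: L_h_def)
    moreover have "a_h M u\<^sub>h (pi_inv M (\<lambda>T x. 0)) = 0"
      using a_h_linear[OF upa zero_piecewise_affine zero_piecewise_affine, of 1] by simp
    ultimately show ?thesis by simp
  qed
  show ?thesis using ge[of 1] ge[of "-1"] by simp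
qed

text \<open>
  A piecewise affine function is the sum of its means, where the definition of the multiplier
  applies, and a function with vanishing means, on which the piecewise constant multiplier
  vanishes.
\<close>

lemma discrete_orthogonality:
  assumes f: "f \<in> L2 \<Omega>" and u: "discrete_solution M f \<psi> u\<^sub>h" and lam: "discrete_multiplier M f u\<^sub>h lam\<^sub>h"
    and w: "w \<in> piecewise_affine"
  shows "(\<Sum>T\<in>M. LINT x|lebesgue_on T. lam\<^sub>h T x * w T x) = L_h M f (pi_inv M w) - a_h M u\<^sub>h (pi_inv M w)"
proof -
  have upa: "fst u\<^sub>h \<in> piecewise_affine"
    using u V_h_piecewise_affine by (simp add: discrete_solution_def K_h_def)
  define m where "m = (\<lambda>T (x::plane). (LINT x|lebesgue_on T. w T x) / measure lebesgue T)"
  have mW: "m \<in> W_h M" by (auto simp: W_h_def m_def)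
  have mpa: "m \<in> piecewise_affine"
    unfolding piecewise_affine_def
  proof (intro CollectI ballI)
    fix T
    have "m T x = (LINT y|lebesgue_on T. w T y) / measure lebesgue T + 0 \<bullet> x" for x
      by (simp add: m_def)
    then show "\<exists>c p. \<forall>x. m T x = c + p \<bullet> x" by blast
  qed
  define z where "z = (\<lambda>T x. w T x + (-1) * m T x)"
  have zpa: "z \<in> piecewise_affine" unfolding z_def by (rule piecewise_affine_linear[OF w mpa])
  have mint: "(LINT x|lebesgue_on T. m T x) = (LINT x|lebesgue_on T. w T x)" if T: "T \<in> M" for T
    unfolding m_def LINT_const[OF T] using measure_pos[OF T] by simp
  have "(LINT x|lebesgue_on T. z T x) = 0" if T: "T \<in> M" for T
    using mint[OF T] piecewise_affine_integrable(1)[OF w T] piecewise_affine_integrable(1)[OF mpa T]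
    by (simp add: z_def)
  then have z: "a_h M u\<^sub>h (pi_inv M z) = L_h M f (pi_inv M z)"
    by (rule mean_zero_variation[OF f u zpa])
  have "(LINT x|lebesgue_on T. lam\<^sub>h T x * w T x) = (LINT x|lebesgue_on T. lam\<^sub>h T x * m T x)" if T: "T \<in> M" for T
  proof -
    obtain c where "\<And>x. lam\<^sub>h T x = c" using lam T unfolding discrete_multiplier_def W_h_def by blast
    then show ?thesis using mint[OF T] by simp
  qed
  then have "(\<Sum>T\<in>M. LINT x|lebesgue_on T. lam\<^sub>h T x * w T x) = L_h M f (pi_inv M m) - a_h M u\<^sub>h (pi_inv M m)"
    using lam mW unfolding discrete_multiplier_def by simp
  moreover have "L_h M f (pi_inv M z) = L_h M f (pi_inv M w) + (-1) * L_h M f (pi_inv M m)"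
    unfolding z_def by (rule L_h_linear[OF f w mpa])
  moreover have "a_h M u\<^sub>h (pi_inv M z) = a_h M u\<^sub>h (pi_inv M w) + (-1) * a_h M u\<^sub>h (pi_inv M m)"
    unfolding z_def by (rule a_h_linear[OF upa w mpa])
  ultimately show ?thesis using z by simp
qed

lemma interpolant_piecewise_affine: "interpolant V \<in> piecewise_affine"
  unfolding piecewise_affine_def using interpolant(1) by blast

lemma interpolant_agrees_on_edge:
  assumes "T \<in> adjacent M e" "T' \<in> adjacent M e" "x \<in> e"
  shows "interpolant V T x = interpolant V T' x"
proof -
  have T: "T \<in> M" "e edge_of T" "T' \<in> M" "e edge_of T'" using assms by (auto simp: adjacent_iff)
  obtain a b where e: "e = closed_segment a b" using edge_segment[OF edge_of_in_edges[OF T(1,2)]] by blast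
  obtain t where "x = (1 - t) *\<^sub>R a + t *\<^sub>R b" using assms(3) unfolding e in_segment by blast
  then show ?thesis
    using interpolant_on_edge[OF T(1) T(2)[unfolded e]] interpolant_on_edge[OF T(3) T(4)[unfolded e]] by simp
qed

lemma interpolant_on_boundary_edge:
  assumes V: "\<And>z. z \<in> frontier \<Omega> \<Longrightarrow> V z = 0" and e: "e \<in> boundary_edges M" "T \<in> adjacent M e" "x \<in> e"
  shows "interpolant V T x = 0"
proof -
  have T: "T \<in> M" "e edge_of T" using e(2) by (auto simp: adjacent_iff)
  obtain a b where ab: "e = closed_segment a b" using edge_segment[OF edge_of_in_edges[OF T]] by blast
  have "a \<in> e" "b \<in> e" unfolding ab by auto
  then have "V a = 0" "V b = 0" using V boundary_edge_in_frontier[OF e(1)] by blast+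
  moreover obtain t where "x = (1 - t) *\<^sub>R a + t *\<^sub>R b" using e(3) unfolding ab in_segment by blast
  ultimately show ?thesis using interpolant_on_edge[OF T(1) T(2)[unfolded ab]] by simp
qed

lemma avg_interpolant:
  assumes "T \<in> adjacent M e" "x \<in> e"
  shows "avg M (interpolant V) e x = interpolant V T x"
proof -
  have "card (adjacent M e) \<noteq> 0" using assms(1) finite_adjacent by auto
  moreover have "(\<Sum>T'\<in>adjacent M e. interpolant V T' x) = (\<Sum>T'\<in>adjacent M e. interpolant V T x)"
    by (rule sum.cong) (use interpolant_agrees_on_edge[OF _ assms(1,2)] in auto)
  ultimately show ?thesis unfolding avg_def by simp
qed

lemma jump_interpolant:
  assumes V: "\<And>z. z \<in> frontier \<Omega> \<Longrightarrow> V z = 0" and e: "e \<in> edges M" "x \<in> e"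
  shows "jump M (interpolant V) e x = 0"
proof (cases "e \<in> boundary_edges M")
  case True
  then show ?thesis
    unfolding jump_def using interpolant_on_boundary_edge[OF V True _ e(2)] by simp
next
  case False
  then have "card (adjacent M e) = 2"
    using interior_or_boundary_edge[OF e(1)] by (auto simp: interior_edges_def)
  then obtain T T' where TT: "adjacent M e = {T, T'}" "T \<noteq> T'" unfolding card_2_iff by blast
  have "jump M (interpolant V) e x = interpolant V T x *\<^sub>R (outward_normal T e + outward_normal T' e)"
    unfolding jump_def TT(1) using TT(2) interpolant_agrees_on_edge[of T' e T x V] TT(1) e(2)
    by (simp add: scaleR_add_right)
  also have "\<dots> = 0"
    using outward_normals_opposite[of T e T'] TT by simp
  finally show ?thesis .
qed

text \<open>
  The conforming interpolant has no jumps, so only the weak gradients contribute; tested with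
  the constant weak gradient of \<open>u\<close>, that of the interpolant turns into edge integrals.
\<close>

lemma a_h_interpolant:
  assumes V: "\<And>z. z \<in> frontier \<Omega> \<Longrightarrow> V z = 0"
  shows "a_h M u (pi_inv M (interpolant V)) =
    (\<Sum>T\<in>M. \<Sum>e | e edge_of T. edge_integral e (avg M (interpolant V) e) * (weak_grad M u T \<bullet> outward_normal T e))"
proof -
  have "edge_integral e (\<lambda>x. jump M (fst u) e x \<bullet> jump M (interpolant V) e x) = 0" if e: "e \<in> edges M" for e
  proof -
    obtain a b where ab: "e = closed_segment a b" using edge_segment[OF e] by blast
    have "edge_integral e (\<lambda>x. jump M (fst u) e x \<bullet> jump M (interpolant V) e x) = edge_integral e (\<lambda>x. 0)"
      by (rule edge_integral_cong[OF ab]) (simp add: jump_interpolant[OF V e])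
    then show ?thesis by (simp add: edge_integral_zero)
  qed
  moreover have "(LINT x|lebesgue_on T. weak_grad M u T \<bullet> weak_grad M (pi_inv M (interpolant V)) T) =
      (\<Sum>e | e edge_of T. edge_integral e (avg M (interpolant V) e) * (weak_grad M u T \<bullet> outward_normal T e))"
    if T: "T \<in> M" for T
    unfolding LINT_const[OF T] weak_grad_eq[OF T, of "pi_inv M (interpolant V)"] fst_pi_inv
    using measure_pos[OF T] by (simp add: inner_sum_right)
  ultimately show ?thesis
    unfolding a_h_def fst_pi_inv by simp
qed

end

section \<open>The residual estimate\<close>

lemma test_function_zero_on_frontier:
  assumes "\<phi> \<in> test_functions \<Omega>" "open \<Omega>" "x \<in> frontier \<Omega>"
  shows "\<phi> x = 0"
proof -
  have "x \<notin> \<Omega>" using assms(2,3) by (simp add: frontier_def interior_open)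
  then show ?thesis using test_functionsD(2)[OF assms(1)] by blast
qed

lemma divergence_const: "divergence (\<lambda>y. c) x = 0"
proof -
  have "partial_deriv i (\<lambda>y. c $ i) x = 0" for i :: 2
    using partial_deriv_eq[OF has_derivative_const] by simp
  then show ?thesis by (simp add: divergence_def)
qed

lemma abs_sum_mult_le:
  fixes a b :: "'a \<Rightarrow> real"
  shows "\<bar>\<Sum>i\<in>I. a i * b i\<bar> \<le> sqrt (\<Sum>i\<in>I. (a i)\<^sup>2) * sqrt (\<Sum>i\<in>I. (b i)\<^sup>2)"
  using real_sqrt_le_mono[OF Cauchy_Schwarz_ineq_sum[of a b I]] by (simp only: real_sqrt_abs real_sqrt_mult)

context shape_regular_mesh
begin

text \<open>
  Adds up the constants of \<open>interpolation_error\<close> and \<open>sum_vertex_energy_le\<close>, where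
  \<open>48 = 16 * 3\<close>.
\<close>

definition stability_constant :: real where
  "stability_constant = 16 + 16 / \<kappa>\<^sup>2 + 48 / \<kappa> ^ 6"

lemma sum_interpolation_error:
  assumes \<phi>: "C_k 1 \<phi>" and zero: "\<And>x. x \<in> frontier \<Omega> \<Longrightarrow> \<phi> x = 0"
  shows "(\<Sum>T\<in>M. (sqrt (LINT x|lebesgue_on T. (\<phi> x - interpolant (node_value \<phi>) T x)\<^sup>2) / diameter T)\<^sup>2)
    \<le> stability_constant * (\<Sum>T\<in>M. energy \<phi> T)"
proof -
  have "(\<Sum>T\<in>M. (sqrt (LINT x|lebesgue_on T. (\<phi> x - interpolant (node_value \<phi>) T x)\<^sup>2) / diameter T)\<^sup>2)
      \<le> (\<Sum>T\<in>M. (16 + 16 / \<kappa>\<^sup>2) * energy \<phi> T + 16 * vertex_energy \<phi> T)"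
  proof (rule sum_mono)
    fix T assume T: "T \<in> M"
    let ?I = "LINT x|lebesgue_on T. (\<phi> x - interpolant (node_value \<phi>) T x)\<^sup>2"
    have "?I \<ge> 0" by (rule Bochner_Integration.integral_nonneg) simp
    then have "(sqrt ?I / diameter T)\<^sup>2 = ?I / (diameter T)\<^sup>2" by (simp add: power_divide)
    also have "\<dots> \<le> (16 + 16 / \<kappa>\<^sup>2) * energy \<phi> T + 16 * vertex_energy \<phi> T"
      using interpolation_error[OF \<phi> zero T] diameter_pos[OF T]
      by (simp only: pos_divide_le_eq zero_less_power mult.commute)
    finally show "(sqrt ?I / diameter T)\<^sup>2 \<le> (16 + 16 / \<kappa>\<^sup>2) * energy \<phi> T + 16 * vertex_energy \<phi> T" .
  qed
  also have "\<dots> = (16 + 16 / \<kappa>\<^sup>2) * (\<Sum>T\<in>M. energy \<phi> T) + 16 * (\<Sum>T\<in>M. vertex_energy \<phi> T)"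
    by (simp only: sum.distrib sum_distrib_left)
  also have "\<dots> \<le> (16 + 16 / \<kappa>\<^sup>2) * (\<Sum>T\<in>M. energy \<phi> T) + 16 * (3 / \<kappa> ^ 6 * (\<Sum>T\<in>M. energy \<phi> T))"
    using sum_vertex_energy_le by (intro add_mono mult_left_mono) auto
  also have "\<dots> = stability_constant * (\<Sum>T\<in>M. energy \<phi> T)"
    by (simp add: stability_constant_def distrib_right)
  finally show ?thesis .
qed

text \<open>
  The integral of \<open>\<phi> - w\<close> over \<open>e\<close> for the quasi-interpolant \<open>w\<close> of \<open>\<phi>\<close>.
\<close>

definition edge_defect :: "(plane \<Rightarrow> real) \<Rightarrow> plane set \<Rightarrow> real" where
  "edge_defect \<phi> e = edge_integral e \<phi> - edge_integral e (avg M (interpolant (node_value \<phi>)) e)"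

lemma edge_defect_bound:
  assumes \<phi>: "C_k 1 \<phi>" and zero: "\<And>x. x \<in> frontier \<Omega> \<Longrightarrow> \<phi> x = 0"
    and e: "e \<in> edges M" and T: "T \<in> adjacent M e"
  shows "(edge_defect \<phi> e / diameter e)\<^sup>2 \<le> vertex_energy \<phi> T" "diameter e > 0"
proof -
  obtain a b where ab: "e = closed_segment a b" "a \<noteq> b" using edge_segment[OF e] by blast
  let ?V = "node_value \<phi>"
  let ?w = "avg M (interpolant ?V) e"
  have TM: "T \<in> M" "closed_segment a b edge_of T" using T unfolding ab adjacent_iff by auto
  have d: "diameter e = dist a b" by (simp add: ab diameter_closed_segment)
  show pos: "diameter e > 0" using d ab(2) by simp
  have "seg_mean a b ?w = integral {0..1} (\<lambda>t. ?V a + t * (?V b - ?V a))"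
    unfolding seg_mean_def
  proof (rule Henstock_Kurzweil_Integration.integral_cong)
    fix t :: real assume "t \<in> {0..1}"
    then have "(1 - t) *\<^sub>R a + t *\<^sub>R b \<in> e" unfolding ab in_segment by auto
    from avg_interpolant[OF T this, of ?V]
    show "?w ((1 - t) *\<^sub>R a + t *\<^sub>R b) = ?V a + t * (?V b - ?V a)"
      using interpolant_on_edge[OF TM, of ?V t] by (simp add: algebra_simps)
  qed
  also have "\<dots> = (?V a + ?V b) / 2"
  proof -
    have "((\<lambda>t. t * (?V b - ?V a)) has_integral ((1\<^sup>2 - 0\<^sup>2) / 2) * (?V b - ?V a)) {0..1::real}"
      by (rule has_integral_mult_left[OF ident_has_integral]) simp
    from has_integral_add[OF has_integral_const_real[of "?V a" 0 1] this]
    show ?thesis by (simp add: integral_unique field_simps)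
  qed
  finally have mw: "seg_mean a b ?w = (?V a + ?V b) / 2" .
  have "edge_defect \<phi> e = dist a b * (seg_mean a b \<phi> - (?V a + ?V b) / 2)"
    unfolding edge_defect_def
    using edge_integral_closed_segment[OF C_k_1_classical_grad(3)[OF \<phi>], of a b]
      edge_integral_closed_segment[OF avg_continuous[OF interpolant_piecewise_affine[of ?V], of e], of a b]
    by (simp add: ab(1)[symmetric] mw right_diff_distrib)
  then have "edge_defect \<phi> e / diameter e = seg_mean a b \<phi> - (?V a + ?V b) / 2"
    using ab(2) d by simp
  then show "(edge_defect \<phi> e / diameter e)\<^sup>2 \<le> vertex_energy \<phi> T"
    using edge_interpolation_error[OF \<phi> zero e[unfolded ab(1)] ab(2) T[unfolded ab(1)]] by simp
qed

lemma edge_defect_boundary: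
  assumes zero: "\<And>x. x \<in> frontier \<Omega> \<Longrightarrow> \<phi> x = 0" and e: "e \<in> boundary_edges M"
  shows "edge_defect \<phi> e = 0"
proof -
  have eM: "e \<in> edges M" using e by (simp add: boundary_edges_def)
  obtain a b where ab: "e = closed_segment a b" using edge_segment[OF eM] by blast
  obtain T where T: "T \<in> adjacent M e" using eM unfolding edges_def adjacent_iff by blast
  have V: "node_value \<phi> z = 0" if "z \<in> frontier \<Omega>" for z using that by (simp add: node_value_def)
  have "edge_integral e \<phi> = edge_integral e (avg M (interpolant (node_value \<phi>)) e)"
  proof (rule edge_integral_cong[OF ab])
    fix x assume x: "x \<in> e"
    have "\<phi> x = 0" using zero boundary_edge_in_frontier[OF e] x by blast
    moreover have "avg M (interpolant (node_value \<phi>)) e x = 0"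
      using avg_interpolant[OF T x] interpolant_on_boundary_edge[OF V e T x] by simp
    ultimately show "\<phi> x = avg M (interpolant (node_value \<phi>)) e x" by simp
  qed
  then show ?thesis by (simp add: edge_defect_def)
qed

lemma sum_edge_defect:
  assumes \<phi>: "C_k 1 \<phi>" and zero: "\<And>x. x \<in> frontier \<Omega> \<Longrightarrow> \<phi> x = 0"
  shows "(\<Sum>e\<in>interior_edges M. (edge_defect \<phi> e / diameter e)\<^sup>2) \<le> stability_constant * (\<Sum>T\<in>M. energy \<phi> T)"
proof -
  have "(\<Sum>e\<in>interior_edges M. (edge_defect \<phi> e / diameter e)\<^sup>2) \<le> (\<Sum>e\<in>edges M. (edge_defect \<phi> e / diameter e)\<^sup>2)"
    using finite_edges by (intro sum_mono2) (auto simp: interior_edges_def)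
  also have "\<dots> \<le> 3 * (\<Sum>T\<in>M. vertex_energy \<phi> T)"
    using edge_defect_bound(1)[OF \<phi> zero] by (intro sum_edges_le) (auto intro: sum_nonneg patch_energy_nonneg)
  also have "\<dots> \<le> 3 * (3 / \<kappa> ^ 6 * (\<Sum>T\<in>M. energy \<phi> T))"
    using sum_vertex_energy_le by (intro mult_left_mono) auto
  also have "\<dots> = (9 / \<kappa> ^ 6) * (\<Sum>T\<in>M. energy \<phi> T)" by simp
  also have "\<dots> \<le> stability_constant * (\<Sum>T\<in>M. energy \<phi> T)"
  proof (rule mult_right_mono)
    have "9 / \<kappa> ^ 6 \<le> 48 / \<kappa> ^ 6" using \<kappa>_pos by (intro divide_right_mono) auto
    moreover have "16 / \<kappa>\<^sup>2 \<ge> 0" by simp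
    ultimately show "9 / \<kappa> ^ 6 \<le> stability_constant" unfolding stability_constant_def by linarith
  qed (intro sum_nonneg energy_nonneg)
  finally show ?thesis .
qed

text \<open>
  Subtracting the orthogonality relation for the quasi-interpolant and integrating by parts on
  each triangle leaves, edge by edge, the defect of the edge integral times the sum of the
  outward fluxes of the weak gradient on both sides, which is its normal jump. On boundary edges
  the defect vanishes.
\<close>

lemma residual_representation:
  assumes f: "f \<in> L2 \<Omega>" and u: "discrete_solution M f \<psi> u\<^sub>h" and lam: "discrete_multiplier M f u\<^sub>h lam\<^sub>h"
    and c: "\<And>T x. T \<in> M \<Longrightarrow> lam\<^sub>h T x = c T" and \<phi>: "\<phi> \<in> test_functions \<Omega>"
  shows "residual M f c (weak_grad M u\<^sub>h) \<phi> (classical_grad \<phi>) =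
    (\<Sum>T\<in>M. LINT x|lebesgue_on T. (f x - c T) * (\<phi> x - interpolant (node_value \<phi>) T x)) -
    (\<Sum>e\<in>interior_edges M. edge_defect \<phi> e * (\<Sum>T\<in>adjacent M e. weak_grad M u\<^sub>h T \<bullet> outward_normal T e))"
proof -
  let ?g = "weak_grad M u\<^sub>h" and ?w = "interpolant (node_value \<phi>)"
  note C1 = test_function_C1[OF \<phi>]
  note cont = C_k_1_classical_grad[OF C1]
  have zero: "\<phi> x = 0" if "x \<in> frontier \<Omega>" for x
    using test_function_zero_on_frontier[OF \<phi> domain(1) that] .
  have V: "node_value \<phi> z = 0" if "z \<in> frontier \<Omega>" for z using that by (simp add: node_value_def)
  have fT: "f \<in> L2 T" if "T \<in> M" for T
    by (rule L2_almost_subset[OF domain_measurable(1) triangle_topology(5)[OF that] negligible_outside[OF that] f])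
  have fcT: "(\<lambda>x. f x - c T) \<in> L2 T" if T: "T \<in> M" for T
    by (rule L2_diff[OF fT[OF T] L2_const[OF triangle_topology(4)[OF T]]])
  have wT: "?w T \<in> L2 T" if "T \<in> M" for T
    by (rule piecewise_affine_integrable(2)[OF interpolant_piecewise_affine that])
  have \<phi>T: "\<phi> \<in> L2 T" if T: "T \<in> M" for T
    by (rule L2_almost_subset[OF domain_measurable(1) triangle_topology(5)[OF T] negligible_outside[OF T]
          test_function_L2[OF \<phi> domain_measurable(2)]])
  have div: "(\<Sum>i\<in>UNIV. ?g T $ i * (LINT x|lebesgue_on T. classical_grad \<phi> x $ i)) =
      (\<Sum>e | e edge_of T. edge_integral e \<phi> * (?g T \<bullet> outward_normal T e))" if T: "T \<in> M" for T
  proof -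
    obtain p q r where abc: "T = convex hull {p, q, r}" "cross (q - p) (r - p) \<noteq> 0"
      using simplex[OF T] unfolding simplex_2_iff by blast
    have int: "integrable (lebesgue_on T) (\<lambda>x. classical_grad \<phi> x $ i)" for i
      by (intro LINT_compact(1) triangle_topology(1) T continuous_intros continuous_on_subset[OF cont(2)]) auto
    have "(\<Sum>i\<in>UNIV. ?g T $ i * (LINT x|lebesgue_on T. classical_grad \<phi> x $ i)) = (LINT x|lebesgue_on T. ?g T \<bullet> classical_grad \<phi> x)"
      using int by (simp add: inner_vec_def)
    then show ?thesis
      using triangle_divergence_theorem[OF C1 abc(2), of "?g T"] unfolding abc(1)[symmetric] by simp
  qed
  have "(\<Sum>T\<in>M. LINT x|lebesgue_on T. lam\<^sub>h T x * ?w T x) = L_h M f (pi_inv M ?w) - a_h M u\<^sub>h (pi_inv M ?w)"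
    by (rule discrete_orthogonality[OF f u lam interpolant_piecewise_affine])
  moreover have "(\<Sum>T\<in>M. LINT x|lebesgue_on T. lam\<^sub>h T x * ?w T x) = L_h M f (pi_inv M ?w) - (\<Sum>T\<in>M. LINT x|lebesgue_on T. (f x - c T) * ?w T x)"
    unfolding L_h_def fst_pi_inv sum_subtractf[symmetric]
  proof (rule sum.cong[OF refl])
    fix T assume T: "T \<in> M"
    have "(LINT x|lebesgue_on T. f x * ?w T x) - (LINT x|lebesgue_on T. (f x - c T) * ?w T x)
        = (LINT x|lebesgue_on T. f x * ?w T x - (f x - c T) * ?w T x)"
      by (rule Bochner_Integration.integral_diff[symmetric, OF L2_mult_integrable(1)[OF fT[OF T] wT[OF T]] L2_mult_integrable(1)[OF fcT[OF T] wT[OF T]]])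
    also have "\<dots> = (LINT x|lebesgue_on T. lam\<^sub>h T x * ?w T x)"
      by (rule Bochner_Integration.integral_cong) (simp_all add: c[OF T] algebra_simps)
    finally show "(LINT x|lebesgue_on T. lam\<^sub>h T x * ?w T x) =
        (LINT x|lebesgue_on T. f x * ?w T x) - (LINT x|lebesgue_on T. (f x - c T) * ?w T x)" by simp
  qed
  ultimately have "(\<Sum>T\<in>M. LINT x|lebesgue_on T. (f x - c T) * ?w T x) = a_h M u\<^sub>h (pi_inv M ?w)"
    by linarith
  also have "\<dots> = (\<Sum>T\<in>M. \<Sum>e | e edge_of T. edge_integral e (avg M ?w e) * (?g T \<bullet> outward_normal T e))"
    by (rule a_h_interpolant) (rule V)
  finally have orth: "(\<Sum>T\<in>M. LINT x|lebesgue_on T. (f x - c T) * ?w T x) =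
      (\<Sum>T\<in>M. \<Sum>e | e edge_of T. edge_integral e (avg M ?w e) * (?g T \<bullet> outward_normal T e))" .
  have "residual M f c ?g \<phi> (classical_grad \<phi>) =
      (\<Sum>T\<in>M. LINT x|lebesgue_on T. (f x - c T) * \<phi> x) -
      (\<Sum>T\<in>M. \<Sum>e | e edge_of T. edge_integral e \<phi> * (?g T \<bullet> outward_normal T e))"
    unfolding sum_subtractf[symmetric] by (rule sum.cong[OF refl]) (simp only: div)
  also have "\<dots> = ((\<Sum>T\<in>M. LINT x|lebesgue_on T. (f x - c T) * \<phi> x) - (\<Sum>T\<in>M. LINT x|lebesgue_on T. (f x - c T) * ?w T x))
      - ((\<Sum>T\<in>M. \<Sum>e | e edge_of T. edge_integral e \<phi> * (?g T \<bullet> outward_normal T e))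
       - (\<Sum>T\<in>M. \<Sum>e | e edge_of T. edge_integral e (avg M ?w e) * (?g T \<bullet> outward_normal T e)))"
    unfolding orth by simp
  also have "(\<Sum>T\<in>M. LINT x|lebesgue_on T. (f x - c T) * \<phi> x) - (\<Sum>T\<in>M. LINT x|lebesgue_on T. (f x - c T) * ?w T x)
      = (\<Sum>T\<in>M. LINT x|lebesgue_on T. (f x - c T) * (\<phi> x - ?w T x))"
    unfolding sum_subtractf[symmetric]
  proof (rule sum.cong[OF refl])
    fix T assume T: "T \<in> M"
    show "(LINT x|lebesgue_on T. (f x - c T) * \<phi> x) - (LINT x|lebesgue_on T. (f x - c T) * ?w T x) = (LINT x|lebesgue_on T. (f x - c T) * (\<phi> x - ?w T x))"
      unfolding right_diff_distrib[of "_ - c T"]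
      by (rule Bochner_Integration.integral_diff[symmetric, OF L2_mult_integrable(1)[OF fcT[OF T] \<phi>T[OF T]] L2_mult_integrable(1)[OF fcT[OF T] wT[OF T]]])
  qed
  also have "(\<Sum>T\<in>M. \<Sum>e | e edge_of T. edge_integral e \<phi> * (?g T \<bullet> outward_normal T e))
       - (\<Sum>T\<in>M. \<Sum>e | e edge_of T. edge_integral e (avg M ?w e) * (?g T \<bullet> outward_normal T e))
      = (\<Sum>T\<in>M. \<Sum>e | e \<in> edges M \<and> e edge_of T. edge_defect \<phi> e * (?g T \<bullet> outward_normal T e))"
    unfolding sum_subtractf[symmetric]
  proof (rule sum.cong[OF refl])
    fix T assume T: "T \<in> M"
    have "{e. e edge_of T} = {e. e \<in> edges M \<and> e edge_of T}" using edge_of_in_edges[OF T] by blast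
    then show "(\<Sum>e | e edge_of T. edge_integral e \<phi> * (?g T \<bullet> outward_normal T e) - edge_integral e (avg M ?w e) * (?g T \<bullet> outward_normal T e))
        = (\<Sum>e | e \<in> edges M \<and> e edge_of T. edge_defect \<phi> e * (?g T \<bullet> outward_normal T e))"
      by (simp only: edge_defect_def left_diff_distrib)
  qed
  also have "\<dots> = (\<Sum>e\<in>edges M. \<Sum>T | T \<in> M \<and> e edge_of T. edge_defect \<phi> e * (?g T \<bullet> outward_normal T e))"
    by (rule sum.swap_restrict[OF finite_mesh finite_edges])
  also have "\<dots> = (\<Sum>e\<in>edges M. edge_defect \<phi> e * (\<Sum>T\<in>adjacent M e. ?g T \<bullet> outward_normal T e))"
    by (simp only: adjacent_def sum_distrib_left)
  also have "\<dots> = (\<Sum>e\<in>interior_edges M. edge_defect \<phi> e * (\<Sum>T\<in>adjacent M e. ?g T \<bullet> outward_normal T e))"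
  proof (rule sum.mono_neutral_right[OF finite_edges])
    show "interior_edges M \<subseteq> edges M" by (auto simp: interior_edges_def)
    show "\<forall>e\<in>edges M - interior_edges M. edge_defect \<phi> e * (\<Sum>T\<in>adjacent M e. ?g T \<bullet> outward_normal T e) = 0"
    proof
      fix e assume "e \<in> edges M - interior_edges M"
      then have "e \<in> boundary_edges M" using interior_or_boundary_edge by blast
      then have "edge_defect \<phi> e = 0" by (rule edge_defect_boundary[rotated]) (rule zero)
      then show "edge_defect \<phi> e * (\<Sum>T\<in>adjacent M e. ?g T \<bullet> outward_normal T e) = 0" by simp
    qed
  qed
  finally show ?thesis .
qed

lemma eta1_square:
  assumes c: "\<And>T x. T \<in> M \<Longrightarrow> lam\<^sub>h T x = c T"
  shows "(eta1 M f u\<^sub>h lam\<^sub>h)\<^sup>2 = (\<Sum>T\<in>M. (diameter T * L2_norm T (\<lambda>x. f x - c T))\<^sup>2)"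
proof -
  have "(eta1 M f u\<^sub>h lam\<^sub>h)\<^sup>2 = (\<Sum>T\<in>M. (diameter T)\<^sup>2 *
       (L2_norm T (\<lambda>x. f x + divergence (\<lambda>y. weak_grad M u\<^sub>h T) x - lam\<^sub>h T x))\<^sup>2)"
    unfolding eta1_def by (intro real_sqrt_pow2 sum_nonneg) simp
  also have "\<dots> = (\<Sum>T\<in>M. (diameter T * L2_norm T (\<lambda>x. f x - c T))\<^sup>2)"
    by (intro sum.cong refl) (simp add: c divergence_const power_mult_distrib)
  finally show ?thesis .
qed

lemma eta2_square:
  "(eta2 M u\<^sub>h)\<^sup>2 = (\<Sum>e\<in>interior_edges M. (diameter e * (\<Sum>T\<in>adjacent M e. weak_grad M u\<^sub>h T \<bullet> outward_normal T e))\<^sup>2)"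
proof -
  have eq: "diameter e * edge_integral e (\<lambda>x. (vjump M (\<lambda>T y. weak_grad M u\<^sub>h T) e x)\<^sup>2) =
      (diameter e * (\<Sum>T\<in>adjacent M e. weak_grad M u\<^sub>h T \<bullet> outward_normal T e))\<^sup>2" if e: "e \<in> interior_edges M" for e
  proof -
    obtain a b where ab: "e = closed_segment a b" using edge_segment[of e] e by (auto simp: interior_edges_def)
    show ?thesis
      unfolding vjump_def ab diameter_closed_segment edge_integral_const
      by (simp add: power_mult_distrib power2_eq_square)
  qed
  have "(\<Sum>e\<in>interior_edges M. diameter e * edge_integral e (\<lambda>x. (vjump M (\<lambda>T y. weak_grad M u\<^sub>h T) e x)\<^sup>2)) =
      (\<Sum>e\<in>interior_edges M. (diameter e * (\<Sum>T\<in>adjacent M e. weak_grad M u\<^sub>h T \<bullet> outward_normal T e))\<^sup>2)"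
    by (rule sum.cong[OF refl eq])
  then show ?thesis
    unfolding eta2_def by (simp add: sum_nonneg)
qed

text \<open>
  Cauchy--Schwarz for sums, with \<open>h\<^sub>T\<close> and \<open>h\<^sub>e\<close> distributed so that one factor is an estimator
  and the other a scale-invariant interpolation error.
\<close>

lemma residual_estimate_test_function:
  assumes f: "f \<in> L2 \<Omega>" and u: "discrete_solution M f \<psi> u\<^sub>h" and lam: "discrete_multiplier M f u\<^sub>h lam\<^sub>h"
    and c: "\<And>T x. T \<in> M \<Longrightarrow> lam\<^sub>h T x = c T" and \<phi>: "\<phi> \<in> test_functions \<Omega>"
  shows "\<bar>residual M f c (weak_grad M u\<^sub>h) \<phi> (classical_grad \<phi>)\<bar>
    \<le> sqrt (2 * stability_constant * ((eta1 M f u\<^sub>h lam\<^sub>h)\<^sup>2 + (eta2 M u\<^sub>h)\<^sup>2)) *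
       sqrt (energy \<phi> \<Omega>)"
proof -
  let ?w = "interpolant (node_value \<phi>)" and ?C = stability_constant
  let ?J = "\<lambda>e. \<Sum>T\<in>adjacent M e. weak_grad M u\<^sub>h T \<bullet> outward_normal T e"
  let ?S = "energy \<phi> \<Omega>"
  let ?e1 = "eta1 M f u\<^sub>h lam\<^sub>h" and ?e2 = "eta2 M u\<^sub>h"
  note C1 = test_function_C1[OF \<phi>]
  note cont = C_k_1_classical_grad[OF C1]
  have zero: "\<phi> x = 0" if "x \<in> frontier \<Omega>" for x
    using test_function_zero_on_frontier[OF \<phi> domain(1) that] .
  have Lc: "(\<lambda>x. classical_grad \<phi> x $ i) \<in> L2 \<Omega>" for i
    using test_function_weak_grad[OF \<phi> domain_measurable(2)] by (simp add: has_weak_grad_def)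
  have S: "(\<Sum>T\<in>M. energy \<phi> T) = ?S"
    unfolding energy_def by (rule sum_LINT_mesh) (rule L2_inner(1)[OF Lc Lc])
  have e0: "?e1 \<ge> 0" "?e2 \<ge> 0"
    unfolding eta1_def eta2_def
  proof -
    show "0 \<le> sqrt (\<Sum>T\<in>M. (diameter T)\<^sup>2 * (L2_norm T (\<lambda>x. f x + divergence (\<lambda>y. weak_grad M u\<^sub>h T) x - lam\<^sub>h T x))\<^sup>2)"
      by (intro real_sqrt_ge_zero sum_nonneg) simp
    have "0 \<le> diameter e * edge_integral e (\<lambda>x. (vjump M (\<lambda>T y. weak_grad M u\<^sub>h T) e x)\<^sup>2)" if e: "e \<in> interior_edges M" for e
    proof -
      obtain a b where ab: "e = closed_segment a b" using edge_segment[of e] e by (auto simp: interior_edges_def)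
      show ?thesis unfolding vjump_def ab diameter_closed_segment edge_integral_const by simp
    qed
    then show "0 \<le> sqrt (\<Sum>e\<in>interior_edges M. diameter e * edge_integral e (\<lambda>x. (vjump M (\<lambda>T y. weak_grad M u\<^sub>h T) e x)\<^sup>2))"
      by (intro real_sqrt_ge_zero sum_nonneg)
  qed
  have "\<bar>LINT x|lebesgue_on T. (f x - c T) * (\<phi> x - ?w T x)\<bar>
      \<le> (diameter T * L2_norm T (\<lambda>x. f x - c T)) * (sqrt (LINT x|lebesgue_on T. (\<phi> x - ?w T x)\<^sup>2) / diameter T)"
    if T: "T \<in> M" for T
  proof -
    note sub = L2_almost_subset[OF domain_measurable(1) triangle_topology(5)[OF T] negligible_outside[OF T]]
    have 1: "(\<lambda>x. f x - c T) \<in> L2 T"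
      by (rule L2_diff[OF sub[OF f] L2_const[OF triangle_topology(4)[OF T]]])
    have 2: "(\<lambda>x. \<phi> x - ?w T x) \<in> L2 T"
      by (rule L2_diff[OF sub[OF test_function_L2[OF \<phi> domain_measurable(2)]]
            piecewise_affine_integrable(2)[OF interpolant_piecewise_affine T]])
    have "\<bar>LINT x|lebesgue_on T. (f x - c T) * (\<phi> x - ?w T x)\<bar> \<le> L2_norm T (\<lambda>x. f x - c T) * sqrt (LINT x|lebesgue_on T. (\<phi> x - ?w T x)\<^sup>2)"
      using real_sqrt_le_mono[OF L2_mult_integrable(2)[OF 1 2]] unfolding L2_norm_def by (simp only: real_sqrt_abs real_sqrt_mult)
    then show ?thesis using diameter_pos[OF T] by simp
  qed
  then have "\<bar>\<Sum>T\<in>M. LINT x|lebesgue_on T. (f x - c T) * (\<phi> x - ?w T x)\<bar> \<le>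
      (\<Sum>T\<in>M. (diameter T * L2_norm T (\<lambda>x. f x - c T)) * (sqrt (LINT x|lebesgue_on T. (\<phi> x - ?w T x)\<^sup>2) / diameter T))"
    by (rule order_trans[OF sum_abs sum_mono])
  also have "\<dots> \<le> sqrt (?e1\<^sup>2) * sqrt (\<Sum>T\<in>M. (sqrt (LINT x|lebesgue_on T. (\<phi> x - ?w T x)\<^sup>2) / diameter T)\<^sup>2)"
  proof -
    have "?e1\<^sup>2 = (\<Sum>T\<in>M. (diameter T * L2_norm T (\<lambda>x. f x - c T))\<^sup>2)"
      by (rule eta1_square) (rule c)
    then show ?thesis by (simp only:) (rule order_trans[OF abs_ge_self abs_sum_mult_le])
  qed
  also have "\<dots> \<le> ?e1 * sqrt (?C * ?S)"
    using sum_interpolation_error[OF C1 zero] e0 unfolding S by (simp add: mult_left_mono)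
  finally have term1: "\<bar>\<Sum>T\<in>M. LINT x|lebesgue_on T. (f x - c T) * (\<phi> x - ?w T x)\<bar> \<le> ?e1 * sqrt (?C * ?S)" .
  have "(\<Sum>e\<in>interior_edges M. edge_defect \<phi> e * ?J e) = (\<Sum>e\<in>interior_edges M. (diameter e * ?J e) * (edge_defect \<phi> e / diameter e))"
  proof (rule sum.cong[OF refl])
    fix e assume "e \<in> interior_edges M"
    then have e: "e \<in> edges M" by (simp add: interior_edges_def)
    then obtain T where "T \<in> adjacent M e" unfolding edges_def adjacent_iff by blast
    then have "diameter e > 0" using edge_defect_bound(2)[OF C1 zero e] by blast
    then show "edge_defect \<phi> e * ?J e = (diameter e * ?J e) * (edge_defect \<phi> e / diameter e)" by simp
  qed
  then have "\<bar>\<Sum>e\<in>interior_edges M. edge_defect \<phi> e * ?J e\<bar> \<le> sqrt (?e2\<^sup>2) * sqrt (\<Sum>e\<in>interior_edges M. (edge_defect \<phi> e / diameter e)\<^sup>2)"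
    unfolding eta2_square by (simp only: abs_sum_mult_le)
  also have "\<dots> \<le> ?e2 * sqrt (?C * ?S)"
    using sum_edge_defect[OF C1 zero] e0 unfolding S by (simp add: mult_left_mono)
  finally have term2: "\<bar>\<Sum>e\<in>interior_edges M. edge_defect \<phi> e * ?J e\<bar> \<le> ?e2 * sqrt (?C * ?S)" .
  have S0: "?S \<ge> 0" by (rule energy_nonneg)
  have C0: "?C \<ge> 0" unfolding stability_constant_def by simp
  have "?e1 + ?e2 \<le> sqrt (2 * (?e1\<^sup>2 + ?e2\<^sup>2))"
  proof (rule real_le_rsqrt)
    show "(?e1 + ?e2)\<^sup>2 \<le> 2 * (?e1\<^sup>2 + ?e2\<^sup>2)"
      using zero_le_power2[of "?e1 - ?e2"] by (simp add: power2_eq_square algebra_simps)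
  qed
  then have "(?e1 + ?e2) * sqrt (?C * ?S) \<le> sqrt (2 * (?e1\<^sup>2 + ?e2\<^sup>2)) * sqrt (?C * ?S)"
    using S0 C0 by (intro mult_right_mono) auto
  also have "\<dots> = sqrt (2 * ?C * (?e1\<^sup>2 + ?e2\<^sup>2)) * sqrt ?S"
    by (simp add: real_sqrt_mult[symmetric] algebra_simps)
  finally have "(?e1 + ?e2) * sqrt (?C * ?S) \<le> sqrt (2 * ?C * (?e1\<^sup>2 + ?e2\<^sup>2)) * sqrt ?S" .
  then have fin: "\<bar>(\<Sum>T\<in>M. LINT x|lebesgue_on T. (f x - c T) * (\<phi> x - ?w T x)) - (\<Sum>e\<in>interior_edges M. edge_defect \<phi> e * ?J e)\<bar>
      \<le> sqrt (2 * ?C * (?e1\<^sup>2 + ?e2\<^sup>2)) * sqrt ?S"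
    using term1 term2 by (simp only: distrib_right)
  show ?thesis
  proof (subst residual_representation[OF f u lam _ \<phi>])
    show "lam\<^sub>h T x = c T" if "T \<in> M" for T x by (rule c[OF that])
  qed (fact fin)
qed

end

section \<open>The functional in the negative norm\<close>

lemma test_function_add:
  assumes "\<phi> \<in> test_functions \<Omega>" "\<theta> \<in> test_functions \<Omega>"
  shows "(\<lambda>x. \<phi> x + \<theta> x) \<in> test_functions \<Omega>"
proof -
  obtain K where K: "compact K" "K \<subseteq> \<Omega>" "\<And>x. x \<notin> K \<Longrightarrow> \<phi> x = 0"
    using test_functionsD(2)[OF assms(1)] by blast
  obtain K' where K': "compact K'" "K' \<subseteq> \<Omega>" "\<And>x. x \<notin> K' \<Longrightarrow> \<theta> x = 0"
    using test_functionsD(2)[OF assms(2)] by blast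
  have "\<And>x. x \<notin> K \<union> K' \<Longrightarrow> \<phi> x + \<theta> x = 0" using K K' by simp
  moreover have "compact (K \<union> K')" "K \<union> K' \<subseteq> \<Omega>" using K K' by auto
  moreover have "C_k k (\<lambda>x. \<phi> x + \<theta> x)" for k
    using assms test_functionsD(1) C_k_add by blast
  ultimately show ?thesis unfolding test_functions_def by blast
qed

lemma H10_add_test_function:
  assumes u: "u \<in> H10 \<Omega>" and b: "b \<in> test_functions \<Omega>" and \<Omega>: "\<Omega> \<in> sets lebesgue"
  shows "(\<lambda>x. u x + b x) \<in> H10 \<Omega>"
proof -
  let ?v = "\<lambda>x. u x + b x"
  have uH: "u \<in> H1 \<Omega>" using u by (simp add: H10_def)
  have "C_k k (\<lambda>x. - 1 * b x)" for k by (intro C_k_mult C_k_const test_functionsD(1)[OF b])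
  then have mb: "(\<lambda>x. - b x) \<in> test_functions \<Omega>"
    using b unfolding test_functions_def by auto
  have "u - (\<lambda>x. - b x) = ?v" by auto
  then have "has_weak_grad \<Omega> ?v (\<lambda>x. grad \<Omega> u x - classical_grad (\<lambda>x. - b x) x)"
    using has_weak_grad_diff[OF grad_spec[OF uH] test_function_weak_grad[OF mb \<Omega>] \<Omega>] by simp
  then have "?v \<in> H1 \<Omega>" unfolding H1_def by blast
  moreover have "\<exists>\<theta>\<in>test_functions \<Omega>. H1_norm \<Omega> (?v - \<theta>) < \<epsilon>" if eps: "\<epsilon> > 0" for \<epsilon>
  proof -
    have "\<forall>\<epsilon>>0. \<exists>\<phi>\<in>test_functions \<Omega>. H1_norm \<Omega> (u - \<phi>) < \<epsilon>" using u by (simp add: H10_def)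
    then obtain \<phi> where \<phi>: "\<phi> \<in> test_functions \<Omega>" "H1_norm \<Omega> (u - \<phi>) < \<epsilon>" using eps by blast
    have "?v - (\<lambda>x. \<phi> x + b x) = u - \<phi>" by (simp add: fun_eq_iff)
    then have "H1_norm \<Omega> (?v - (\<lambda>x. \<phi> x + b x)) < \<epsilon>" using \<phi>(2) by (simp only:)
    then show ?thesis using test_function_add[OF \<phi>(1) b] by blast
  qed
  ultimately show ?thesis unfolding H10_def by blast
qed

lemma ereal_square_le_of_symmetric_bound:
  fixes S :: ereal
  assumes "ereal (- B) \<le> S" "S \<le> ereal B" "B\<^sup>2 \<le> R"
  shows "S\<^sup>2 \<le> ereal R"
proof (cases S)
  case (real s)
  then have "\<bar>s\<bar> \<le> B" using assms by auto
  then have "s\<^sup>2 \<le> B\<^sup>2" by (metis abs_ge_zero power2_abs power_mono)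
  then show ?thesis using real assms(3) by (simp add: power2_eq_square)
qed (use assms in auto)

context triangulated_domain
begin

text \<open>
  If \<open>u\<close> vanishes almost everywhere, then adding a bump function to it gives a function that
  does not.
\<close>

lemma H10_nontrivial:
  assumes u: "u \<in> H10 \<Omega>"
  shows "\<exists>v\<in>H10 \<Omega>. \<not> (AE x in lebesgue_on \<Omega>. v x = 0)"
proof -
  obtain T where T: "T \<in> M" using Union_mesh domain(2) closure_subset by blast
  obtain a b c where abc: "T = convex hull {a, b, c}" "cross (b - a) (c - a) \<noteq> 0"
    using simplex[OF T] unfolding simplex_2_iff by blast
  \<comment> \<open>At the centroid all coordinates are \<open>1/3 > 1/4\<close>, so the bump function with parameter \<open>4\<close>
      is positive there.\<close>
  let ?b = "bump a b c 4"
  note I = open_triangle_subset_domain[OF T[unfolded abc(1)] abc(2)]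
  have bt: "?b \<in> test_functions \<Omega>" by (rule bump_test_function[OF abc(2) I])
  define x0 where "x0 = (1/3) *\<^sub>R a + (1/3) *\<^sub>R b + (1/3) *\<^sub>R c"
  let ?U = "{x. ?b x > 0}"
  have third: "1 / 3 + 1 / 3 + 1 / 3 = (1 :: real)" by (simp add: field_simps)
  have "bary a b c x0 = 1 / 3"
    by (rule bary_combination[OF abc(2) _ third]) (simp add: x0_def)
  moreover have "bary b c a x0 = 1 / 3"
    by (rule bary_combination[OF cross_cyclic(1)[OF abc(2)] _ third]) (simp add: x0_def)
  moreover have "bary c a b x0 = 1 / 3"
    by (rule bary_combination[OF cross_cyclic(2)[OF abc(2)] _ third]) (simp add: x0_def)
  ultimately have "x0 \<in> ?U"
    unfolding bump_def by (auto intro!: mult_pos_pos flat_1_pos)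
  moreover have "open ?U"
    by (intro open_Collect_less continuous_on_const test_function_continuous[OF bt])
  moreover have U\<Omega>: "?U \<subseteq> \<Omega>"
    using test_functionsD(2)[OF bt] by force
  ultimately have nneg: "\<not> negligible ?U" using open_not_negligible by blast
  show ?thesis
  proof (rule ccontr)
    assume no: "\<not> ?thesis"
    have "AE x in lebesgue_on \<Omega>. u x = 0" "AE x in lebesgue_on \<Omega>. u x + ?b x = 0"
      using no u H10_add_test_function[OF u bt domain_measurable(2)] by auto
    then have "AE x in lebesgue_on \<Omega>. ?b x = 0" by eventually_elim simp
    then have "AE x in lebesgue. x \<in> \<Omega> \<longrightarrow> ?b x = 0"
      using domain_measurable(2) by (simp add: AE_restrict_space_iff)
    then have "AE x in lebesgue. x \<notin> ?U"
      by (rule AE_mp) (use U\<Omega> in auto)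
    then have "?U \<in> null_sets lebesgue"
      using \<open>open ?U\<close> by (subst AE_iff_null_sets) auto
    then show False using nneg negligible_iff_null_sets by blast
  qed
qed

lemma weak_grad_uminus: "T \<in> M \<Longrightarrow> weak_grad M (- u) T = - weak_grad M u T"
proof -
  assume T: "T \<in> M"
  have "avg M (fst (- u)) e = (\<lambda>x. - avg M (fst u) e x)" for e
    by (rule ext) (simp add: avg_def sum_negf)
  then show ?thesis
    unfolding weak_grad_eq[OF T] by (simp add: edge_integral_uminus sum_negf)
qed

lemma weak_grad_zero: "T \<in> M \<Longrightarrow> weak_grad M (\<lambda>T x. 0, \<lambda>e x. 0) T = 0"
proof -
  assume T: "T \<in> M"
  have "avg M (\<lambda>T x. 0) e = (\<lambda>x. 0)" for e
    by (rule ext) (simp add: avg_def)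
  then show ?thesis
    unfolding weak_grad_eq[OF T] by (simp add: edge_integral_zero)
qed

text \<open>
  The two occurrences of \<open>a(u, v)\<close> cancel, and the jumps of \<open>v\<close> vanish.
\<close>

lemma G_h_eq_residual:
  assumes f: "f \<in> L2 \<Omega>" and u: "u \<in> H1 \<Omega>" and v: "v \<in> H1 \<Omega>"
    and c: "\<And>T x. T \<in> M \<Longrightarrow> lam\<^sub>h T x = c T"
  shows "G_h \<Omega> M f u u\<^sub>h lam\<^sub>h v = residual M f c (weak_grad M u\<^sub>h) v (grad \<Omega> v)"
proof -
  let ?g = "weak_grad M u\<^sub>h"
  have Lu: "(\<lambda>x. grad \<Omega> u x $ i) \<in> L2 \<Omega>" and Lv: "(\<lambda>x. grad \<Omega> v x $ i) \<in> L2 \<Omega>" and vL: "v \<in> L2 \<Omega>" for i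
    using grad_spec[OF u] grad_spec[OF v] by (simp_all add: has_weak_grad_def)
  note sub = L2_almost_subset[OF domain_measurable(1) triangle_topology(5) negligible_outside]
  have "jump M (\<lambda>T x. 0) e x = 0" for e x by (simp add: jump_def)
  then have "a_h_sum \<Omega> M (u, - u\<^sub>h) (v, (\<lambda>T x. 0, \<lambda>e x. 0)) =
      (\<Sum>T\<in>M. LINT x|lebesgue_on T. (grad \<Omega> u x + weak_grad M (- u\<^sub>h) T) \<bullet> (grad \<Omega> v x + weak_grad M (\<lambda>T x. 0, \<lambda>e x. 0) T))"
    by (simp add: a_h_sum_def edge_integral_zero)
  also have "\<dots> = (\<Sum>T\<in>M. (LINT x|lebesgue_on T. grad \<Omega> u x \<bullet> grad \<Omega> v x) -
      (\<Sum>i\<in>UNIV. ?g T $ i * (LINT x|lebesgue_on T. grad \<Omega> v x $ i)))"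
  proof (rule sum.cong[OF refl])
    fix T assume T: "T \<in> M"
    have LuT: "(\<lambda>x. grad \<Omega> u x $ i) \<in> L2 T" and LvT: "(\<lambda>x. grad \<Omega> v x $ i) \<in> L2 T" for i
      using sub[OF T T] Lu Lv by blast+
    have int: "integrable (lebesgue_on T) (\<lambda>x. grad \<Omega> v x $ i)" for i
      by (rule L2_integrable[OF triangle_topology(4)[OF T] LvT])
    have "(LINT x|lebesgue_on T. (grad \<Omega> u x + weak_grad M (- u\<^sub>h) T) \<bullet> (grad \<Omega> v x + weak_grad M (\<lambda>T x. 0, \<lambda>e x. 0) T))
        = (LINT x|lebesgue_on T. grad \<Omega> u x \<bullet> grad \<Omega> v x - (\<Sum>i\<in>UNIV. ?g T $ i * grad \<Omega> v x $ i))"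
      unfolding weak_grad_uminus[OF T] weak_grad_zero[OF T]
      by (simp add: inner_vec_def left_diff_distrib sum_subtractf)
    also have "\<dots> = (LINT x|lebesgue_on T. grad \<Omega> u x \<bullet> grad \<Omega> v x) - (\<Sum>i\<in>UNIV. ?g T $ i * (LINT x|lebesgue_on T. grad \<Omega> v x $ i))"
      using int L2_inner(1)[OF LuT LvT] by simp
    finally show "(LINT x|lebesgue_on T. (grad \<Omega> u x + weak_grad M (- u\<^sub>h) T) \<bullet> (grad \<Omega> v x + weak_grad M (\<lambda>T x. 0, \<lambda>e x. 0) T))
        = (LINT x|lebesgue_on T. grad \<Omega> u x \<bullet> grad \<Omega> v x) - (\<Sum>i\<in>UNIV. ?g T $ i * (LINT x|lebesgue_on T. grad \<Omega> v x $ i))" .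
  qed
  also have "\<dots> = a_form \<Omega> u v - (\<Sum>T\<in>M. \<Sum>i\<in>UNIV. ?g T $ i * (LINT x|lebesgue_on T. grad \<Omega> v x $ i))"
    unfolding sum_subtractf a_form_def sum_LINT_mesh[OF L2_inner(1)[OF Lu Lv]] ..
  finally have a: "a_h_sum \<Omega> M (u, - u\<^sub>h) (v, (\<lambda>T x. 0, \<lambda>e x. 0)) =
      a_form \<Omega> u v - (\<Sum>T\<in>M. \<Sum>i\<in>UNIV. ?g T $ i * (LINT x|lebesgue_on T. grad \<Omega> v x $ i))" .
  have L: "L_form \<Omega> f v = (\<Sum>T\<in>M. LINT x|lebesgue_on T. f x * v x)"
    unfolding L_form_def by (rule sum_LINT_mesh[OF L2_mult_integrable(1)[OF f vL], symmetric])
  have "(LINT x|lebesgue_on T. f x * v x) - (LINT x|lebesgue_on T. lam\<^sub>h T x * v x) = (LINT x|lebesgue_on T. (f x - c T) * v x)"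
    if T: "T \<in> M" for T
  proof -
    have "integrable (lebesgue_on T) (\<lambda>x. f x * v x)" by (rule L2_mult_integrable(1)[OF sub[OF T T f] sub[OF T T vL]])
    moreover have "integrable (lebesgue_on T) (\<lambda>x. c T * v x)"
      using L2_integrable[OF triangle_topology(4)[OF T] sub[OF T T vL]] by simp
    ultimately show ?thesis by (simp add: c[OF T] left_diff_distrib)
  qed
  then have "(\<Sum>T\<in>M. LINT x|lebesgue_on T. f x * v x) - (\<Sum>T\<in>M. LINT x|lebesgue_on T. lam\<^sub>h T x * v x) =
      (\<Sum>T\<in>M. LINT x|lebesgue_on T. (f x - c T) * v x)"
    unfolding sum_subtractf[symmetric] by (rule sum.cong[OF refl])
  then show ?thesis
    unfolding G_h_def a multiplier_def L sum_subtractf by simp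
qed

end

theorem lemma4p4:
  fixes \<Omega> :: "plane set" and F :: "mesh set"
  assumes "convex_polygonal_domain \<Omega>"
    and "\<forall>M\<in>F. mesh_of \<Omega> M"
    and "shape_regular F"
  shows "\<exists>C>0. \<forall>f \<psi> u M u\<^sub>h lam\<^sub>h.
           f \<in> L2 \<Omega> \<and> \<psi> \<in> H2 \<Omega> \<and> nonpos_on_boundary \<Omega> \<psi> \<and> obstacle_solution \<Omega> f \<psi> u \<and>
           M \<in> F \<and> discrete_solution M f \<psi> u\<^sub>h \<and> discrete_multiplier M f u\<^sub>h lam\<^sub>h
           \<longrightarrow> (Hm1_norm \<Omega> (G_h \<Omega> M f u u\<^sub>h lam\<^sub>h))\<^sup>2
                 \<le> ereal (C * ((eta1 M f u\<^sub>h lam\<^sub>h)\<^sup>2 + (eta2 M u\<^sub>h)\<^sup>2))"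
proof -
  obtain \<kappa> where \<kappa>: "\<kappa> > 0" "\<And>M T. M \<in> F \<Longrightarrow> T \<in> M \<Longrightarrow> \<exists>x. ball x (\<kappa> * diameter T) \<subseteq> T"
    using assms(3) unfolding shape_regular_def by blast
  \<comment> \<open>The stability constant depends on \<open>\<kappa>\<close> alone, hence can be fixed before the mesh.\<close>
  define C where "C = 2 * (16 + 16 / \<kappa>\<^sup>2 + 48 / \<kappa> ^ 6)"
  have "16 / \<kappa>\<^sup>2 \<ge> 0" "48 / \<kappa> ^ 6 \<ge> 0" by simp_all
  then have "0 < 16 + 16 / \<kappa>\<^sup>2 + 48 / \<kappa> ^ 6" by linarith
  then have C: "C > 0" unfolding C_def by (rule mult_pos_pos[rotated]) simp
  have "(Hm1_norm \<Omega> (G_h \<Omega> M f u u\<^sub>h lam\<^sub>h))\<^sup>2 \<le> ereal (C * ((eta1 M f u\<^sub>h lam\<^sub>h)\<^sup>2 + (eta2 M u\<^sub>h)\<^sup>2))"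
    if f: "f \<in> L2 \<Omega>" and u: "obstacle_solution \<Omega> f \<psi> u" and MF: "M \<in> F"
      and uh: "discrete_solution M f \<psi> u\<^sub>h" and lam: "discrete_multiplier M f u\<^sub>h lam\<^sub>h"
    for f \<psi> u M u\<^sub>h lam\<^sub>h
  proof -
    interpret shape_regular_mesh \<Omega> M \<kappa>
      using assms(1,2) MF \<kappa> by unfold_locales auto
    have CC: "C = 2 * stability_constant" unfolding C_def stability_constant_def ..
    have "\<forall>T\<in>M. \<exists>k. \<forall>x. lam\<^sub>h T x = k" using lam unfolding discrete_multiplier_def W_h_def by blast
    then obtain c where c: "\<And>T x. T \<in> M \<Longrightarrow> lam\<^sub>h T x = c T" by metis
    have uH: "u \<in> H10 \<Omega>" using u by (simp add: obstacle_solution_def K_set_def)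
    then have u1: "u \<in> H1 \<Omega>" by (simp add: H10_def)
    let ?R = "C * ((eta1 M f u\<^sub>h lam\<^sub>h)\<^sup>2 + (eta2 M u\<^sub>h)\<^sup>2)"
    let ?G = "G_h \<Omega> M f u u\<^sub>h lam\<^sub>h"
    have R0: "?R \<ge> 0" using C by simp
    have bound: "\<bar>?G v\<bar> \<le> sqrt ?R * H1_norm \<Omega> v" if v: "v \<in> H10 \<Omega>" for v
    proof -
      have v1: "v \<in> H1 \<Omega>" using v by (simp add: H10_def)
      have "\<bar>residual M f c (weak_grad M u\<^sub>h) v (grad \<Omega> v)\<bar> \<le> sqrt ?R * H1_norm \<Omega> v"
      proof (rule H10_bound_from_test_functions[OF domain_measurable(1) finite_mesh triangle_topology(4)
            negligible_outside weak_grad_mean_unique f _ _ v])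
        show "0 \<le> sqrt ?R" using R0 by simp
        show "\<bar>residual M f c (weak_grad M u\<^sub>h) \<phi> (classical_grad \<phi>)\<bar>
          \<le> sqrt ?R * sqrt (energy \<phi> \<Omega>)"
          if "\<phi> \<in> test_functions \<Omega>" for \<phi>
          unfolding CC by (rule residual_estimate_test_function[OF f uh lam c that])
      qed
      also have "residual M f c (weak_grad M u\<^sub>h) v (grad \<Omega> v) = ?G v"
        by (rule G_h_eq_residual[symmetric, OF f u1 v1 c])
      finally show ?thesis .
    qed
    have quot: "\<bar>?G v / H1_norm \<Omega> v\<bar> \<le> sqrt ?R" if v: "v \<in> H10 \<Omega>" for v
    proof (cases "H1_norm \<Omega> v = 0")
      case True
      then show ?thesis using R0 by simp
    next
      case False
      have "H1_norm \<Omega> v \<ge> 0"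
        unfolding H1_norm_def by (intro real_sqrt_ge_zero add_nonneg_nonneg Bochner_Integration.integral_nonneg) auto
      with False have "H1_norm \<Omega> v > 0" by simp
      then show ?thesis using bound[OF v] by (simp add: pos_divide_le_eq)
    qed
    obtain w where w: "w \<in> H10 \<Omega>" "\<not> (AE x in lebesgue_on \<Omega>. w x = 0)" using H10_nontrivial[OF uH] by blast
    show ?thesis
    proof (rule ereal_square_le_of_symmetric_bound)
      have "- sqrt ?R \<le> ?G w / H1_norm \<Omega> w" using quot[OF w(1)] by linarith
      then have "ereal (- sqrt ?R) \<le> ereal (?G w / H1_norm \<Omega> w)" by simp
      also have "\<dots> \<le> Hm1_norm \<Omega> ?G"
        unfolding Hm1_norm_def by (rule SUP_upper) (use w in simp)
      finally show "ereal (- sqrt ?R) \<le> Hm1_norm \<Omega> ?G" .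
      show "Hm1_norm \<Omega> ?G \<le> ereal (sqrt ?R)"
        unfolding Hm1_norm_def
      proof (rule SUP_least)
        fix v assume "v \<in> {v \<in> H10 \<Omega>. \<not> (AE x in lebesgue_on \<Omega>. v x = 0)}"
        then have "?G v / H1_norm \<Omega> v \<le> sqrt ?R" using quot[of v] abs_le_D1 by blast
        then show "ereal (?G v / H1_norm \<Omega> v) \<le> ereal (sqrt ?R)" by simp
      qed
      show "(sqrt ?R)\<^sup>2 \<le> ?R" using R0 by simp
    qed
  qed
  then show ?thesis using C by blast
qed

end
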